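(* Let $M(\phi,\xi,\eta,g_M)$ be a Sasakian manifold of dimension $2m+1$, $(N,g_N)$ a Riemannian manifold of dimension $n$, and $F:M(\phi,\xi,\eta,g_M)\to(N,g_N)$ an anti-invariant Riemannian submersion such that $\phi(\ker F_* )=(\ker F_* )^\perp$. Then $F$ is harmonic if and only if $\operatorname{Trace}\phi\mathcal{T}_V=(2m-n)\,\eta(V)$ for all $V\in\Gamma(\ker F_* )$.
   Context: A Sasakian manifold $M(\phi,\xi,\eta,g_M)$ is a smooth manifold with a $(1,1)$-tensor field $\phi$, a vector field $\xi$ (the characteristic vector field), a 1-form $\eta$ and a Riemannian metric $g_M$ such that $\phi^2=-I+\eta\otimes\xi$, $\phi\xi=0$, $\eta\circ\phi=0$, $\eta(\xi)=1$, $g_M(\phi X,\phi Y)=g_M(X,Y)-\eta(X)\eta(Y)$, $\eta(X)=g_M(X,\xi)$, and $(\nabla_X\phi)Y=g_M(X,Y)\xi-\eta(Y)X$, where $\nabla$ is the Levi-Civita connection of $g_M$ (so that $\nabla_X\xi=-\phi X$). A Riemannian submersion $F:(M,g_M)\to(N,g_N)$ is a smooth surjective map of maximal rank whose differential $F_*$ preserves lengths of horizontal vectors. Vertical means tangent to $\ker F_*$; horizontal means tangent to $(\ker F_* )^\perp$; $\mathcal V,\mathcal H$ are the corresponding orthogonal projections. $F$ is anti-invariant if $\phi(\ker F_* )\subseteq(\ker F_* )^\perp$. O'Neill's tensor $\mathcal T$ is $\mathcal{T}_EG=\mathcal{H}\nabla_{\mathcal{V}E}\mathcal{V}G+\mathcal{V}\nabla_{\mathcal{V}E}\mathcal{H}G$.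 For vertical $V$, $\operatorname{Trace}\phi\mathcal T_V=\sum_{i=1}^k g_M(\phi\mathcal T_Ve_i,e_i)$, where $e_1,\dots,e_k$ ($k=2m+1-n$) is a local orthonormal frame of $\ker F_*$. The second fundamental form of $F$ is $(\nabla F_* )(X,Y)=\nabla^F_XF_*(Y)-F_*(\nabla_XY)$ with $\nabla^F$ the pullback connection; $F$ is harmonic if the trace of $\nabla F_*$ over an orthonormal frame of $TM$ vanishes. *)

theory Defs
  imports "HOL-Analysis.Analysis"
begin

text \<open>Only used on open sets of finite-dimensional spaces. There, a function is of class
  \<open>C\<^sup>k\<^sup>+\<^sup>1\<close> iff it is differentiable and all its directional derivatives are of class \<open>C\<^sup>k\<close>.\<close>

primrec Ck_on :: "nat \<Rightarrow> 'a::real_normed_vector set \<Rightarrow> ('a \<Rightarrow> 'b::real_normed_vector) \<Rightarrow> bool" where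
  "Ck_on 0 S f \<longleftrightarrow> continuous_on S f"
| "Ck_on (Suc k) S f \<longleftrightarrow>
     (\<forall>x\<in>S. f differentiable (at x)) \<and> (\<forall>v. Ck_on k S (\<lambda>x. frechet_derivative f (at x) v))"

definition smooth_on :: "'a::real_normed_vector set \<Rightarrow> ('a \<Rightarrow> 'b::real_normed_vector) \<Rightarrow> bool" where
  "smooth_on S f \<longleftrightarrow> (\<forall>k. Ck_on k S f)"

text \<open>A chart is a pair of its domain and its coordinate map. The model space \<open>'e\<close> is a
  finite-dimensional real inner product space, and the dimension of the manifold is that of \<open>'e\<close>.
  The class \<^class>\<open>real_inner\<close> is used instead of \<^class>\<open>euclidean_space\<close> because the latter
  excludes dimension 0.\<close>

type_synonym ('a, 'e) chart = "'a set \<times> ('a \<Rightarrow> 'e)"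

record ('a, 'e) manifold =
  mtop :: "'a topology"
  atlas :: "('a, 'e) chart set"

abbreviation points :: "('a, 'e) manifold \<Rightarrow> 'a set" where
  "points M \<equiv> topspace (mtop M)"

abbreviation mopen :: "('a, 'e) manifold \<Rightarrow> 'a set \<Rightarrow> bool" where
  "mopen M \<equiv> openin (mtop M)"

locale smooth_manifold =
  fixes M :: "('a, 'e::real_inner) manifold"
  assumes finite_dim: "\<exists>B::'e set. finite B \<and> span B = UNIV"
    and Hausdorff: "Hausdorff_space (mtop M)"
    and second_countable: "second_countable (mtop M)"
    and chart: "\<And>U c. (U, c) \<in> atlas M \<Longrightarrow>
      mopen M U \<and> open (c ` U) \<and> homeomorphic_map (subtopology (mtop M) U) (top_of_set (c ` U)) c"
    and covering: "points M = (\<Union>(U, c)\<in>atlas M. U)"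
    and compatible: "\<And>U c V d. (U, c) \<in> atlas M \<Longrightarrow> (V, d) \<in> atlas M \<Longrightarrow>
      smooth_on (c ` (U \<inter> V)) (d \<circ> inv_into U c)"

definition smooth_fun ::
    "('a, 'e::real_normed_vector) manifold \<Rightarrow> 'a set \<Rightarrow> ('a \<Rightarrow> 'b::real_normed_vector) \<Rightarrow> bool" where
  "smooth_fun M U f \<longleftrightarrow> (\<forall>(W, c)\<in>atlas M. smooth_on (c ` (U \<inter> W)) (f \<circ> inv_into W c))"

text \<open>The tangent space at every point \<open>p\<close> is \<open>'e\<close>: a vector \<open>u :: 'e\<close> stands for the tangent vector
  that has coordinates \<open>u\<close> in the chart \<open>chart_at M p\<close>, which is chosen once and for all. No
  continuity of the choice in \<open>p\<close> is required.\<close>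

definition chart_at :: "('a, 'e) manifold \<Rightarrow> 'a \<Rightarrow> ('a, 'e) chart" where
  "chart_at M p = (SOME C. C \<in> atlas M \<and> p \<in> fst C)"

definition dir_deriv ::
    "('a, 'e::real_normed_vector) manifold \<Rightarrow> 'a \<Rightarrow> 'e \<Rightarrow> ('a \<Rightarrow> 'b::real_normed_vector) \<Rightarrow> 'b" where
  "dir_deriv M p u f =
     (case chart_at M p of (W, c) \<Rightarrow> frechet_derivative (f \<circ> inv_into W c) (at (c p)) u)"

text \<open>For a chart \<open>(W, c)\<close> and \<open>p \<in> W\<close>, \<open>dir_deriv M p u c\<close> is the coordinate vector of the
  tangent vector \<open>u\<close> in that chart. So a vector field is smooth iff its coordinates in each chart
  are smooth functions.\<close>

definition vector_field ::
    "('a, 'e::real_normed_vector) manifold \<Rightarrow> 'a set \<Rightarrow> ('a \<Rightarrow> 'e) \<Rightarrow> bool" where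
  "vector_field M U X \<longleftrightarrow>
     (\<forall>(W, c)\<in>atlas M. smooth_fun M (U \<inter> W) (\<lambda>p. dir_deriv M p (X p) c))"

text \<open>\<open>[X, Y]\<close> is determined by \<open>[X, Y] f = X (Y f) - Y (X f)\<close>; taking for \<open>f\<close> the coordinate map of
  \<open>chart_at M p\<close> yields the element of \<open>'e\<close> that represents it at \<open>p\<close>.\<close>

definition lie_bracket ::
    "('a, 'e::real_normed_vector) manifold \<Rightarrow> ('a \<Rightarrow> 'e) \<Rightarrow> ('a \<Rightarrow> 'e) \<Rightarrow> 'a \<Rightarrow> 'e" where
  "lie_bracket M X Y p = (let c = snd (chart_at M p) in
     dir_deriv M p (X p) (\<lambda>q. dir_deriv M q (Y q) c) -
     dir_deriv M p (Y p) (\<lambda>q. dir_deriv M q (X q) c))"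

definition smooth_map ::
    "('a, 'e::real_normed_vector) manifold \<Rightarrow> ('b, 'f::real_normed_vector) manifold \<Rightarrow>
     ('a \<Rightarrow> 'b) \<Rightarrow> bool" where
  "smooth_map M N F \<longleftrightarrow> continuous_map (mtop M) (mtop N) F \<and>
     (\<forall>(V, d)\<in>atlas N. smooth_fun M (points M \<inter> F -` V) (d \<circ> F))"

definition differential ::
    "('a, 'e::real_normed_vector) manifold \<Rightarrow> ('b, 'f::real_normed_vector) manifold \<Rightarrow>
     ('a \<Rightarrow> 'b) \<Rightarrow> 'a \<Rightarrow> 'e \<Rightarrow> 'f" where
  "differential M N F p u = dir_deriv M p u (snd (chart_at N (F p)) \<circ> F)"

text \<open>Smooth sections over \<open>U\<close> of the pullback bundle \<open>F\<^sup>*TN\<close>, where \<open>s p\<close> is tangent to \<open>N\<close> at \<open>F p\<close>.\<close>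

definition section_along ::
    "('a, 'e::real_normed_vector) manifold \<Rightarrow> ('b, 'f::real_normed_vector) manifold \<Rightarrow>
     ('a \<Rightarrow> 'b) \<Rightarrow> 'a set \<Rightarrow> ('a \<Rightarrow> 'f) \<Rightarrow> bool" where
  "section_along M N F U s \<longleftrightarrow>
     (\<forall>(V, d)\<in>atlas N. smooth_fun M (U \<inter> F -` V) (\<lambda>p. dir_deriv N (F p) (s p) d))"

text \<open>\<open>\<Gamma> U s\<close> says that \<open>s\<close> is a smooth section over the open set \<open>U\<close> of a vector bundle over \<open>M\<close>, and
  \<open>D p u s\<close> is the covariant derivative at \<open>p\<close> of \<open>s\<close>, defined near \<open>p\<close>, along the tangent vector \<open>u\<close>.\<close>

definition is_connection ::
    "('a, 'e::real_normed_vector) manifold \<Rightarrow> ('a set \<Rightarrow> ('a \<Rightarrow> 'v::real_normed_vector) \<Rightarrow> bool) \<Rightarrow>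
     ('a \<Rightarrow> 'e \<Rightarrow> ('a \<Rightarrow> 'v) \<Rightarrow> 'v) \<Rightarrow> bool" where
  "is_connection M \<Gamma> D \<longleftrightarrow>
     (\<forall>U X s. mopen M U \<and> vector_field M U X \<and> \<Gamma> U s \<longrightarrow> \<Gamma> U (\<lambda>p. D p (X p) s)) \<and>
     (\<forall>U s. mopen M U \<and> \<Gamma> U s \<longrightarrow> (\<forall>p\<in>U. linear (\<lambda>u. D p u s))) \<and>
     (\<forall>U s t. mopen M U \<and> \<Gamma> U s \<and> \<Gamma> U t \<and> (\<forall>q\<in>U. s q = t q) \<longrightarrow>
        (\<forall>p\<in>U. \<forall>u. D p u s = D p u t)) \<and>
     (\<forall>U s t. mopen M U \<and> \<Gamma> U s \<and> \<Gamma> U t \<longrightarrow>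
        (\<forall>p\<in>U. \<forall>u. D p u (\<lambda>q. s q + t q) = D p u s + D p u t)) \<and>
     (\<forall>U s f. mopen M U \<and> \<Gamma> U s \<and> smooth_fun M U f \<longrightarrow>
        (\<forall>p\<in>U. \<forall>u. D p u (\<lambda>q. f q *\<^sub>R s q) = dir_deriv M p u f *\<^sub>R s p + f p *\<^sub>R D p u s))"

locale riemannian_manifold = smooth_manifold M
  for M :: "('a, 'e::real_inner) manifold" +
  fixes g :: "'a \<Rightarrow> 'e \<Rightarrow> 'e \<Rightarrow> real"
  assumes metric_bilinear: "p \<in> points M \<Longrightarrow> bilinear (g p)"
    and metric_sym: "p \<in> points M \<Longrightarrow> g p u v = g p v u"
    and metric_pos: "p \<in> points M \<Longrightarrow> u \<noteq> 0 \<Longrightarrow> g p u u > 0"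
    and metric_smooth: "mopen M U \<Longrightarrow> vector_field M U X \<Longrightarrow> vector_field M U Y \<Longrightarrow>
      smooth_fun M U (\<lambda>p. g p (X p) (Y p))"

definition levi_civita ::
    "('a, 'e::real_inner) manifold \<Rightarrow> ('a \<Rightarrow> 'e \<Rightarrow> 'e \<Rightarrow> real) \<Rightarrow>
     ('a \<Rightarrow> 'e \<Rightarrow> ('a \<Rightarrow> 'e) \<Rightarrow> 'e) \<Rightarrow> bool" where
  "levi_civita M g D \<longleftrightarrow> is_connection M (vector_field M) D \<and>
     (\<forall>U X Y. mopen M U \<and> vector_field M U X \<and> vector_field M U Y \<longrightarrow>
        (\<forall>p\<in>U. D p (X p) Y - D p (Y p) X = lie_bracket M X Y p)) \<and>
     (\<forall>U X Y. mopen M U \<and> vector_field M U X \<and> vector_field M U Y \<longrightarrow>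
        (\<forall>p\<in>U. \<forall>u. dir_deriv M p u (\<lambda>q. g q (X q) (Y q)) =
                    g p (D p u X) (Y p) + g p (X p) (D p u Y)))"

text \<open>\<open>DF\<close> is the pullback to \<open>F\<^sup>*TN\<close> of the connection \<open>DN\<close> on \<open>N\<close>, that is, the unique connection
  with \<open>DF\<^sub>u (Z \<circ> F) = DN\<^bsub>F\<^sub>* u\<^esub> Z\<close>.\<close>

definition pullback_connection ::
    "('a, 'e::real_normed_vector) manifold \<Rightarrow> ('b, 'f::real_normed_vector) manifold \<Rightarrow>
     ('a \<Rightarrow> 'b) \<Rightarrow> ('b \<Rightarrow> 'f \<Rightarrow> ('b \<Rightarrow> 'f) \<Rightarrow> 'f) \<Rightarrow> ('a \<Rightarrow> 'e \<Rightarrow> ('a \<Rightarrow> 'f) \<Rightarrow> 'f) \<Rightarrow> bool" where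
  "pullback_connection M N F DN DF \<longleftrightarrow> is_connection M (section_along M N F) DF \<and>
     (\<forall>W Z p u. mopen N W \<and> vector_field N W Z \<and> p \<in> points M \<and> F p \<in> W \<longrightarrow>
        DF p u (Z \<circ> F) = DN (F p) (differential M N F p u) Z)"

definition orthonormal_frame ::
    "('a, 'e::real_inner) manifold \<Rightarrow> ('a \<Rightarrow> 'e \<Rightarrow> 'e \<Rightarrow> real) \<Rightarrow> ('a \<Rightarrow> 'e set) \<Rightarrow>
     'a set \<Rightarrow> nat \<Rightarrow> (nat \<Rightarrow> 'a \<Rightarrow> 'e) \<Rightarrow> bool" where
  "orthonormal_frame M g \<Delta> U k e \<longleftrightarrow> mopen M U \<and> (\<forall>i<k. vector_field M U (e i)) \<and>
     (\<forall>p\<in>U. (\<forall>i<k. \<forall>j<k. g p (e i p) (e j p) = (if i = j then 1 else 0)) \<and>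
            span ((\<lambda>i. e i p) ` {..<k}) = \<Delta> p)"

locale sasakian_manifold = riemannian_manifold M g
  for M :: "('a, 'e::real_inner) manifold" and g +
  fixes D :: "'a \<Rightarrow> 'e \<Rightarrow> ('a \<Rightarrow> 'e) \<Rightarrow> 'e"
    and \<phi> :: "'a \<Rightarrow> 'e \<Rightarrow> 'e" and \<xi> :: "'a \<Rightarrow> 'e" and \<eta> :: "'a \<Rightarrow> 'e \<Rightarrow> real"
  assumes levi_civita: "levi_civita M g D"
    and phi_linear: "p \<in> points M \<Longrightarrow> linear (\<phi> p)"
    and phi_smooth: "mopen M U \<Longrightarrow> vector_field M U X \<Longrightarrow> vector_field M U (\<lambda>p. \<phi> p (X p))"
    and xi_smooth: "vector_field M (points M) \<xi>"
    and eta_linear: "p \<in> points M \<Longrightarrow> linear (\<eta> p)"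
    and eta_smooth: "mopen M U \<Longrightarrow> vector_field M U X \<Longrightarrow> smooth_fun M U (\<lambda>p. \<eta> p (X p))"
    and phi_phi: "p \<in> points M \<Longrightarrow> \<phi> p (\<phi> p u) = - u + \<eta> p u *\<^sub>R \<xi> p"
    and phi_xi: "p \<in> points M \<Longrightarrow> \<phi> p (\<xi> p) = 0"
    and eta_phi: "p \<in> points M \<Longrightarrow> \<eta> p (\<phi> p u) = 0"
    and eta_xi: "p \<in> points M \<Longrightarrow> \<eta> p (\<xi> p) = 1"
    and metric_phi: "p \<in> points M \<Longrightarrow> g p (\<phi> p u) (\<phi> p v) = g p u v - \<eta> p u * \<eta> p v"
    and eta_metric: "p \<in> points M \<Longrightarrow> \<eta> p u = g p u (\<xi> p)"
    and nabla_phi: "mopen M U \<Longrightarrow> vector_field M U Y \<Longrightarrow> p \<in> U \<Longrightarrow>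
      D p u (\<lambda>q. \<phi> q (Y q)) - \<phi> p (D p u Y) = g p u (Y p) *\<^sub>R \<xi> p - \<eta> p (Y p) *\<^sub>R u"

definition vertical ::
    "('a, 'e::real_normed_vector) manifold \<Rightarrow> ('b, 'f::real_normed_vector) manifold \<Rightarrow>
     ('a \<Rightarrow> 'b) \<Rightarrow> 'a \<Rightarrow> 'e set" where
  "vertical M N F p = {u. differential M N F p u = 0}"

definition horizontal ::
    "('a, 'e::real_normed_vector) manifold \<Rightarrow> ('a \<Rightarrow> 'e \<Rightarrow> 'e \<Rightarrow> real) \<Rightarrow>
     ('b, 'f::real_normed_vector) manifold \<Rightarrow> ('a \<Rightarrow> 'b) \<Rightarrow> 'a \<Rightarrow> 'e set" where
  "horizontal M g N F p = {u. \<forall>v\<in>vertical M N F p. g p u v = 0}"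

definition ver ::
    "('a, 'e::real_normed_vector) manifold \<Rightarrow> ('a \<Rightarrow> 'e \<Rightarrow> 'e \<Rightarrow> real) \<Rightarrow>
     ('b, 'f::real_normed_vector) manifold \<Rightarrow> ('a \<Rightarrow> 'b) \<Rightarrow> 'a \<Rightarrow> 'e \<Rightarrow> 'e" where
  "ver M g N F p u = (THE v. v \<in> vertical M N F p \<and> u - v \<in> horizontal M g N F p)"

definition hor ::
    "('a, 'e::real_normed_vector) manifold \<Rightarrow> ('a \<Rightarrow> 'e \<Rightarrow> 'e \<Rightarrow> real) \<Rightarrow>
     ('b, 'f::real_normed_vector) manifold \<Rightarrow> ('a \<Rightarrow> 'b) \<Rightarrow> 'a \<Rightarrow> 'e \<Rightarrow> 'e" where
  "hor M g N F p u = (THE v. v \<in> horizontal M g N F p \<and> u - v \<in> vertical M N F p)"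

definition riemannian_submersion ::
    "('a, 'e::real_normed_vector) manifold \<Rightarrow> ('a \<Rightarrow> 'e \<Rightarrow> 'e \<Rightarrow> real) \<Rightarrow>
     ('b, 'f::real_normed_vector) manifold \<Rightarrow> ('b \<Rightarrow> 'f \<Rightarrow> 'f \<Rightarrow> real) \<Rightarrow> ('a \<Rightarrow> 'b) \<Rightarrow> bool" where
  "riemannian_submersion M g N h F \<longleftrightarrow> smooth_map M N F \<and> F ` points M = points N \<and>
     (\<forall>p\<in>points M. surj (differential M N F p) \<and>
        (\<forall>u\<in>horizontal M g N F p.
           h (F p) (differential M N F p u) (differential M N F p u) = g p u u))"

definition anti_invariant ::
    "('a, 'e::real_normed_vector) manifold \<Rightarrow> ('a \<Rightarrow> 'e \<Rightarrow> 'e \<Rightarrow> real) \<Rightarrow> ('a \<Rightarrow> 'e \<Rightarrow> 'e) \<Rightarrow>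
     ('b, 'f::real_normed_vector) manifold \<Rightarrow> ('a \<Rightarrow> 'b) \<Rightarrow> bool" where
  "anti_invariant M g \<phi> N F \<longleftrightarrow>
     (\<forall>p\<in>points M. \<phi> p ` vertical M N F p \<subseteq> horizontal M g N F p)"

definition oneill_T ::
    "('a, 'e::real_normed_vector) manifold \<Rightarrow> ('a \<Rightarrow> 'e \<Rightarrow> 'e \<Rightarrow> real) \<Rightarrow>
     ('a \<Rightarrow> 'e \<Rightarrow> ('a \<Rightarrow> 'e) \<Rightarrow> 'e) \<Rightarrow> ('b, 'f::real_normed_vector) manifold \<Rightarrow> ('a \<Rightarrow> 'b) \<Rightarrow>
     ('a \<Rightarrow> 'e) \<Rightarrow> ('a \<Rightarrow> 'e) \<Rightarrow> 'a \<Rightarrow> 'e" where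
  "oneill_T M g D N F E G p =
     hor M g N F p (D p (ver M g N F p (E p)) (\<lambda>q. ver M g N F q (G q))) +
     ver M g N F p (D p (ver M g N F p (E p)) (\<lambda>q. hor M g N F q (G q)))"

definition trace_phi_T ::
    "('a, 'e::real_normed_vector) manifold \<Rightarrow> ('a \<Rightarrow> 'e \<Rightarrow> 'e \<Rightarrow> real) \<Rightarrow>
     ('a \<Rightarrow> 'e \<Rightarrow> ('a \<Rightarrow> 'e) \<Rightarrow> 'e) \<Rightarrow> ('a \<Rightarrow> 'e \<Rightarrow> 'e) \<Rightarrow>
     ('b, 'f::real_normed_vector) manifold \<Rightarrow> ('a \<Rightarrow> 'b) \<Rightarrow>
     nat \<Rightarrow> (nat \<Rightarrow> 'a \<Rightarrow> 'e) \<Rightarrow> ('a \<Rightarrow> 'e) \<Rightarrow> 'a \<Rightarrow> real" where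
  "trace_phi_T M g D \<phi> N F k e V p =
     (\<Sum>i<k. g p (\<phi> p (oneill_T M g D N F V (e i) p)) (e i p))"

definition second_fundamental_form ::
    "('a, 'e::real_normed_vector) manifold \<Rightarrow> ('a \<Rightarrow> 'e \<Rightarrow> ('a \<Rightarrow> 'e) \<Rightarrow> 'e) \<Rightarrow>
     ('b, 'f::real_normed_vector) manifold \<Rightarrow> ('a \<Rightarrow> 'b) \<Rightarrow> ('a \<Rightarrow> 'e \<Rightarrow> ('a \<Rightarrow> 'f) \<Rightarrow> 'f) \<Rightarrow>
     ('a \<Rightarrow> 'e) \<Rightarrow> ('a \<Rightarrow> 'e) \<Rightarrow> 'a \<Rightarrow> 'f" where
  "second_fundamental_form M D N F DF X Y p =
     DF p (X p) (\<lambda>q. differential M N F q (Y q)) - differential M N F p (D p (X p) Y)"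

definition harmonic ::
    "('a, 'e::real_inner) manifold \<Rightarrow> ('a \<Rightarrow> 'e \<Rightarrow> 'e \<Rightarrow> real) \<Rightarrow>
     ('a \<Rightarrow> 'e \<Rightarrow> ('a \<Rightarrow> 'e) \<Rightarrow> 'e) \<Rightarrow> ('b, 'f::real_normed_vector) manifold \<Rightarrow> ('a \<Rightarrow> 'b) \<Rightarrow>
     ('a \<Rightarrow> 'e \<Rightarrow> ('a \<Rightarrow> 'f) \<Rightarrow> 'f) \<Rightarrow> bool" where
  "harmonic M g D N F DF \<longleftrightarrow>
     (\<forall>U e. orthonormal_frame M g (\<lambda>p. UNIV) U (dim (UNIV :: 'e set)) e \<longrightarrow>
        (\<forall>p\<in>U. (\<Sum>i<dim (UNIV :: 'e set). second_fundamental_form M D N F DF (e i) (e i) p) = 0))"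

end

theory Submission
  imports Defs
begin

text \<open>Let \<open>e\<^sub>i\<close> be a local orthonormal frame of \<open>ker F\<^sub>*\<close>. The second fundamental form \<open>\<nabla>F\<^sub>*\<close> is symmetric,
  since the pullback connection is torsion free, and vanishes on horizontal vectors, since that
  connection is also metric. So the trace of \<open>\<nabla>F\<^sub>*\<close> over an orthonormal frame adapted to the splitting
  into horizontal and vertical vectors is \<open>- F\<^sub>*(\<Sum>\<nabla>\<^bsub>e\<^sub>i\<^esub> e\<^sub>i)\<close>, and \<open>F\<close> is harmonic iff
  \<open>\<Sum>\<nabla>\<^bsub>e\<^sub>i\<^esub> e\<^sub>i\<close> is vertical. On the other hand, \<open>\<nabla>\<^sub>V e\<^sub>i - \<nabla>\<^bsub>e\<^sub>i\<^esub> V\<close> is vertical and \<open>\<phi>\<close> is skew and maps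
  vertical to horizontal vectors, so the formula for \<open>\<nabla>\<phi>\<close> gives
  \<open>Trace \<phi>T\<^sub>V = (k - 1) \<eta>(V) - g(\<phi>V, \<Sum>\<nabla>\<^bsub>e\<^sub>i\<^esub> e\<^sub>i)\<close> with \<open>k - 1 = 2m - n\<close>. As \<open>\<phi>V\<close> ranges over all horizontal
  vectors, the last term vanishes for all \<open>V\<close> iff \<open>\<Sum>\<nabla>\<^bsub>e\<^sub>i\<^esub> e\<^sub>i\<close> is vertical.\<close>

section \<open>Functions of class \<open>C\<^sup>k\<close> on open sets\<close>

text \<open>Tangent vectors at \<open>p\<close> are coordinates in a chart picked at
  \<open>p\<close>, and the pick may jump, so a field cannot be differentiated as a function; every
  derivative passes through \<open>dir_deriv\<close> of a chart map. \<open>Ck_on\<close> in turn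
  controls derivatives in fixed directions only, so varying directions are expanded in a finite
  orthonormal basis. The pullback connection is given by axioms that prescribe it on sections
  \<open>Z \<circ> F\<close>. That it is torsion free and metric must be derived, by expanding
  arbitrary sections in pulled back coordinate fields. Harmonicity speaks of every orthonormal
  frame, so adapted frames must exist near each point and the trace must not depend on the frame,
  although \<open>second_fundamental_form\<close> takes fields and not vectors. The trace condition
  speaks of global vertical fields, so for the converse a vertical vector is extended by means of a
  bump function, up to a positive factor. In the constant, \<open>k\<close> counts the terms
  \<open>\<eta>(V)\<close>, one for each \<open>e_i\<close>, and the \<open>- 1\<close> comes from
  \<open>\<Sum>\<eta>(e_i) g(e_i, V) = \<eta>(V)\<close>.\<close>

lemma has_derivative_cong_open:
  assumes "open S" "x \<in> S" "\<And>y. y \<in> S \<Longrightarrow> f y = g y"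
  shows "(f has_derivative f') (at x) \<longleftrightarrow> (g has_derivative f') (at x)"
  using assms has_derivative_transform_within_open by metis

lemma frechet_derivative_cong_open:
  assumes "open S" "x \<in> S" "\<And>y. y \<in> S \<Longrightarrow> f y = g y"
  shows "frechet_derivative f (at x) = frechet_derivative g (at x)"
  unfolding frechet_derivative_def using has_derivative_cong_open[OF assms] by simp

lemma differentiable_cong_open:
  assumes "open S" "x \<in> S" "\<And>y. y \<in> S \<Longrightarrow> f y = g y"
  shows "f differentiable (at x) \<longleftrightarrow> g differentiable (at x)"
  unfolding differentiable_def using has_derivative_cong_open[OF assms] by simp

lemma frechet_derivative_eqI:
  "(f has_derivative f') (at x) \<Longrightarrow> frechet_derivative f (at x) = f'"
  by (metis frechet_derivative_at)

lemma Ck_on_cong: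
  assumes "open S" "\<And>x. x \<in> S \<Longrightarrow> f x = g x" "Ck_on k S f"
  shows "Ck_on k S g"
  using assms(2,3)
proof (induction k arbitrary: f g)
  case 0
  then show ?case by (metis Ck_on.simps(1) continuous_on_cong)
next
  case (Suc k)
  show ?case unfolding Ck_on.simps
  proof (intro conjI ballI allI)
    fix x assume "x \<in> S"
    then show "g differentiable at x"
      using Suc.prems differentiable_cong_open[OF assms(1) _ Suc.prems(1)] by auto
  next
    fix v
    show "Ck_on k S (\<lambda>x. frechet_derivative g (at x) v)"
      by (rule Suc.IH[of "\<lambda>x. frechet_derivative f (at x) v"])
        (use Suc.prems frechet_derivative_cong_open[OF assms(1) _ Suc.prems(1)] in auto)
  qed
qed

lemma Ck_on_subset: "Ck_on k S f \<Longrightarrow> T \<subseteq> S \<Longrightarrow> Ck_on k T f"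
  by (induction k arbitrary: f) (auto intro: continuous_on_subset)

lemma Ck_on_SucD: "Ck_on (Suc k) S f \<Longrightarrow> Ck_on k S f"
  by (induction k arbitrary: f)
    (auto intro!: continuous_at_imp_continuous_on dest: differentiable_imp_continuous_within)

text \<open>Derivatives in \<open>Ck_on\<close> are taken in the whole space, not within
  \<open>S\<close>, so being of class C^k can be tested near each point, even for a set
  \<open>S\<close> that is not open.\<close>

lemma Ck_on_local:
  assumes "\<And>x. x \<in> S \<Longrightarrow> \<exists>T. open T \<and> x \<in> T \<and> Ck_on k T f"
  shows "Ck_on k S f"
  using assms
proof (induction k arbitrary: f)
  case 0
  show ?case unfolding Ck_on.simps
  proof (rule continuous_at_imp_continuous_on, rule ballI)
    fix x assume "x \<in> S"
    with 0 obtain T where "open T" "x \<in> T" "continuous_on T f" by auto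
    then show "isCont f x" by (simp add: continuous_on_eq_continuous_at)
  qed
next
  case (Suc k)
  show ?case unfolding Ck_on.simps
  proof (intro conjI ballI allI)
    fix x assume "x \<in> S"
    then show "f differentiable at x" using Suc.prems by fastforce
  next
    fix v
    show "Ck_on k S (\<lambda>x. frechet_derivative f (at x) v)"
      by (rule Suc.IH) (use Suc.prems in fastforce)
  qed
qed

lemma Ck_on_const [simp]: "Ck_on k S (\<lambda>x. c)"
  by (induction k arbitrary: c) auto

lemma Ck_on_bounded_linear:
  assumes "open S" "bounded_linear L" "Ck_on k S f"
  shows "Ck_on k S (\<lambda>x. L (f x))"
  using assms(3)
proof (induction k arbitrary: f)
  case 0
  then show ?case by (simp add: bounded_linear.continuous_on[OF assms(2)])
next
  case (Suc k)
  have *: "((\<lambda>x. L (f x)) has_derivative (\<lambda>v. L (frechet_derivative f (at x) v))) (at x)" if "x \<in> S" for x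
    using Suc.prems that by (auto intro!: bounded_linear.has_derivative[OF assms(2)] simp: frechet_derivative_works)
  show ?case unfolding Ck_on.simps
  proof (intro conjI ballI allI)
    fix x assume "x \<in> S"
    then show "(\<lambda>x. L (f x)) differentiable at x" using * differentiable_def by blast
  next
    fix v
    show "Ck_on k S (\<lambda>x. frechet_derivative (\<lambda>x. L (f x)) (at x) v)"
      by (rule Ck_on_cong[OF assms(1) _ Suc.IH[of "\<lambda>x. frechet_derivative f (at x) v"]])
        (use Suc.prems in \<open>auto simp: frechet_derivative_eqI[OF *]\<close>)
  qed
qed

lemma Ck_on_add:
  assumes "open S" "Ck_on k S f" "Ck_on k S g"
  shows "Ck_on k S (\<lambda>x. f x + g x)"
  using assms(2,3)
proof (induction k arbitrary: f g)
  case 0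
  then show ?case by (simp add: continuous_on_add)
next
  case (Suc k)
  have *: "((\<lambda>x. f x + g x) has_derivative
      (\<lambda>v. frechet_derivative f (at x) v + frechet_derivative g (at x) v)) (at x)" if "x \<in> S" for x
    using Suc.prems that by (auto intro!: derivative_eq_intros simp: frechet_derivative_works)
  show ?case unfolding Ck_on.simps
  proof (intro conjI ballI allI)
    fix x assume "x \<in> S"
    then show "(\<lambda>x. f x + g x) differentiable at x" using * differentiable_def by blast
  next
    fix v
    show "Ck_on k S (\<lambda>x. frechet_derivative (\<lambda>x. f x + g x) (at x) v)"
      by (rule Ck_on_cong[OF assms(1) _ Suc.IH[of "\<lambda>x. frechet_derivative f (at x) v"
          "\<lambda>x. frechet_derivative g (at x) v"]])
        (use Suc.prems in \<open>auto simp: frechet_derivative_eqI[OF *]\<close>)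
  qed
qed

lemma Ck_on_scaleR:
  fixes f :: "_ \<Rightarrow> real"
  assumes "open S" "Ck_on k S f" "Ck_on k S g"
  shows "Ck_on k S (\<lambda>x. f x *\<^sub>R g x)"
  using assms(2,3)
proof (induction k arbitrary: f g)
  case 0
  then show ?case by (simp add: continuous_on_scaleR)
next
  case (Suc k)
  have *: "((\<lambda>x. f x *\<^sub>R g x) has_derivative
      (\<lambda>v. f x *\<^sub>R frechet_derivative g (at x) v + frechet_derivative f (at x) v *\<^sub>R g x)) (at x)" if "x \<in> S" for x
    using Suc.prems that by (auto intro!: has_derivative_scaleR simp: frechet_derivative_works)
  show ?case unfolding Ck_on.simps
  proof (intro conjI ballI allI)
    fix x assume "x \<in> S"
    then show "(\<lambda>x. f x *\<^sub>R g x) differentiable at x" using * differentiable_def by blast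
  next
    fix v
    \<comment> \<open>Each Leibniz term pairs a derivative with an undifferentiated factor, so both
      factors are lowered from class k + 1 to class k.\<close>
    have "Ck_on k S f" "Ck_on k S g" using Suc.prems Ck_on_SucD by blast+
    then have "Ck_on k S (\<lambda>x. f x *\<^sub>R frechet_derivative g (at x) v + frechet_derivative f (at x) v *\<^sub>R g x)"
      using Suc.prems by (intro Ck_on_add[OF assms(1)] Suc.IH) auto
    then show "Ck_on k S (\<lambda>x. frechet_derivative (\<lambda>x. f x *\<^sub>R g x) (at x) v)"
      by (rule Ck_on_cong[OF assms(1), rotated]) (auto simp: frechet_derivative_eqI[OF *])
  qed
qed

lemma Ck_on_sum:
  assumes "open S" "\<And>i. i \<in> I \<Longrightarrow> Ck_on k S (f i)"
  shows "Ck_on k S (\<lambda>x. \<Sum>i\<in>I. f i x)"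
  using assms(2) by (induction I rule: infinite_finite_induct) (auto intro: Ck_on_add[OF assms(1)])

section \<open>Orthonormal bases of the model spaces and the chain rule\<close>

text \<open>A predicate on a type and not a class, so that the locale axiom
  \<open>finite_dim\<close> can supply it while dimension 0 stays allowed.\<close>

definition fin_dim :: "'a::real_vector itself \<Rightarrow> bool" where
  "fin_dim _ \<longleftrightarrow> (\<exists>B::'a set. finite B \<and> span B = UNIV)"

lemma orthonormal_expansion:
  fixes B :: "'a::real_inner set"
  assumes "finite B" "pairwise orthogonal B" "\<And>b. b \<in> B \<Longrightarrow> norm b = 1" "x \<in> span B"
  shows "(\<Sum>b\<in>B. (x \<bullet> b) *\<^sub>R b) = x"
proof -
  from assms(1,4) obtain c where x: "x = (\<Sum>b\<in>B. c b *\<^sub>R b)"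
    by (auto simp: span_finite)
  have "x \<bullet> b = c b" if "b \<in> B" for b
  proof -
    have "x \<bullet> b = (\<Sum>a\<in>B. c a * (a \<bullet> b))"
      by (simp add: x inner_sum_left)
    also have "\<dots> = (\<Sum>a\<in>B. if a = b then c b else 0)"
      using assms(2,3) that by (intro sum.cong) (auto simp: pairwise_def orthogonal_def dot_square_norm)
    finally show ?thesis using that assms(1) by simp
  qed
  then have "(\<Sum>b\<in>B. (x \<bullet> b) *\<^sub>R b) = (\<Sum>b\<in>B. c b *\<^sub>R b)" by (intro sum.cong) auto
  then show ?thesis using x by simp
qed

text \<open>The residual \<open>y\<close> of the new vector is either zero, and the vector is
  redundant, or it is normalized and added.\<close>

lemma gram_schmidt_set:
  fixes B :: "'a::real_inner set"
  assumes "finite B"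
  shows "\<exists>C. finite C \<and> pairwise orthogonal C \<and> (\<forall>b\<in>C. norm b = 1) \<and> span C = span B"
  using assms
proof (induction B)
  case empty
  then show ?case by (intro exI[of _ "{}"]) auto
next
  case (insert x B)
  then obtain C where C: "finite C" "pairwise orthogonal C" "\<forall>b\<in>C. norm b = 1" "span C = span B" by blast
  define y where "y = x - (\<Sum>b\<in>C. (x \<bullet> b) *\<^sub>R b)"
  have sp: "(\<Sum>b\<in>C. (x \<bullet> b) *\<^sub>R b) \<in> span C" by (intro span_sum span_scale span_base)
  show ?case
  proof (cases "y = 0")
    case True
    then have "x \<in> span B" using sp C(4) by (simp add: y_def)
    then show ?thesis using C by (intro exI[of _ C]) (simp add: span_redundant)
  next
    case False
    have orth: "y \<bullet> c = 0" if "c \<in> C" for c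
    proof -
      have "(\<Sum>b\<in>C. (x \<bullet> b) *\<^sub>R b) \<bullet> c = (\<Sum>b\<in>C. if b = c then x \<bullet> c else 0)"
        unfolding inner_sum_left using C that
        by (intro sum.cong) (auto simp: pairwise_def orthogonal_def dot_square_norm)
      then show ?thesis using that C(1) by (simp add: y_def inner_diff_left)
    qed
    have "span (insert (y /\<^sub>R norm y) C) = span (insert x B)"
    proof -
      have "y /\<^sub>R norm y \<in> span (insert x C)" unfolding y_def
        by (intro span_scale span_diff span_base[of x])
          (use sp span_mono[of C "insert x C"] in auto)
      moreover have "x \<in> span (insert (y /\<^sub>R norm y) C)"
      proof -
        have "x = norm y *\<^sub>R (y /\<^sub>R norm y) + (\<Sum>b\<in>C. (x \<bullet> b) *\<^sub>R b)" using False by (simp add: y_def)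
        moreover have "norm y *\<^sub>R (y /\<^sub>R norm y) \<in> span (insert (y /\<^sub>R norm y) C)"
          by (intro span_scale span_base) simp
        ultimately show ?thesis using sp span_mono[of C "insert (y /\<^sub>R norm y) C"]
          by (metis (no_types, lifting) span_add subsetD subset_insertI)
      qed
      ultimately have "span (insert (y /\<^sub>R norm y) C) = span (insert x C)"
        by (auto intro!: span_eq[THEN iffD2] simp: span_base)
      also have "\<dots> = span (insert x B)"
        using C(4) by (simp add: span_insert)
      finally show ?thesis .
    qed
    moreover have "pairwise orthogonal (insert (y /\<^sub>R norm y) C)"
      using C(2) orth by (auto simp: pairwise_insert orthogonal_def inner_commute)
    ultimately show ?thesis using C False
      by (intro exI[of _ "insert (y /\<^sub>R norm y) C"]) auto
  qed
qed

lemma fin_dim_orthonormal_basis: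
  assumes "fin_dim TYPE('a::real_inner)"
  obtains B :: "'a::real_inner set" where "finite B" "pairwise orthogonal B" "\<And>b. b \<in> B \<Longrightarrow> norm b = 1"
    "\<And>x. (\<Sum>b\<in>B. (x \<bullet> b) *\<^sub>R b) = x" "span B = UNIV"
proof -
  obtain B :: "'a set" where "finite B" "span B = UNIV" using assms by (auto simp: fin_dim_def)
  then obtain C where "finite C" "pairwise orthogonal C" "\<forall>b\<in>C. norm b = 1" "span C = (UNIV :: 'a set)"
    using gram_schmidt_set[of B] by auto
  then show ?thesis using orthonormal_expansion[of C] by (intro that[of C]) auto
qed

text \<open>The derivative of \<open>g\<close> is evaluated on a direction that varies with the
  point, while \<open>Ck_on\<close> speaks of fixed directions. Expanding that direction in an
  orthonormal basis of the middle space gives a sum of products to which the induction hypothesis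
  applies.\<close>

lemma Ck_on_compose:
  fixes f :: "'a::real_normed_vector \<Rightarrow> 'b::real_inner" and g :: "'b \<Rightarrow> 'c::real_normed_vector"
  assumes fd: "fin_dim TYPE('b)" and S: "open S" and fS: "f ` S \<subseteq> T"
    and "Ck_on k S f" "Ck_on k T g"
  shows "Ck_on k S (g \<circ> f)"
  using assms(4,5)
proof (induction k arbitrary: g)
  case 0
  then have "continuous_on (f ` S) g" using fS continuous_on_subset by auto
  with 0 show ?case unfolding Ck_on.simps by (intro continuous_on_compose)
next
  case (Suc k)
  obtain B :: "'b set" where B: "finite B" "\<And>x. (\<Sum>b\<in>B. (x \<bullet> b) *\<^sub>R b) = x"
    by (rule fin_dim_orthonormal_basis[OF fd]) (rule that)
  have *: "(g \<circ> f has_derivative (\<lambda>v. frechet_derivative g (at (f x)) (frechet_derivative f (at x) v))) (at x)"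
    if "x \<in> S" for x
  proof -
    have "(f has_derivative frechet_derivative f (at x)) (at x)"
      using Suc.prems(1) that by (simp add: frechet_derivative_works)
    moreover have "f x \<in> T" using that fS by auto
    then have "(g has_derivative frechet_derivative g (at (f x))) (at (f x))"
      using Suc.prems(2) by (simp add: frechet_derivative_works)
    ultimately show ?thesis using diff_chain_at by (fastforce simp: comp_def)
  qed
  show ?case unfolding Ck_on.simps
  proof (intro conjI ballI allI)
    fix x assume "x \<in> S"
    then show "g \<circ> f differentiable at x" using * differentiable_def by blast
  next
    fix v
    have kf: "Ck_on k S f" using Suc.prems Ck_on_SucD by blast
    have "Ck_on k S (\<lambda>x. \<Sum>b\<in>B. (frechet_derivative f (at x) v \<bullet> b) *\<^sub>R
        ((\<lambda>y. frechet_derivative g (at y) b) \<circ> f) x)"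
      using Suc.prems kf
      by (intro Ck_on_sum[OF S] Ck_on_scaleR[OF S] Suc.IH
          Ck_on_bounded_linear[OF S bounded_linear_inner_left]) auto
    then show "Ck_on k S (\<lambda>x. frechet_derivative (g \<circ> f) (at x) v)"
    proof (rule Ck_on_cong[OF S, rotated])
      fix x assume x: "x \<in> S"
      interpret bl: bounded_linear "frechet_derivative g (at (f x))"
        using Suc.prems x fS by (intro has_derivative_bounded_linear[of g _ "at (f x)"]) (auto simp: frechet_derivative_works)
      have "frechet_derivative g (at (f x)) (frechet_derivative f (at x) v)
        = frechet_derivative g (at (f x)) (\<Sum>b\<in>B. (frechet_derivative f (at x) v \<bullet> b) *\<^sub>R b)"
        by (simp only: B(2))
      then show "(\<Sum>b\<in>B. (frechet_derivative f (at x) v \<bullet> b) *\<^sub>R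
        ((\<lambda>y. frechet_derivative g (at y) b) \<circ> f) x) = frechet_derivative (g \<circ> f) (at x) v"
        by (simp add: frechet_derivative_eqI[OF *[OF x]] bl.sum bl.scaleR)
    qed
  qed
qed

section \<open>Powers and flat functions of one real variable\<close>

lemma Ck_on_powr: "Ck_on k {0<..} (\<lambda>x::real. x powr a)"
proof (induction k arbitrary: a)
  case 0
  show ?case by (auto intro!: continuous_intros)
next
  case (Suc k)
  have *: "((\<lambda>x::real. x powr a) has_derivative (\<lambda>v. (v * a) *\<^sub>R (x powr (a - 1)))) (at x)" if "x > 0" for x
  proof -
    have "(\<lambda>v. (v * a) *\<^sub>R (x powr (a - 1))) = (*) (a * x powr (a - 1))" by (auto simp: fun_eq_iff)
    then show ?thesis using has_real_derivative_powr[OF that, of a] by (simp only: has_field_derivative_def)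
  qed
  show ?case unfolding Ck_on.simps
  proof (intro conjI ballI allI)
    fix x :: real assume "x \<in> {0<..}"
    then show "(\<lambda>x. x powr a) differentiable at x" using * differentiable_def by auto
  next
    fix v
    show "Ck_on k {0<..} (\<lambda>x. frechet_derivative (\<lambda>x. x powr a) (at x) v)"
      by (rule Ck_on_cong[OF _ _ Ck_on_scaleR[OF _ Ck_on_const[of k _ "v * a"] Suc[of "a - 1"]]])
        (auto simp: frechet_derivative_eqI[OF *])
  qed
qed

definition flat :: "real poly \<Rightarrow> real \<Rightarrow> real" where
  "flat P x = (if x > 0 then poly P (1 / x) * exp (- (1 / x)) else 0)"

text \<open>The substitution y = 1/x turns the limit at 0 into that of a polynomial divided by exp
  at infinity.\<close>

lemma flat_tendsto: "((\<lambda>x. poly P (1 / x) * exp (- (1 / x))) \<longlongrightarrow> 0) (at_right (0::real))"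
proof -
  have "((\<lambda>y. poly P y * exp (- y)) \<longlongrightarrow> 0) at_top"
  proof -
    have "((\<lambda>y. \<Sum>i\<le>degree P. coeff P i * (y ^ i / exp y)) \<longlongrightarrow> (\<Sum>i\<le>degree P. coeff P i * 0)) at_top"
      by (intro tendsto_sum tendsto_mult tendsto_const tendsto_power_div_exp_0)
    then show ?thesis
      by (simp add: poly_altdef sum_distrib_right exp_minus divide_inverse mult.assoc)
  qed
  then show ?thesis
    by (rule filterlim_compose) (simp add: filterlim_inverse_at_top_right inverse_eq_divide [symmetric])
qed

text \<open>For x > 0 the chain rule gives (P - P')(1/x) (1/x)^2 exp(-1/x); the polynomial
  \<open>[:0, 0, 1:]\<close> is the factor (1/x)^2.\<close>

lemma flat_has_derivative:
  "(flat P has_real_derivative flat ((P - pderiv P) * [:0, 0, 1:]) x) (at x)"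
proof -
  consider "x > 0" | "x < 0" | "x = 0" by linarith
  then show ?thesis
  proof cases
    case 1
    have "((\<lambda>x. poly P (1 / x) * exp (- (1 / x))) has_real_derivative
       poly (pderiv P) (1 / x) * (- (1 / x\<^sup>2)) * exp (- (1 / x)) + exp (- (1 / x)) * (1 / x\<^sup>2) * poly P (1 / x)) (at x)"
      using 1 by (auto intro!: derivative_eq_intros DERIV_chain2[OF poly_DERIV] simp: power2_eq_square field_simps)
    also have "poly (pderiv P) (1 / x) * (- (1 / x\<^sup>2)) * exp (- (1 / x)) + exp (- (1 / x)) * (1 / x\<^sup>2) * poly P (1 / x)
      = flat ((P - pderiv P) * [:0, 0, 1:]) x"
      using 1 by (simp add: flat_def power2_eq_square field_simps)
    finally show ?thesis
      by (rule has_field_derivative_transform_within_open[where S="{0<..}"]) (use 1 in \<open>auto simp: flat_def\<close>)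
  next
    case 2
    have "((\<lambda>_. 0) has_real_derivative 0) (at x)" by simp
    then have "(flat P has_real_derivative 0) (at x)"
      by (rule has_field_derivative_transform_within_open[where S="{..<0}"]) (use 2 in \<open>auto simp: flat_def\<close>)
    then show ?thesis using 2 by (simp add: flat_def)
  next
    case 3
    have "((\<lambda>y. (flat P y - flat P 0) / (y - 0)) \<longlongrightarrow> 0) (at 0)"
    proof (rule filterlim_split_at)
      show "((\<lambda>y. (flat P y - flat P 0) / (y - 0)) \<longlongrightarrow> 0) (at_left 0)"
        by (rule tendsto_eventually) (auto simp: eventually_at_filter flat_def)
      \<comment> \<open>Dividing by \<open>y\<close> multiplies the polynomial by its variable, so
        the quotient is again of the form treated by \<open>flat_tendsto\<close>.\<close>
      show "((\<lambda>y. (flat P y - flat P 0) / (y - 0)) \<longlongrightarrow> 0) (at_right 0)"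
        by (rule Lim_transform_eventually[OF flat_tendsto[of "P * [:0, 1:]"]])
          (auto simp: eventually_at_filter flat_def)
    qed
    then have "(flat P has_real_derivative 0) (at 0)" by (simp add: has_field_derivative_iff)
    then show ?thesis using 3 by (simp add: flat_def)
  qed
qed

lemma Ck_on_flat: "Ck_on k UNIV (flat P)"
proof (induction k arbitrary: P)
  case 0
  show ?case
    unfolding Ck_on.simps
    by (intro continuous_at_imp_continuous_on ballI DERIV_isCont[OF flat_has_derivative])
next
  case (Suc k)
  have *: "(flat P has_derivative (\<lambda>v. v *\<^sub>R (flat ((P - pderiv P) * [:0, 0, 1:]) x))) (at x)" for x
  proof -
    have "(\<lambda>v. v *\<^sub>R (flat ((P - pderiv P) * [:0, 0, 1:]) x)) = (*) (flat ((P - pderiv P) * [:0, 0, 1:]) x)"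
      by (auto simp: fun_eq_iff)
    then show ?thesis using flat_has_derivative[of P x] by (simp only: has_field_derivative_def)
  qed
  show ?case unfolding Ck_on.simps
  proof (intro conjI ballI allI)
    fix x show "flat P differentiable at x" using * differentiable_def by blast
  next
    fix v
    show "Ck_on k UNIV (\<lambda>x. frechet_derivative (flat P) (at x) v)"
      unfolding frechet_derivative_eqI[OF *] by (intro Ck_on_scaleR Ck_on_const Suc) auto
  qed
qed

section \<open>Symmetry of second derivatives\<close>

text \<open>The second difference is the increment over [0, s] of \<open>G\<close>, a difference of
  \<open>f\<close> in direction \<open>v\<close>. One mean value theorem makes it \<open>s\<close>
  times an increment of \<open>K\<close>, the derivative along \<open>u\<close>; a second one
  applies to \<open>K\<close>.\<close>

lemma mixed_difference:
  fixes f :: "'a::real_normed_vector \<Rightarrow> real"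
  assumes C: "Ck_on 2 S f"
    and s: "s > 0" and S: "\<And>a b. a \<in> {0..s} \<Longrightarrow> b \<in> {0..s} \<Longrightarrow> x + a *\<^sub>R u + b *\<^sub>R v \<in> S"
  shows "\<exists>a\<in>{0..s}. \<exists>b\<in>{0..s}. f (x + s *\<^sub>R u + s *\<^sub>R v) - f (x + s *\<^sub>R u) - f (x + s *\<^sub>R v) + f x
    = s * s * frechet_derivative (\<lambda>y. frechet_derivative f (at y) u) (at (x + a *\<^sub>R u + b *\<^sub>R v)) v"
proof -
  have d1: "(f has_derivative frechet_derivative f (at y)) (at y)" if "y \<in> S" for y
    using C that by (simp add: numeral_2_eq_2 frechet_derivative_works)
  have d2: "((\<lambda>y. frechet_derivative f (at y) u) has_derivative
      frechet_derivative (\<lambda>y. frechet_derivative f (at y) u) (at y)) (at y)" if "y \<in> S" for y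
    using C that by (simp add: numeral_2_eq_2 frechet_derivative_works[symmetric])
  define G where "G a = f (x + a *\<^sub>R u + s *\<^sub>R v) - f (x + a *\<^sub>R u + 0 *\<^sub>R v)" for a
  have G': "(G has_real_derivative frechet_derivative f (at (x + a *\<^sub>R u + s *\<^sub>R v)) u
      - frechet_derivative f (at (x + a *\<^sub>R u + 0 *\<^sub>R v)) u) (at a)" if "0 \<le> a" "a \<le> s" for a
  proof -
    have "((\<lambda>a. f (x + a *\<^sub>R u + b *\<^sub>R v)) has_derivative (\<lambda>t. frechet_derivative f (at (x + a *\<^sub>R u + b *\<^sub>R v)) (t *\<^sub>R u))) (at a)"
      if "b \<in> {0..s}" for b
      using that \<open>0 \<le> a\<close> \<open>a \<le> s\<close> 
      by (intro has_derivative_compose[of "\<lambda>a. x + a *\<^sub>R u + b *\<^sub>R v", OF _ d1] S)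
        (auto intro!: derivative_eq_intros)
    moreover have "frechet_derivative f (at (x + a *\<^sub>R u + b *\<^sub>R v)) (t *\<^sub>R u)
      = t * frechet_derivative f (at (x + a *\<^sub>R u + b *\<^sub>R v)) u" if "b \<in> {0..s}" for b t
      using linear_scale[OF has_derivative_linear[OF d1[OF S]], of a b t u] that \<open>0 \<le> a\<close> \<open>a \<le> s\<close> by simp
    ultimately have *: "((\<lambda>a. f (x + a *\<^sub>R u + b *\<^sub>R v)) has_real_derivative frechet_derivative f (at (x + a *\<^sub>R u + b *\<^sub>R v)) u) (at a)"
      if "b \<in> {0..s}" for b
      using that by (simp add: has_field_derivative_def mult_commute_abs)
    show ?thesis unfolding G_def
      using DERIV_diff[OF *[of s] *[of 0]] s by simp
  qed
  obtain a where a: "0 < a" "a < s" and Ga: "G s - G 0 = s * (frechet_derivative f (at (x + a *\<^sub>R u + s *\<^sub>R v)) u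
      - frechet_derivative f (at (x + a *\<^sub>R u + 0 *\<^sub>R v)) u)"
    using MVT2[OF s G'] by auto
  define K where "K b = frechet_derivative f (at (x + a *\<^sub>R u + b *\<^sub>R v)) u" for b
  let ?D = "\<lambda>y. frechet_derivative (\<lambda>y. frechet_derivative f (at y) u) (at y)"
  have K': "(K has_real_derivative ?D (x + a *\<^sub>R u + b *\<^sub>R v) v) (at b)" if "0 \<le> b" "b \<le> s" for b
  proof -
    have *: "x + a *\<^sub>R u + b *\<^sub>R v \<in> S" using that a by (intro S) auto
    have "(K has_derivative (\<lambda>t. ?D (x + a *\<^sub>R u + b *\<^sub>R v) (t *\<^sub>R v))) (at b)"
      unfolding K_def
      by (intro has_derivative_compose[of "\<lambda>b. x + a *\<^sub>R u + b *\<^sub>R v", OF _ d2] *)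
        (auto intro!: derivative_eq_intros)
    then show ?thesis
      using linear_scale[OF has_derivative_linear[OF d2[OF *]]]
      by (simp add: has_field_derivative_def mult_commute_abs)
  qed
  obtain b where b: "0 < b" "b < s" and Kb: "K s - K 0 = s * ?D (x + a *\<^sub>R u + b *\<^sub>R v) v"
    using MVT2[OF s K'] by auto
  have "f (x + s *\<^sub>R u + s *\<^sub>R v) - f (x + s *\<^sub>R u) - f (x + s *\<^sub>R v) + f x = G s - G 0"
    by (simp add: G_def)
  also have "\<dots> = s * (K s - K 0)" by (simp add: Ga K_def)
  finally show ?thesis using a b Kb by (intro bexI[of _ a] bexI[of _ b]) auto
qed

text \<open>The second difference over a parallelogram is symmetric in \<open>u\<close> and
  \<open>v\<close>. Divided by s^2 it is a value of either mixed derivative at a nearby point, and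
  continuity of both identifies them at \<open>x\<close>.\<close>

lemma frechet_derivative_symmetric_real:
  fixes f :: "'a::real_normed_vector \<Rightarrow> real"
  assumes S: "open S" "x \<in> S" and C: "Ck_on 2 S f"
  shows "frechet_derivative (\<lambda>y. frechet_derivative f (at y) u) (at x) v =
    frechet_derivative (\<lambda>y. frechet_derivative f (at y) v) (at x) u"
proof -
  define P where "P u v y = frechet_derivative (\<lambda>y. frechet_derivative f (at y) u) (at y) v" for u v y
  have cont: "isCont (P u v) x" for u v
    using C S unfolding P_def[abs_def] numeral_2_eq_2 by (simp add: continuous_on_eq_continuous_at)
  have close: "\<bar>P u v x - P v u x\<bar> \<le> e" if "e > 0" for e
  proof -
    have ev: "\<forall>\<^sub>F y in nhds x. \<bar>P u v y - P u v x\<bar> < e / 2" for u v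
    proof -
      have "\<forall>\<^sub>F y in at x. dist (P u v y) (P u v x) < e / 2"
        using tendstoD[OF cont[of u v, unfolded isCont_def], of "e / 2"] that by simp
      then show ?thesis
        unfolding eventually_at_filter by (rule eventually_mono) (use that in \<open>auto simp: dist_real_def\<close>)
    qed
    have "\<forall>\<^sub>F y in nhds x. \<bar>P u v y - P u v x\<bar> < e / 2 \<and> \<bar>P v u y - P v u x\<bar> < e / 2 \<and> y \<in> S"
      by (intro eventually_conj ev eventually_nhds_in_open S)
    then obtain d where d: "d > 0" and dd: "\<And>y. dist y x < d \<Longrightarrow>
        \<bar>P u v y - P u v x\<bar> < e / 2 \<and> \<bar>P v u y - P v u x\<bar> < e / 2 \<and> y \<in> S"
      unfolding eventually_nhds_metric by blast
    \<comment> \<open>With this choice \<open>s * (norm u + norm v)\<close> is at most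
      \<open>d / 2\<close>, so the parallelogram stays within distance \<open>d\<close> of
      \<open>x\<close>; the \<open>+ 1\<close> keeps the denominator positive when \<open>u\<close>
      and \<open>v\<close> vanish.\<close>
    define s where "s = d / (2 * (norm u + norm v + 1))"
    have n: "norm u + norm v + 1 > 0" by (simp add: add_nonneg_pos)
    have s: "s > 0" using d n by (simp add: s_def)
    have s': "s * (norm u + norm v) < d"
    proof -
      have "s * (norm u + norm v) \<le> s * (norm u + norm v + 1)" using s by simp
      also have "\<dots> = d / 2" using n by (simp add: s_def divide_simps)
      finally show ?thesis using d by simp
    qed
    have dist: "dist (x + a *\<^sub>R u + b *\<^sub>R v) x < d" if "a \<in> {0..s}" "b \<in> {0..s}" for a b
    proof -
      have "dist (x + a *\<^sub>R u + b *\<^sub>R v) x = norm (a *\<^sub>R u + b *\<^sub>R v)" by (simp add: dist_norm add.assoc)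
      also have "\<dots> \<le> a * norm u + b * norm v" using that norm_triangle_ineq[of "a *\<^sub>R u" "b *\<^sub>R v"] by simp
      also have "\<dots> \<le> s * norm u + s * norm v" using that by (intro add_mono mult_right_mono) auto
      finally show ?thesis using s' by (simp add: distrib_left)
    qed
    obtain a b where ab: "a \<in> {0..s}" "b \<in> {0..s}"
      "f (x + s *\<^sub>R u + s *\<^sub>R v) - f (x + s *\<^sub>R u) - f (x + s *\<^sub>R v) + f x = s * s * P u v (x + a *\<^sub>R u + b *\<^sub>R v)"
      unfolding P_def using mixed_difference[OF C s, of x u v] dd[OF dist] by blast
    have dist': "x + a *\<^sub>R v + b *\<^sub>R u \<in> S" if "a \<in> {0..s}" "b \<in> {0..s}" for a b
      using dd[OF dist[OF that(2,1)]] by (simp add: algebra_simps)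
    obtain a' b' where ab': "a' \<in> {0..s}" "b' \<in> {0..s}"
      "f (x + s *\<^sub>R v + s *\<^sub>R u) - f (x + s *\<^sub>R v) - f (x + s *\<^sub>R u) + f x = s * s * P v u (x + a' *\<^sub>R v + b' *\<^sub>R u)"
      unfolding P_def using mixed_difference[OF C s dist'] by blast
    have "s * s * P u v (x + a *\<^sub>R u + b *\<^sub>R v) = s * s * P v u (x + a' *\<^sub>R v + b' *\<^sub>R u)"
      using ab(3) ab'(3) by (simp add: algebra_simps)
    then have "P u v (x + a *\<^sub>R u + b *\<^sub>R v) = P v u (x + b' *\<^sub>R u + a' *\<^sub>R v)"
      using s by (simp add: algebra_simps)
    then show ?thesis
      using dd[OF dist[OF ab(1,2)]] dd[OF dist[OF ab'(2,1)]] by linarith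
  qed
  then have "\<bar>P u v x - P v u x\<bar> \<le> 0" by (rule field_le_epsilon) simp
  then show ?thesis by (simp add: P_def)
qed

text \<open>The mean value argument concerns real functions, so it is applied to
  \<open>f y \<bullet> w\<close> for every \<open>w\<close>.\<close>

lemma frechet_derivative_symmetric:
  fixes f :: "'a::real_normed_vector \<Rightarrow> 'b::real_inner"
  assumes S: "open S" "x \<in> S" and C: "Ck_on 2 S f"
  shows "frechet_derivative (\<lambda>y. frechet_derivative f (at y) u) (at x) v =
    frechet_derivative (\<lambda>y. frechet_derivative f (at y) v) (at x) u"
proof -
  have inner: "frechet_derivative (\<lambda>y. g y \<bullet> w) (at y) u = frechet_derivative g (at y) u \<bullet> w"
    if "g differentiable at y" for g :: "'a \<Rightarrow> 'b" and y u w
    using frechet_derivative_eqI[OF has_derivative_inner_left[of g "frechet_derivative g (at y)"]] that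
    by (simp add: frechet_derivative_works)
  have *: "frechet_derivative (\<lambda>y. frechet_derivative (\<lambda>y. f y \<bullet> w) (at y) u) (at x) v
      = frechet_derivative (\<lambda>y. frechet_derivative f (at y) u) (at x) v \<bullet> w" for u v w
  proof -
    have "frechet_derivative (\<lambda>y. frechet_derivative (\<lambda>y. f y \<bullet> w) (at y) u) (at x) v
      = frechet_derivative (\<lambda>y. frechet_derivative f (at y) u \<bullet> w) (at x) v"
      using C by (subst frechet_derivative_cong_open[OF S, of _ "\<lambda>y. frechet_derivative f (at y) u \<bullet> w"])
        (auto simp: numeral_2_eq_2 inner)
    then show ?thesis using C S by (simp add: numeral_2_eq_2 inner)
  qed
  have "frechet_derivative (\<lambda>y. frechet_derivative f (at y) u) (at x) v \<bullet> w =
    frechet_derivative (\<lambda>y. frechet_derivative f (at y) v) (at x) u \<bullet> w" for w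
    using frechet_derivative_symmetric_real[OF S Ck_on_bounded_linear[OF S(1) bounded_linear_inner_left C], of w u v]
    by (simp add: *)
  then show ?thesis using vector_eq_rdot by blast
qed

section \<open>Calculus on smooth manifolds\<close>

lemma has_derivative_frechet_apply:
  fixes f :: "'a::real_inner \<Rightarrow> 'b::real_normed_vector"
  assumes fd: "fin_dim TYPE('a)" and z: "z \<in> S" and C: "Ck_on 2 S f" and y: "(y has_derivative y') (at z)"
    and S: "open S"
  shows "((\<lambda>w. frechet_derivative f (at w) (y w)) has_derivative
    (\<lambda>u. frechet_derivative (\<lambda>w. frechet_derivative f (at w) (y z)) (at z) u + frechet_derivative f (at z) (y' u))) (at z)"
proof -
  obtain B :: "'a set" where B: "finite B" "\<And>x. (\<Sum>b\<in>B. (x \<bullet> b) *\<^sub>R b) = x"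
    by (rule fin_dim_orthonormal_basis[OF fd]) (rule that)
  have lin: "frechet_derivative f (at w) v = (\<Sum>b\<in>B. (v \<bullet> b) *\<^sub>R frechet_derivative f (at w) b)" if "w \<in> S" for w v
  proof -
    interpret linear "frechet_derivative f (at w)"
      using C that by (intro linear_frechet_derivative) (simp add: numeral_2_eq_2)
    have "frechet_derivative f (at w) v = frechet_derivative f (at w) (\<Sum>b\<in>B. (v \<bullet> b) *\<^sub>R b)" by (simp only: B(2))
    then show ?thesis by (simp only: sum scale)
  qed
  have d2: "((\<lambda>w. frechet_derivative f (at w) v) has_derivative frechet_derivative (\<lambda>w. frechet_derivative f (at w) v) (at z)) (at z)" for v
    using C z by (simp add: numeral_2_eq_2 frechet_derivative_works[symmetric])
  have "((\<lambda>w. \<Sum>b\<in>B. (y w \<bullet> b) *\<^sub>R frechet_derivative f (at w) b) has_derivative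
    (\<lambda>u. \<Sum>b\<in>B. (y z \<bullet> b) *\<^sub>R frechet_derivative (\<lambda>w. frechet_derivative f (at w) b) (at z) u
      + (y' u \<bullet> b) *\<^sub>R frechet_derivative f (at z) b)) (at z)"
    by (intro has_derivative_sum has_derivative_scaleR has_derivative_inner_left y d2)
  moreover have "frechet_derivative (\<lambda>w. frechet_derivative f (at w) (y z)) (at z) u
      = (\<Sum>b\<in>B. (y z \<bullet> b) *\<^sub>R frechet_derivative (\<lambda>w. frechet_derivative f (at w) b) (at z) u)" for u
  proof -
    have "((\<lambda>w. \<Sum>b\<in>B. (y z \<bullet> b) *\<^sub>R frechet_derivative f (at w) b) has_derivative
      (\<lambda>u. \<Sum>b\<in>B. (y z \<bullet> b) *\<^sub>R frechet_derivative (\<lambda>w. frechet_derivative f (at w) b) (at z) u)) (at z)"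
      by (intro has_derivative_sum bounded_linear.has_derivative[OF bounded_linear_scaleR_right] d2)
    note eq = frechet_derivative_eqI[OF this]
    have "frechet_derivative (\<lambda>w. frechet_derivative f (at w) (y z)) (at z)
      = frechet_derivative (\<lambda>w. \<Sum>b\<in>B. (y z \<bullet> b) *\<^sub>R frechet_derivative f (at w) b) (at z)"
      by (intro frechet_derivative_cong_open[OF S z] lin)
    then show ?thesis by (simp only: eq)
  qed
  ultimately have "((\<lambda>w. \<Sum>b\<in>B. (y w \<bullet> b) *\<^sub>R frechet_derivative f (at w) b) has_derivative
    (\<lambda>u. frechet_derivative (\<lambda>w. frechet_derivative f (at w) (y z)) (at z) u + frechet_derivative f (at z) (y' u))) (at z)"
    by (simp only: sum.distrib lin[OF z, of "y' _"])
  moreover have "(\<Sum>b\<in>B. (y w \<bullet> b) *\<^sub>R frechet_derivative f (at w) b) = frechet_derivative f (at w) (y w)"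
    if "w \<in> S" for w using lin[OF that, of "y w"] by simp
  ultimately show ?thesis by (rule has_derivative_transform_within_open[OF _ S z])
qed

section \<open>Smooth functions and vector fields in charts\<close>

lemma smooth_funI:
  "(\<And>W c k. (W, c) \<in> atlas M \<Longrightarrow> Ck_on k (c ` (U \<inter> W)) (f \<circ> inv_into W c)) \<Longrightarrow> smooth_fun M U f"
  by (auto simp: smooth_fun_def smooth_on_def)

lemma smooth_funD:
  "smooth_fun M U f \<Longrightarrow> (W, c) \<in> atlas M \<Longrightarrow> Ck_on k (c ` (U \<inter> W)) (f \<circ> inv_into W c)"
  by (auto simp: smooth_fun_def smooth_on_def)

lemma smooth_fun_subset:
  assumes "smooth_fun M U f" "V \<subseteq> U"
  shows "smooth_fun M V f"
proof (rule smooth_funI)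
  fix W c k assume "(W, c) \<in> atlas M"
  then show "Ck_on k (c ` (V \<inter> W)) (f \<circ> inv_into W c)"
    using assms by (intro Ck_on_subset[OF smooth_funD[OF assms(1)]]) auto
qed

lemma vector_fieldI:
  "(\<And>W c. (W, c) \<in> atlas M \<Longrightarrow> smooth_fun M (U \<inter> W) (\<lambda>p. dir_deriv M p (X p) c)) \<Longrightarrow> vector_field M U X"
  by (auto simp: vector_field_def)

lemma vector_fieldD:
  "vector_field M U X \<Longrightarrow> (W, c) \<in> atlas M \<Longrightarrow> smooth_fun M (U \<inter> W) (\<lambda>p. dir_deriv M p (X p) c)"
  by (auto simp: vector_field_def)

lemma vector_field_subset:
  assumes "vector_field M U X" "V \<subseteq> U"
  shows "vector_field M V X"
proof (rule vector_fieldI)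
  fix W c assume "(W, c) \<in> atlas M"
  then show "smooth_fun M (V \<inter> W) (\<lambda>p. dir_deriv M p (X p) c)"
    using assms by (intro smooth_fun_subset[OF vector_fieldD[OF assms(1)]]) auto
qed

text \<open>The field with constant coordinates \<open>v\<close> in the chart \<open>(W, c)\<close>.
  The derivative of the transition map rewrites \<open>v\<close> in the coordinates of
  \<open>chart_at M q\<close>, which represent tangent vectors at \<open>q\<close>.\<close>

definition coord_field :: "('a, 'e::real_normed_vector) manifold \<Rightarrow> 'a set \<Rightarrow> ('a \<Rightarrow> 'e) \<Rightarrow> 'e \<Rightarrow> 'a \<Rightarrow> 'e" where
  "coord_field M W c v q = frechet_derivative (snd (chart_at M q) \<circ> inv_into W c) (at (c q)) v"

context smooth_manifold
begin

lemma fin_dim: "fin_dim TYPE('e)"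
  using finite_dim by (simp add: fin_dim_def)

lemma chart_mopen: "(W, c) \<in> atlas M \<Longrightarrow> mopen M W"
  using chart by blast

lemma chart_subset: "(W, c) \<in> atlas M \<Longrightarrow> W \<subseteq> points M"
  using chart_mopen openin_subset by blast

lemma chart_inj: "(W, c) \<in> atlas M \<Longrightarrow> inj_on c W"
  using chart[of W c] chart_subset[of W c] homeomorphic_imp_injective_map
  by (fastforce simp: topspace_subtopology Int_absorb1)

lemma inv_chart [simp]: "(W, c) \<in> atlas M \<Longrightarrow> q \<in> W \<Longrightarrow> inv_into W c (c q) = q"
  by (simp add: chart_inj)

lemma chart_image_open:
  assumes "(W, c) \<in> atlas M" "mopen M U"
  shows "open (c ` (U \<inter> W))"
proof -
  have "openin (subtopology (mtop M) W) (U \<inter> W)"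
    using assms(2) by (auto simp: openin_subtopology)
  then have "openin (top_of_set (c ` W)) (c ` (U \<inter> W))"
    using chart[OF assms(1)] homeomorphic_imp_open_map open_map_def by blast
  then show ?thesis
    using chart[OF assms(1)] openin_open_trans by blast
qed

lemma chart_preimage_open:
  assumes "(W, c) \<in> atlas M" "open T"
  shows "mopen M {q \<in> W. c q \<in> T}"
proof -
  have "continuous_map (subtopology (mtop M) W) (top_of_set (c ` W)) c"
    using chart[OF assms(1)] homeomorphic_imp_continuous_map by blast
  moreover have "openin (top_of_set (c ` W)) (c ` W \<inter> T)" using assms(2) by (simp add: openin_open_Int)
  ultimately have "openin (subtopology (mtop M) W) {q \<in> topspace (subtopology (mtop M) W). c q \<in> c ` W \<inter> T}"
    by (rule openin_continuous_map_preimage)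
  moreover have "{q \<in> topspace (subtopology (mtop M) W). c q \<in> c ` W \<inter> T} = {q \<in> W. c q \<in> T}"
    using chart_subset[OF assms(1)] by auto
  ultimately show ?thesis
    using openin_trans_full[OF _ chart_mopen[OF assms(1)]] by simp
qed

lemma chart_at:
  assumes "p \<in> points M"
  obtains W c where "chart_at M p = (W, c)" "(W, c) \<in> atlas M" "p \<in> W"
proof -
  have "\<exists>C. C \<in> atlas M \<and> p \<in> fst C" using assms covering by force
  then have "chart_at M p \<in> atlas M \<and> p \<in> fst (chart_at M p)" unfolding chart_at_def by (rule someI_ex)
  then show ?thesis using that[of "fst (chart_at M p)" "snd (chart_at M p)"] by simp
qed

lemma chart_at_domain:
  assumes "p \<in> points M"
  shows "(fst (chart_at M p), snd (chart_at M p)) \<in> atlas M" "p \<in> fst (chart_at M p)"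
  using chart_at[OF assms] by (metis fst_conv snd_conv)+

lemma transition_smooth:
  "(W, c) \<in> atlas M \<Longrightarrow> (V, d) \<in> atlas M \<Longrightarrow> Ck_on k (c ` (W \<inter> V)) (d \<circ> inv_into W c)"
  using compatible by (simp add: smooth_on_def)

lemma has_derivative_change_chart:
  assumes "(W, c) \<in> atlas M" "(V, d) \<in> atlas M" "q \<in> W" "q \<in> V"
    and "(f \<circ> inv_into W c has_derivative F') (at (c q))"
  shows "(f \<circ> inv_into V d has_derivative
    (\<lambda>u. F' (frechet_derivative (c \<circ> inv_into V d) (at (d q)) u))) (at (d q))"
proof -
  let ?S = "d ` (W \<inter> V)"
  have S: "open ?S" "d q \<in> ?S"
    using chart_image_open[OF assms(2) chart_mopen[OF assms(1)]] assms by auto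
  have "(c \<circ> inv_into V d has_derivative frechet_derivative (c \<circ> inv_into V d) (at (d q))) (at (d q))"
    using transition_smooth[OF assms(2,1), of 1] assms by (simp add: frechet_derivative_works)
  moreover have "(c \<circ> inv_into V d) (d q) = c q" using assms by simp
  ultimately have "((f \<circ> inv_into W c) \<circ> (c \<circ> inv_into V d) has_derivative
    F' \<circ> frechet_derivative (c \<circ> inv_into V d) (at (d q))) (at (d q))"
    using assms(5) by (intro diff_chain_at) auto
  then have "((f \<circ> inv_into W c) \<circ> (c \<circ> inv_into V d) has_derivative
    (\<lambda>u. F' (frechet_derivative (c \<circ> inv_into V d) (at (d q)) u))) (at (d q))"
    by (simp add: comp_def)
  moreover have "((f \<circ> inv_into W c) \<circ> (c \<circ> inv_into V d)) y = (f \<circ> inv_into V d) y" if "y \<in> ?S" for y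
    using that assms by auto
  ultimately show ?thesis by (rule has_derivative_transform_within_open[OF _ S])
qed

text \<open>The chain rule for transition maps. The second fact computes \<open>dir_deriv\<close> in
  an arbitrary chart from the coordinates of \<open>u\<close> there, which frees later arguments
  from the pointwise choice made by \<open>chart_at\<close>.\<close>

lemma has_derivative_dir_deriv:
  assumes "(W, c) \<in> atlas M" "q \<in> W" "(f \<circ> inv_into W c) differentiable (at (c q))"
  shows "(f \<circ> inv_into (fst (chart_at M q)) (snd (chart_at M q)) has_derivative (\<lambda>u. dir_deriv M q u f))
     (at (snd (chart_at M q) q))"
    and "dir_deriv M q u f = frechet_derivative (f \<circ> inv_into W c) (at (c q)) (dir_deriv M q u c)"
proof -
  obtain W0 c0 where c0: "chart_at M q = (W0, c0)" "(W0, c0) \<in> atlas M" "q \<in> W0"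
    using chart_at chart_subset assms by blast
  have h: "(f \<circ> inv_into W0 c0 has_derivative (\<lambda>u. frechet_derivative (f \<circ> inv_into W c) (at (c q))
     (frechet_derivative (c \<circ> inv_into W0 c0) (at (c0 q)) u))) (at (c0 q))"
    using assms(3) by (intro has_derivative_change_chart[OF assms(1) c0(2) assms(2) c0(3)])
      (simp only: frechet_derivative_works)
  then show 1: "dir_deriv M q u f = frechet_derivative (f \<circ> inv_into W c) (at (c q)) (dir_deriv M q u c)" for u
    by (simp add: dir_deriv_def c0 frechet_derivative_eqI)
  show "(f \<circ> inv_into (fst (chart_at M q)) (snd (chart_at M q)) has_derivative (\<lambda>u. dir_deriv M q u f))
     (at (snd (chart_at M q) q))"
    using h by (simp add: 1) (simp add: dir_deriv_def c0)
qed

lemma smooth_fun_differentiable: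
  assumes "smooth_fun M U f" "(W, c) \<in> atlas M" "q \<in> U" "q \<in> W"
  shows "(f \<circ> inv_into W c) differentiable (at (c q))"
  using smooth_funD[OF assms(1,2), of 1] assms(3,4) by auto

lemma smooth_fun_has_derivative:
  assumes "smooth_fun M U f" "mopen M U" "q \<in> U"
  shows "(f \<circ> inv_into (fst (chart_at M q)) (snd (chart_at M q)) has_derivative (\<lambda>u. dir_deriv M q u f))
     (at (snd (chart_at M q) q))"
proof -
  obtain W0 c0 where "chart_at M q = (W0, c0)" "(W0, c0) \<in> atlas M" "q \<in> W0"
    using chart_at assms(2,3) openin_subset by blast
  then show ?thesis using has_derivative_dir_deriv(1) smooth_fun_differentiable[OF assms(1) _ assms(3)] by blast
qed

lemma dir_deriv_eqI:
  assumes "(f \<circ> inv_into (fst (chart_at M q)) (snd (chart_at M q)) has_derivative f') (at (snd (chart_at M q) q))"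
  shows "dir_deriv M q u f = f' u"
  using frechet_derivative_eqI[OF assms] by (simp add: dir_deriv_def split_beta)

lemma dir_deriv_cong:
  assumes "mopen M U" "q \<in> U" "\<And>r. r \<in> U \<Longrightarrow> f r = g r"
  shows "dir_deriv M q u f = dir_deriv M q u g"
proof -
  obtain W c where c: "chart_at M q = (W, c)" "(W, c) \<in> atlas M" "q \<in> W"
    using chart_at assms(1,2) openin_subset by blast
  have "frechet_derivative (f \<circ> inv_into W c) (at (c q)) = frechet_derivative (g \<circ> inv_into W c) (at (c q))"
    using chart_image_open[OF c(2) assms(1)] assms c
    by (intro frechet_derivative_cong_open[of "c ` (U \<inter> W)"]) auto
  then show ?thesis by (simp add: dir_deriv_def c)
qed

lemma dir_deriv_const [simp]: "dir_deriv M q u (\<lambda>r. k) = 0"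
  by (simp add: dir_deriv_def split_beta comp_def)

lemma dir_deriv_linear:
  assumes "smooth_fun M U f" "mopen M U" "q \<in> U"
  shows "linear (\<lambda>u. dir_deriv M q u f)"
  using has_derivative_linear[OF smooth_fun_has_derivative[OF assms]] .

lemma dir_deriv_sum:
  assumes "\<And>i. i \<in> I \<Longrightarrow> smooth_fun M U (f i)" "mopen M U" "q \<in> U"
  shows "dir_deriv M q u (\<lambda>r. \<Sum>i\<in>I. f i r) = (\<Sum>i\<in>I. dir_deriv M q u (f i))"
  using has_derivative_sum[of I, OF smooth_fun_has_derivative[OF assms]]
  by (intro dir_deriv_eqI) (simp add: comp_def)

lemma dir_deriv_scaleR:
  fixes f :: "'a \<Rightarrow> real"
  assumes "smooth_fun M U f" "smooth_fun M U g" "mopen M U" "q \<in> U"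
  shows "dir_deriv M q u (\<lambda>r. f r *\<^sub>R g r) = dir_deriv M q u f *\<^sub>R g q + f q *\<^sub>R dir_deriv M q u g"
proof -
  have "q \<in> points M" using assms(3,4) openin_subset by blast
  note d = chart_at_domain[OF this]
  show ?thesis
  using has_derivative_scaleR[OF smooth_fun_has_derivative[OF assms(1,3,4)] smooth_fun_has_derivative[OF assms(2,3,4)]]
  by (intro dir_deriv_eqI) (simp add: comp_def inv_chart[OF d] add.commute)
qed

lemma dir_deriv_bounded_linear:
  assumes "bounded_linear L" "smooth_fun M U f" "mopen M U" "q \<in> U"
  shows "dir_deriv M q u (\<lambda>r. L (f r)) = L (dir_deriv M q u f)"
  using bounded_linear.has_derivative[OF assms(1) smooth_fun_has_derivative[OF assms(2-4)]]
  by (intro dir_deriv_eqI) (simp add: comp_def)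

lemma dir_deriv_chart_at:
  assumes "q \<in> points M"
  shows "dir_deriv M q u (snd (chart_at M q)) = u"
proof -
  obtain W c where c: "chart_at M q = (W, c)" "(W, c) \<in> atlas M" "q \<in> W"
    using chart_at assms by blast
  have "frechet_derivative (c \<circ> inv_into W c) (at (c q)) = frechet_derivative (\<lambda>x. x) (at (c q))"
    using chart_image_open[OF c(2) chart_mopen[OF c(2)]] c
    by (intro frechet_derivative_cong_open[of "c ` (W \<inter> W)"]) auto
  then show ?thesis by (simp add: dir_deriv_def c)
qed

lemma smooth_fun_cong:
  assumes "mopen M U" "smooth_fun M U f" "\<And>r. r \<in> U \<Longrightarrow> f r = g r"
  shows "smooth_fun M U g"
proof (rule smooth_funI)
  fix W c k assume c: "(W, c) \<in> atlas M"
  show "Ck_on k (c ` (U \<inter> W)) (g \<circ> inv_into W c)"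
    by (rule Ck_on_cong[OF chart_image_open[OF c assms(1)] _ smooth_funD[OF assms(2) c]])
      (use c assms(3) in auto)
qed

lemma smooth_fun_local:
  assumes "\<And>q. q \<in> U \<Longrightarrow> \<exists>V. mopen M V \<and> q \<in> V \<and> smooth_fun M V f"
  shows "smooth_fun M U f"
proof (rule smooth_funI)
  fix W c k assume c: "(W, c) \<in> atlas M"
  show "Ck_on k (c ` (U \<inter> W)) (f \<circ> inv_into W c)"
  proof (rule Ck_on_local)
    fix x assume "x \<in> c ` (U \<inter> W)"
    then obtain q where q: "q \<in> U" "q \<in> W" "x = c q" by blast
    obtain V where V: "mopen M V" "q \<in> V" "smooth_fun M V f" using assms q by blast
    show "\<exists>T. open T \<and> x \<in> T \<and> Ck_on k T (f \<circ> inv_into W c)"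
      using chart_image_open[OF c V(1)] smooth_funD[OF V(3) c] q V(2) by blast
  qed
qed

lemma smooth_fun_const [simp]: "smooth_fun M U (\<lambda>r. k)"
  by (rule smooth_funI) (simp add: comp_def)

lemma smooth_fun_add:
  assumes "mopen M U" "smooth_fun M U f" "smooth_fun M U g"
  shows "smooth_fun M U (\<lambda>r. f r + g r)"
proof (rule smooth_funI)
  fix W c k assume c: "(W, c) \<in> atlas M"
  show "Ck_on k (c ` (U \<inter> W)) ((\<lambda>r. f r + g r) \<circ> inv_into W c)"
    using Ck_on_add[OF chart_image_open[OF c assms(1)] smooth_funD[OF assms(2) c] smooth_funD[OF assms(3) c]]
    by (simp add: comp_def)
qed

lemma smooth_fun_sum:
  assumes "mopen M U" "\<And>i. i \<in> I \<Longrightarrow> smooth_fun M U (f i)"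
  shows "smooth_fun M U (\<lambda>r. \<Sum>i\<in>I. f i r)"
  using assms(2) by (induction I rule: infinite_finite_induct) (auto intro: smooth_fun_add[OF assms(1)])

lemma smooth_fun_scaleR:
  fixes f :: "'a \<Rightarrow> real"
  assumes "mopen M U" "smooth_fun M U f" "smooth_fun M U g"
  shows "smooth_fun M U (\<lambda>r. f r *\<^sub>R g r)"
proof (rule smooth_funI)
  fix W c k assume c: "(W, c) \<in> atlas M"
  show "Ck_on k (c ` (U \<inter> W)) ((\<lambda>r. f r *\<^sub>R g r) \<circ> inv_into W c)"
    using Ck_on_scaleR[OF chart_image_open[OF c assms(1)] smooth_funD[OF assms(2) c] smooth_funD[OF assms(3) c]]
    by (simp add: comp_def)
qed

lemma smooth_fun_bounded_linear:
  assumes "mopen M U" "bounded_linear L" "smooth_fun M U f"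
  shows "smooth_fun M U (\<lambda>r. L (f r))"
proof (rule smooth_funI)
  fix W c k assume c: "(W, c) \<in> atlas M"
  show "Ck_on k (c ` (U \<inter> W)) ((\<lambda>r. L (f r)) \<circ> inv_into W c)"
    using Ck_on_bounded_linear[OF chart_image_open[OF c assms(1)] assms(2) smooth_funD[OF assms(3) c]]
    by (simp add: comp_def)
qed

lemma smooth_fun_compose:
  fixes f :: "'a \<Rightarrow> 'b::real_inner"
  assumes "fin_dim TYPE('b)" "mopen M U" "smooth_fun M U f" "\<And>k. Ck_on k T h" "\<And>r. r \<in> U \<Longrightarrow> f r \<in> T"
  shows "smooth_fun M U (\<lambda>r. h (f r))"
proof (rule smooth_funI)
  fix W c k assume c: "(W, c) \<in> atlas M"
  have "(f \<circ> inv_into W c) ` c ` (U \<inter> W) \<subseteq> T" using c assms(5) by auto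
  then show "Ck_on k (c ` (U \<inter> W)) ((\<lambda>r. h (f r)) \<circ> inv_into W c)"
    using Ck_on_compose[OF assms(1) chart_image_open[OF c assms(2)] _ smooth_funD[OF assms(3) c] assms(4)]
    by (simp add: comp_def)
qed

text \<open>Every other chart differs from \<open>c\<close> by a smooth transition map, so a single
  chart that covers \<open>U\<close> suffices.\<close>

lemma smooth_fun_chartI:
  assumes "(W, c) \<in> atlas M" "mopen M U" "U \<subseteq> W" "\<And>k. Ck_on k (c ` U) (f \<circ> inv_into W c)"
  shows "smooth_fun M U f"
proof (rule smooth_funI)
  fix V d k assume d: "(V, d) \<in> atlas M"
  let ?S = "d ` (U \<inter> V)"
  have S: "open ?S" using chart_image_open[OF d assms(2)] .
  have "Ck_on k ?S (c \<circ> inv_into V d)"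
    by (rule Ck_on_subset[OF transition_smooth[OF d assms(1)]]) (use assms(3) in auto)
  moreover have "(c \<circ> inv_into V d) ` ?S \<subseteq> c ` U" using d by auto
  ultimately have "Ck_on k ?S ((f \<circ> inv_into W c) \<circ> (c \<circ> inv_into V d))"
    using assms(4) by (intro Ck_on_compose[OF fin_dim S])
  then show "Ck_on k ?S (f \<circ> inv_into V d)"
    by (rule Ck_on_cong[OF S, rotated]) (use assms(1,3) d in \<open>auto simp: subset_iff\<close>)
qed

lemma smooth_fun_chart: "(W, c) \<in> atlas M \<Longrightarrow> smooth_fun M W c"
  by (rule smooth_funI) (subst Int_commute, rule transition_smooth)

text \<open>Supplies the open sets on which a residual of Gram-Schmidt does not vanish and can be
  normalized.\<close>

lemma open_superlevel:
  fixes f :: "'a \<Rightarrow> real"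
  assumes "mopen M U" "smooth_fun M U f"
  shows "mopen M {q \<in> U. f q > 0}"
proof -
  have "\<exists>T. mopen M T \<and> q \<in> T \<and> T \<subseteq> {q \<in> U. f q > 0}" if q: "q \<in> U" "f q > 0" for q
  proof -
    obtain W c where c: "chart_at M q = (W, c)" "(W, c) \<in> atlas M" "q \<in> W"
      using chart_at q openin_subset[OF assms(1)] by blast
    have "continuous_on (c ` (U \<inter> W)) (f \<circ> inv_into W c)" using smooth_funD[OF assms(2) c(2), of 0] by simp
    then have "open ((f \<circ> inv_into W c) -` {0<..} \<inter> c ` (U \<inter> W))"
      by (subst Int_commute) (rule continuous_open_preimage[OF _ chart_image_open[OF c(2) assms(1)]], auto)
    then have "mopen M {q \<in> W. c q \<in> (f \<circ> inv_into W c) -` {0<..} \<inter> c ` (U \<inter> W)}"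
      by (rule chart_preimage_open[OF c(2)])
    moreover have "r \<in> {q \<in> U. f q > 0}" if "r \<in> W" "c r \<in> (f \<circ> inv_into W c) -` {0<..} \<inter> c ` (U \<inter> W)" for r
      using that inj_on_image_mem_iff[OF chart_inj[OF c(2)], of r "U \<inter> W"] c(2) by simp
    then have "{q \<in> W. c q \<in> (f \<circ> inv_into W c) -` {0<..} \<inter> c ` (U \<inter> W)} \<subseteq> {q \<in> U. f q > 0}"
      by blast
    moreover have "q \<in> {q \<in> W. c q \<in> (f \<circ> inv_into W c) -` {0<..} \<inter> c ` (U \<inter> W)}" using q c by simp
    ultimately show ?thesis by blast
  qed
  then show ?thesis by (subst openin_subopen) blast
qed

lemma dir_deriv_along_field_smooth:
  assumes "mopen M U" "smooth_fun M U f" "vector_field M U X"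
  shows "smooth_fun M U (\<lambda>q. dir_deriv M q (X q) f)"
proof (rule smooth_funI)
  fix W c k assume c: "(W, c) \<in> atlas M"
  let ?S = "c ` (U \<inter> W)"
  have S: "open ?S" using chart_image_open[OF c assms(1)] .
  obtain B :: "'e set" where B: "finite B" "\<And>x. (\<Sum>b\<in>B. (x \<bullet> b) *\<^sub>R b) = x"
    by (rule fin_dim_orthonormal_basis[OF fin_dim]) (rule that)
  let ?x = "(\<lambda>p. dir_deriv M p (X p) c) \<circ> inv_into W c"
  have "Ck_on k (c ` (U \<inter> W \<inter> W)) ?x" using smooth_funD[OF vector_fieldD[OF assms(3) c] c] .
  then have x: "Ck_on k ?S ?x" by (simp add: Int_assoc)
  \<comment> \<open>One derivative of \<open>f\<close> is spent, while the coordinates of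
    \<open>X\<close> enter undifferentiated.\<close>
  have f: "Ck_on (Suc k) ?S (f \<circ> inv_into W c)" using smooth_funD[OF assms(2) c] .
  have "Ck_on k ?S (\<lambda>y. \<Sum>b\<in>B. (?x y \<bullet> b) *\<^sub>R frechet_derivative (f \<circ> inv_into W c) (at y) b)"
    using f by (intro Ck_on_sum[OF S] Ck_on_scaleR[OF S] Ck_on_bounded_linear[OF S bounded_linear_inner_left x]) simp
  then show "Ck_on k ?S ((\<lambda>q. dir_deriv M q (X q) f) \<circ> inv_into W c)"
  proof (rule Ck_on_cong[OF S, rotated])
    fix y assume y: "y \<in> ?S"
    then obtain q where q: "q \<in> U" "q \<in> W" "y = c q" by blast
    interpret linear "frechet_derivative (f \<circ> inv_into W c) (at y)"
      using f[unfolded Ck_on.simps, THEN conjunct1, rule_format, OF y] by (rule linear_frechet_derivative)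
    have "dir_deriv M q (X q) f = frechet_derivative (f \<circ> inv_into W c) (at (c q)) (dir_deriv M q (X q) c)"
      using has_derivative_dir_deriv(2)[OF c q(2) smooth_fun_differentiable[OF assms(2) c q(1,2)]] .
    also have "\<dots> = frechet_derivative (f \<circ> inv_into W c) (at y) (\<Sum>b\<in>B. (?x y \<bullet> b) *\<^sub>R b)"
      using q c by (simp add: B(2))
    also have "\<dots> = (\<Sum>b\<in>B. (?x y \<bullet> b) *\<^sub>R frechet_derivative (f \<circ> inv_into W c) (at y) b)"
      by (simp only: sum scale)
    finally show "(\<Sum>b\<in>B. (?x y \<bullet> b) *\<^sub>R frechet_derivative (f \<circ> inv_into W c) (at y) b)
      = ((\<lambda>q. dir_deriv M q (X q) f) \<circ> inv_into W c) y"
      using q c by simp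
  qed
qed

lemma dir_deriv_chart_linear:
  assumes "(W, c) \<in> atlas M" "q \<in> W"
  shows "linear (\<lambda>u. dir_deriv M q u c)"
  using dir_deriv_linear[OF smooth_fun_chart chart_mopen] assms by blast

lemma vector_field_cong:
  assumes "mopen M U" "vector_field M U X" "\<And>r. r \<in> U \<Longrightarrow> X r = Y r"
  shows "vector_field M U Y"
proof (rule vector_fieldI)
  fix W c assume c: "(W, c) \<in> atlas M"
  show "smooth_fun M (U \<inter> W) (\<lambda>p. dir_deriv M p (Y p) c)"
    by (rule smooth_fun_cong[OF _ vector_fieldD[OF assms(2) c]])
      (use assms chart_mopen[OF c] in auto)
qed

lemma vector_field_local:
  assumes "\<And>q. q \<in> U \<Longrightarrow> \<exists>V. mopen M V \<and> q \<in> V \<and> vector_field M V X"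
  shows "vector_field M U X"
proof (rule vector_fieldI)
  fix W c assume c: "(W, c) \<in> atlas M"
  show "smooth_fun M (U \<inter> W) (\<lambda>p. dir_deriv M p (X p) c)"
  proof (rule smooth_fun_local)
    fix q assume q: "q \<in> U \<inter> W"
    then obtain V where V: "mopen M V" "q \<in> V" "vector_field M V X" using assms by blast
    show "\<exists>V. mopen M V \<and> q \<in> V \<and> smooth_fun M V (\<lambda>p. dir_deriv M p (X p) c)"
      using vector_fieldD[OF V(3) c] V q chart_mopen[OF c] by (intro exI[of _ "V \<inter> W"]) auto
  qed
qed

lemma vector_field_add:
  assumes "mopen M U" "vector_field M U X" "vector_field M U Y"
  shows "vector_field M U (\<lambda>p. X p + Y p)"
proof (rule vector_fieldI)
  fix W c assume c: "(W, c) \<in> atlas M"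
  have UW: "mopen M (U \<inter> W)" using assms chart_mopen[OF c] by auto
  show "smooth_fun M (U \<inter> W) (\<lambda>p. dir_deriv M p (X p + Y p) c)"
    by (rule smooth_fun_cong[OF UW smooth_fun_add[OF UW vector_fieldD[OF assms(2) c] vector_fieldD[OF assms(3) c]]])
      (simp add: linear_add[OF dir_deriv_chart_linear[OF c]])
qed

lemma vector_field_scaleR:
  assumes "mopen M U" "smooth_fun M U f" "vector_field M U X"
  shows "vector_field M U (\<lambda>p. f p *\<^sub>R X p)"
proof (rule vector_fieldI)
  fix W c assume c: "(W, c) \<in> atlas M"
  have UW: "mopen M (U \<inter> W)" using assms chart_mopen[OF c] by auto
  have f: "smooth_fun M (U \<inter> W) f" using smooth_fun_subset[OF assms(2)] by simp
  show "smooth_fun M (U \<inter> W) (\<lambda>p. dir_deriv M p (f p *\<^sub>R X p) c)"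
    by (rule smooth_fun_cong[OF UW smooth_fun_scaleR[OF UW f vector_fieldD[OF assms(3) c]]])
      (simp add: linear_scale[OF dir_deriv_chart_linear[OF c]])
qed

lemma vector_field_zero: "mopen M U \<Longrightarrow> vector_field M U (\<lambda>p. 0)"
proof (rule vector_fieldI)
  fix W c assume U: "mopen M U" and c: "(W, c) \<in> atlas M"
  have UW: "mopen M (U \<inter> W)" using U chart_mopen[OF c] by auto
  show "smooth_fun M (U \<inter> W) (\<lambda>p. dir_deriv M p 0 c)"
    by (rule smooth_fun_cong[OF UW smooth_fun_const[of _ 0]]) (simp add: linear_0[OF dir_deriv_chart_linear[OF c]])
qed

lemma vector_field_sum:
  assumes "mopen M U" "\<And>i. i \<in> I \<Longrightarrow> vector_field M U (X i)"
  shows "vector_field M U (\<lambda>p. \<Sum>i\<in>I. X i p)"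
  using assms(2)
  by (induction I rule: infinite_finite_induct) (auto intro: vector_field_add[OF assms(1)] vector_field_zero[OF assms(1)])

section \<open>Coordinate fields and the Lie bracket\<close>

lemma dir_deriv_coord_field:
  assumes "(W, c) \<in> atlas M" "q \<in> W" "(f \<circ> inv_into W c) differentiable (at (c q))"
  shows "dir_deriv M q (coord_field M W c v q) f = frechet_derivative (f \<circ> inv_into W c) (at (c q)) v"
proof -
  obtain W0 c0 where c0: "chart_at M q = (W0, c0)" "(W0, c0) \<in> atlas M" "q \<in> W0"
    using chart_at chart_subset assms by blast
  have "(f \<circ> inv_into W0 c0 has_derivative (\<lambda>u. dir_deriv M q u f)) (at (c0 q))"
    using has_derivative_dir_deriv(1)[OF assms] c0 by simp
  from has_derivative_change_chart[OF c0(2) assms(1) c0(3) assms(2) this]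
  have "(f \<circ> inv_into W c has_derivative (\<lambda>v. dir_deriv M q (coord_field M W c v q) f)) (at (c q))"
    by (simp add: coord_field_def c0)
  from frechet_derivative_eqI[OF this] show ?thesis by simp
qed

lemma dir_deriv_coord_field_self:
  assumes "(W, c) \<in> atlas M" "q \<in> W"
  shows "dir_deriv M q (coord_field M W c v q) c = v"
proof -
  have "frechet_derivative (c \<circ> inv_into W c) (at (c q)) = frechet_derivative (\<lambda>x. x) (at (c q))"
    using chart_image_open[OF assms(1) chart_mopen[OF assms(1)]] assms
    by (intro frechet_derivative_cong_open[of "c ` (W \<inter> W)"]) auto
  then show ?thesis
    using dir_deriv_coord_field[OF assms smooth_fun_differentiable[OF smooth_fun_chart[OF assms(1)] assms(1,2,2)]] by simp
qed

lemma coord_field_dir_deriv: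
  assumes "(W, c) \<in> atlas M" "q \<in> W"
  shows "coord_field M W c (dir_deriv M q u c) q = u"
proof -
  have q: "q \<in> points M" using chart_subset assms by blast
  obtain W0 c0 where c0: "chart_at M q = (W0, c0)" "(W0, c0) \<in> atlas M" "q \<in> W0"
    using chart_at[OF q] by blast
  have "dir_deriv M q u c0 = frechet_derivative (c0 \<circ> inv_into W c) (at (c q)) (dir_deriv M q u c)"
    by (rule has_derivative_dir_deriv(2)[OF assms smooth_fun_differentiable[OF smooth_fun_chart[OF c0(2)] assms(1) c0(3) assms(2)]])
  then show ?thesis using dir_deriv_chart_at[OF q] by (simp add: coord_field_def c0)
qed

text \<open>Where \<open>(W, c)\<close> is the chosen chart, coordinates and tangent vectors agree.
  Hence every vector at \<open>q\<close> is the value of a smooth field near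
  \<open>q\<close>.\<close>

lemma coord_field_at:
  assumes "q \<in> points M" "chart_at M q = (W, c)"
  shows "coord_field M W c v q = v"
proof -
  have "(W, c) \<in> atlas M" "q \<in> W" using chart_at_domain[OF assms(1)] assms(2) by auto
  then show ?thesis using coord_field_dir_deriv[of W c q v] dir_deriv_chart_at[OF assms(1), of v] assms(2) by simp
qed

lemma vector_field_coord_field:
  assumes c: "(W, c) \<in> atlas M"
  shows "vector_field M W (coord_field M W c v)"
proof (rule vector_fieldI)
  fix V d assume d: "(V, d) \<in> atlas M"
  have WV: "mopen M (W \<inter> V)" using chart_mopen c d by blast
  have o: "open (c ` (W \<inter> V))" using chart_image_open[OF c chart_mopen[OF d]] by (simp add: Int_commute)
  show "smooth_fun M (W \<inter> V) (\<lambda>p. dir_deriv M p (coord_field M W c v p) d)"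
  proof (rule smooth_fun_chartI[OF c WV])
    fix k
    have "Ck_on k (c ` (W \<inter> V)) (\<lambda>x. frechet_derivative (d \<circ> inv_into W c) (at x) v)"
      using transition_smooth[OF c d, of "Suc k"] by simp
    then show "Ck_on k (c ` (W \<inter> V)) ((\<lambda>p. dir_deriv M p (coord_field M W c v p) d) \<circ> inv_into W c)"
    proof (rule Ck_on_cong[OF o, rotated])
      fix x assume "x \<in> c ` (W \<inter> V)"
      then obtain q where q: "q \<in> W" "q \<in> V" "x = c q" by blast
      then show "frechet_derivative (d \<circ> inv_into W c) (at x) v
        = ((\<lambda>p. dir_deriv M p (coord_field M W c v p) d) \<circ> inv_into W c) x"
        using dir_deriv_coord_field[OF c q(1) smooth_fun_differentiable[OF smooth_fun_chart[OF d] c q(2,1)]] c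
        by simp
    qed
  qed auto
qed

text \<open>The bracket is defined through the coordinate map of one chart. For a general
  \<open>f\<close> each iterated derivative is a second derivative of \<open>f\<close> plus the
  derivative of \<open>f\<close> along the differentiated coordinates of the field; the second
  derivatives cancel by symmetry.\<close>

lemma dir_deriv_lie_bracket:
  fixes f :: "'a \<Rightarrow> 'b::real_inner"
  assumes U: "mopen M U" and X: "vector_field M U X" and Y: "vector_field M U Y" and f: "smooth_fun M U f"
    and p: "p \<in> U"
  shows "dir_deriv M p (lie_bracket M X Y p) f =
    dir_deriv M p (X p) (\<lambda>q. dir_deriv M q (Y q) f) - dir_deriv M p (Y p) (\<lambda>q. dir_deriv M q (X q) f)"
proof -
  have pM: "p \<in> points M" using U p openin_subset by blast
  obtain W c where c: "chart_at M p = (W, c)" "(W, c) \<in> atlas M" "p \<in> W" using chart_at[OF pM] by blast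
  let ?S = "c ` (U \<inter> W)" and ?g = "f \<circ> inv_into W c"
  have S: "open ?S" "c p \<in> ?S" using chart_image_open[OF c(2) U] p c by auto
  have g: "Ck_on k ?S ?g" for k using smooth_funD[OF f c(2)] .
  have self: "dir_deriv M p u c = u" for u using dir_deriv_chart_at[OF pM] c by simp
  have main: "dir_deriv M p u (\<lambda>q. dir_deriv M q (Z q) f) =
     frechet_derivative (\<lambda>w. frechet_derivative ?g (at w) (Z p)) (at (c p)) u
     + frechet_derivative ?g (at (c p)) (dir_deriv M p u (\<lambda>q. dir_deriv M q (Z q) c))"
    if Z: "vector_field M U Z" for Z u
  proof -
    let ?z = "(\<lambda>q. dir_deriv M q (Z q) c) \<circ> inv_into W c"
    have UW: "mopen M (U \<inter> W)" "p \<in> U \<inter> W" using U chart_mopen[OF c(2)] p c by auto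
    have z: "(?z has_derivative (\<lambda>u. dir_deriv M p u (\<lambda>q. dir_deriv M q (Z q) c))) (at (c p))"
      using smooth_fun_has_derivative[OF vector_fieldD[OF Z c(2)] UW] c by simp
    have zp: "?z (c p) = Z p" using c self by simp
    have "((\<lambda>w. frechet_derivative ?g (at w) (?z w)) has_derivative
      (\<lambda>u. frechet_derivative (\<lambda>w. frechet_derivative ?g (at w) (Z p)) (at (c p)) u
      + frechet_derivative ?g (at (c p)) (dir_deriv M p u (\<lambda>q. dir_deriv M q (Z q) c)))) (at (c p))"
      using has_derivative_frechet_apply[OF fin_dim S(2) g z S(1)] zp by simp
    moreover have "frechet_derivative ?g (at w) (?z w) = ((\<lambda>q. dir_deriv M q (Z q) f) \<circ> inv_into W c) w"
      if "w \<in> ?S" for w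
    proof -
      obtain q where q: "q \<in> U" "q \<in> W" "w = c q" using \<open>w \<in> ?S\<close> by blast
      then show ?thesis using has_derivative_dir_deriv(2)[OF c(2) q(2) smooth_fun_differentiable[OF f c(2) q(1,2)]] c by simp
    qed
    ultimately have "((\<lambda>q. dir_deriv M q (Z q) f) \<circ> inv_into W c has_derivative
      (\<lambda>u. frechet_derivative (\<lambda>w. frechet_derivative ?g (at w) (Z p)) (at (c p)) u
      + frechet_derivative ?g (at (c p)) (dir_deriv M p u (\<lambda>q. dir_deriv M q (Z q) c)))) (at (c p))"
      by (rule has_derivative_transform_within_open[OF _ S])
    then show ?thesis using dir_deriv_eqI[of "\<lambda>q. dir_deriv M q (Z q) f" p] c by simp
  qed
  interpret linear "frechet_derivative ?g (at (c p))"
    using smooth_fun_differentiable[OF f c(2) p c(3)] by (rule linear_frechet_derivative)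
  have "dir_deriv M p (lie_bracket M X Y p) f = frechet_derivative ?g (at (c p)) (lie_bracket M X Y p)"
    by (simp add: dir_deriv_def c)
  also have "\<dots> = frechet_derivative ?g (at (c p)) (dir_deriv M p (X p) (\<lambda>q. dir_deriv M q (Y q) c))
     - frechet_derivative ?g (at (c p)) (dir_deriv M p (Y p) (\<lambda>q. dir_deriv M q (X q) c))"
    by (simp add: lie_bracket_def c diff)
  finally show ?thesis
    using frechet_derivative_symmetric[OF S g, of "X p" "Y p"] by (simp add: main[OF X] main[OF Y])
qed

end

section \<open>Sections along a map and the pullback connection\<close>

lemma connection_linear:
  "is_connection M \<Gamma> D \<Longrightarrow> mopen M U \<Longrightarrow> \<Gamma> U s \<Longrightarrow> p \<in> U \<Longrightarrow> linear (\<lambda>u. D p u s)"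
  unfolding is_connection_def
  by (drule conjunct2, drule conjunct1, drule spec[of _ U], drule spec[of _ s]) simp

lemma connection_cong:
  "is_connection M \<Gamma> D \<Longrightarrow> mopen M U \<Longrightarrow> \<Gamma> U s \<Longrightarrow> \<Gamma> U t \<Longrightarrow> (\<And>q. q \<in> U \<Longrightarrow> s q = t q) \<Longrightarrow> p \<in> U \<Longrightarrow>
    D p u s = D p u t"
  unfolding is_connection_def
  by (drule conjunct2, drule conjunct2, drule conjunct1, drule spec[of _ U], drule spec[of _ s], drule spec[of _ t]) simp

lemma connection_add:
  "is_connection M \<Gamma> D \<Longrightarrow> mopen M U \<Longrightarrow> \<Gamma> U s \<Longrightarrow> \<Gamma> U t \<Longrightarrow> p \<in> U \<Longrightarrow>
    D p u (\<lambda>q. s q + t q) = D p u s + D p u t"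
  unfolding is_connection_def
  by (drule conjunct2, drule conjunct2, drule conjunct2, drule conjunct1, drule spec[of _ U], drule spec[of _ s],
      drule spec[of _ t]) simp

lemma connection_leibniz:
  "is_connection M \<Gamma> D \<Longrightarrow> mopen M U \<Longrightarrow> \<Gamma> U s \<Longrightarrow> smooth_fun M U f \<Longrightarrow> p \<in> U \<Longrightarrow>
    D p u (\<lambda>q. f q *\<^sub>R s q) = dir_deriv M p u f *\<^sub>R s p + f p *\<^sub>R D p u s"
  unfolding is_connection_def
  by (drule conjunct2, drule conjunct2, drule conjunct2, drule conjunct2, drule spec[of _ U], drule spec[of _ s],
      drule spec[of _ f]) simp

lemma levi_civita_torsion_free:
  "levi_civita M g D \<Longrightarrow> mopen M U \<Longrightarrow> vector_field M U X \<Longrightarrow> vector_field M U Y \<Longrightarrow> p \<in> U \<Longrightarrow>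
    D p (X p) Y - D p (Y p) X = lie_bracket M X Y p"
  unfolding levi_civita_def
  by (drule conjunct2, drule conjunct1, drule spec[of _ U], drule spec[of _ X], drule spec[of _ Y]) simp

lemma levi_civita_metric:
  "levi_civita M g D \<Longrightarrow> mopen M U \<Longrightarrow> vector_field M U X \<Longrightarrow> vector_field M U Y \<Longrightarrow> p \<in> U \<Longrightarrow>
    dir_deriv M p u (\<lambda>q. g q (X q) (Y q)) = g p (D p u X) (Y p) + g p (X p) (D p u Y)"
  unfolding levi_civita_def
  by (drule conjunct2, drule conjunct2, drule spec[of _ U], drule spec[of _ X], drule spec[of _ Y]) simp

lemma connection_zero:
  assumes "is_connection M \<Gamma> D" "mopen M U" "\<Gamma> U (\<lambda>q. 0)" "p \<in> U"
  shows "D p u (\<lambda>q. 0) = 0"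
  using connection_add[OF assms(1,2,3,3,4), of u] by simp

text \<open>The predicate \<open>\<Gamma>\<close> is abstract and carries no closure under addition,
  so the partial sums are assumed to be sections.\<close>

lemma connection_sum:
  assumes D: "is_connection M \<Gamma> D" and U: "mopen M U" and p: "p \<in> U"
    and zero: "\<Gamma> U (\<lambda>q. 0)" and sum: "\<And>J. finite J \<Longrightarrow> J \<subseteq> I \<Longrightarrow> \<Gamma> U (\<lambda>q. \<Sum>i\<in>J. s i q)"
    and I: "finite I"
  shows "D p u (\<lambda>q. \<Sum>i\<in>I. s i q) = (\<Sum>i\<in>I. D p u (s i))"
  using I sum
proof (induction I)
  case empty
  then show ?case by (simp add: connection_zero[OF D U zero p])
next
  case (insert i I)
  have "\<Gamma> U (\<lambda>q. \<Sum>j\<in>{i}. s j q)" by (rule insert.prems) auto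
  then have i: "\<Gamma> U (s i)" by simp
  have "\<Gamma> U (\<lambda>q. \<Sum>j\<in>I. s j q)" by (rule insert.prems) (use insert.hyps in auto)
  from connection_add[OF D U i this p, of u] show ?case
    using insert by (simp add: subset_insertI2)
qed

context smooth_manifold
begin

lemma linear_coord_field:
  assumes "(W, c) \<in> atlas M" "q \<in> W"
  shows "linear (\<lambda>v. coord_field M W c v q)"
proof -
  have "q \<in> points M" using chart_subset assms by blast
  note d = chart_at_domain[OF this]
  show ?thesis unfolding coord_field_def
    by (intro linear_frechet_derivative smooth_fun_differentiable[OF smooth_fun_chart[OF d(1)] assms(1) d(2) assms(2)])
qed

text \<open>In the chart that defines the bracket at \<open>p\<close> both fields have constant
  coordinates, whose derivatives vanish.\<close>

lemma lie_bracket_coord_field_at: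
  assumes "p \<in> points M" "chart_at M p = (W, c)"
  shows "lie_bracket M (coord_field M W c u) (coord_field M W c v) p = 0"
proof -
  have c: "(W, c) \<in> atlas M" "p \<in> W" using chart_at_domain[OF assms(1)] assms(2) by auto
  have "dir_deriv M p x (\<lambda>q. dir_deriv M q (coord_field M W c y q) c) = 0" for x y
  proof -
    have "dir_deriv M p x (\<lambda>q. dir_deriv M q (coord_field M W c y q) c) = dir_deriv M p x (\<lambda>q. y)"
      by (rule dir_deriv_cong[OF chart_mopen[OF c(1)] c(2)]) (rule dir_deriv_coord_field_self[OF c(1)])
    then show ?thesis by simp
  qed
  then show ?thesis by (simp add: lie_bracket_def assms(2))
qed

end

section \<open>Smooth maps and sections along them\<close>

locale smooth_map_between = M: smooth_manifold M + N: smooth_manifold N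
  for M :: "('a, 'e::real_inner) manifold" and N :: "('b, 'f::real_inner) manifold" +
  fixes F :: "'a \<Rightarrow> 'b"
  assumes smooth_map: "smooth_map M N F"
begin

lemma map_points: "p \<in> points M \<Longrightarrow> F p \<in> points N"
  using smooth_map unfolding smooth_map_def continuous_map_def by blast

lemma preimage_open:
  assumes "mopen M U" "mopen N V"
  shows "mopen M (U \<inter> F -` V)"
proof -
  have "mopen M {x \<in> points M. F x \<in> V}"
    using smooth_map assms(2) openin_continuous_map_preimage unfolding smooth_map_def by blast
  moreover have "U \<inter> F -` V = U \<inter> {x \<in> points M. F x \<in> V}" using openin_subset[OF assms(1)] by blast
  ultimately show ?thesis using assms(1) by (simp add: openin_Int)
qed

lemma smooth_fun_chart_comp:
  assumes "(V, d) \<in> atlas N" "mopen M U"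
  shows "smooth_fun M (U \<inter> F -` V) (d \<circ> F)"
  by (rule smooth_fun_subset[of _ "points M \<inter> F -` V"])
    (use smooth_map assms openin_subset[OF assms(2)] in \<open>auto simp: smooth_map_def\<close>)

lemma smooth_fun_pullback:
  assumes U: "mopen M U" and V: "mopen N V" and h: "smooth_fun N V h"
  shows "smooth_fun M (U \<inter> F -` V) (h \<circ> F)"
proof (rule M.smooth_fun_local)
  fix q assume q: "q \<in> U \<inter> F -` V"
  then have "F q \<in> points N" using V openin_subset by blast
  then obtain V0 d where d: "chart_at N (F q) = (V0, d)" "(V0, d) \<in> atlas N" "F q \<in> V0" using N.chart_at by blast
  have V1: "mopen N (V \<inter> V0)" using V N.chart_mopen[OF d(2)] by blast
  have U1: "mopen M (U \<inter> F -` (V \<inter> V0))" using preimage_open[OF U V1] .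
  have sm: "smooth_fun M (U \<inter> F -` (V \<inter> V0)) (d \<circ> F)"
    by (rule smooth_fun_subset[OF smooth_fun_chart_comp[OF d(2) U]]) blast
  have "smooth_fun M (U \<inter> F -` (V \<inter> V0)) (\<lambda>r. (h \<circ> inv_into V0 d) ((d \<circ> F) r))"
    by (rule M.smooth_fun_compose[OF N.fin_dim U1 sm smooth_funD[OF h d(2)]]) auto
  then have "smooth_fun M (U \<inter> F -` (V \<inter> V0)) (h \<circ> F)"
    by (rule M.smooth_fun_cong[OF U1]) (use d in auto)
  then show "\<exists>T. mopen M T \<and> q \<in> T \<and> smooth_fun M T (h \<circ> F)"
    using U1 q d by blast
qed

lemma dir_deriv_pullback:
  assumes p: "p \<in> points M" "F p \<in> V" and V: "mopen N V" and h: "smooth_fun N V h"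
  shows "dir_deriv M p u (h \<circ> F) = dir_deriv N (F p) (differential M N F p u) h"
proof -
  obtain V0 d where d: "chart_at N (F p) = (V0, d)" "(V0, d) \<in> atlas N" "F p \<in> V0"
    using N.chart_at map_points[OF p(1)] by blast
  obtain W c where c: "chart_at M p = (W, c)" "(W, c) \<in> atlas M" "p \<in> W"
    using M.chart_at p(1) by blast
  have U0: "mopen M (points M \<inter> F -` V0)" "p \<in> points M \<inter> F -` V0"
    using preimage_open N.chart_mopen[OF d(2)] p d by auto
  have "(d \<circ> F \<circ> inv_into W c has_derivative differential M N F p) (at (c p))"
    using M.smooth_fun_has_derivative[OF smooth_fun_chart_comp[OF d(2), of "points M"] U0] c d
    unfolding differential_def[abs_def] by simp
  moreover have "(h \<circ> inv_into V0 d has_derivative (\<lambda>u. dir_deriv N (F p) u h)) (at ((d \<circ> F \<circ> inv_into W c) (c p)))"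
    using N.smooth_fun_has_derivative[OF h V p(2)] d c by simp
  ultimately have *: "((h \<circ> inv_into V0 d) \<circ> (d \<circ> F \<circ> inv_into W c) has_derivative
     (\<lambda>u. dir_deriv N (F p) u h) \<circ> differential M N F p) (at (c p))"
    by (rule diff_chain_at)
  have S: "open (c ` ((points M \<inter> F -` V0) \<inter> W))" "c p \<in> c ` ((points M \<inter> F -` V0) \<inter> W)"
    using M.chart_image_open[OF c(2) U0(1)] U0(2) c(3) by auto
  have "((h \<circ> inv_into V0 d) \<circ> (d \<circ> F \<circ> inv_into W c)) y = (h \<circ> F \<circ> inv_into W c) y"
    if "y \<in> c ` ((points M \<inter> F -` V0) \<inter> W)" for y
    using that c d by auto
  from has_derivative_transform_within_open[OF * S this]
  have "(h \<circ> F \<circ> inv_into W c has_derivative (\<lambda>u. dir_deriv N (F p) u h) \<circ> differential M N F p) (at (c p))" .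
  then show ?thesis using M.dir_deriv_eqI[of "h \<circ> F" p] c by (simp add: comp_assoc)
qed

lemma differential_linear: "p \<in> points M \<Longrightarrow> linear (differential M N F p)"
proof -
  assume p: "p \<in> points M"
  obtain V0 d where d: "chart_at N (F p) = (V0, d)" "(V0, d) \<in> atlas N" "F p \<in> V0"
    using N.chart_at map_points[OF p] by blast
  have U0: "mopen M (points M \<inter> F -` V0)" "p \<in> points M \<inter> F -` V0"
    using preimage_open N.chart_mopen[OF d(2)] p d by auto
  show ?thesis
    using M.dir_deriv_linear[OF smooth_fun_chart_comp[OF d(2), of "points M"] U0] d
    unfolding differential_def[abs_def] by simp
qed

lemma dir_deriv_chart_comp:
  assumes "(V, d) \<in> atlas N" "p \<in> points M" "F p \<in> V"
  shows "dir_deriv M p u (d \<circ> F) = dir_deriv N (F p) (differential M N F p u) d"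
  by (rule dir_deriv_pullback[OF assms(2,3) N.chart_mopen[OF assms(1)] N.smooth_fun_chart[OF assms(1)]])

lemma section_alongI:
  "(\<And>V d. (V, d) \<in> atlas N \<Longrightarrow> smooth_fun M (U \<inter> F -` V) (\<lambda>p. dir_deriv N (F p) (s p) d)) \<Longrightarrow> section_along M N F U s"
  by (auto simp: section_along_def)

lemma section_alongD:
  "section_along M N F U s \<Longrightarrow> (V, d) \<in> atlas N \<Longrightarrow> smooth_fun M (U \<inter> F -` V) (\<lambda>p. dir_deriv N (F p) (s p) d)"
  by (auto simp: section_along_def)

text \<open>In a chart \<open>d\<close> of \<open>N\<close> the coordinates of
  \<open>F\<^sub>* Y\<close> are the derivatives of \<open>d \<circ> F\<close> along
  \<open>Y\<close>, which are smooth.\<close>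

lemma section_along_differential:
  assumes "mopen M U" "vector_field M U Y"
  shows "section_along M N F U (\<lambda>q. differential M N F q (Y q))"
proof (rule section_alongI)
  fix V d assume d: "(V, d) \<in> atlas N"
  have o: "mopen M (U \<inter> F -` V)" using preimage_open[OF assms(1) N.chart_mopen[OF d]] .
  have "smooth_fun M (U \<inter> F -` V) (\<lambda>q. dir_deriv M q (Y q) (d \<circ> F))"
    by (rule M.dir_deriv_along_field_smooth[OF o smooth_fun_chart_comp[OF d assms(1)] vector_field_subset[OF assms(2)]]) blast
  then show "smooth_fun M (U \<inter> F -` V) (\<lambda>p. dir_deriv N (F p) (differential M N F p (Y p)) d)"
    by (rule M.smooth_fun_cong[OF o]) (use dir_deriv_chart_comp[OF d] openin_subset[OF assms(1)] in auto)
qed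

lemma section_along_pullback:
  assumes "mopen M U" "mopen N V" "vector_field N V Z"
  shows "section_along M N F (U \<inter> F -` V) (Z \<circ> F)"
proof (rule section_alongI)
  fix V' d assume d: "(V', d) \<in> atlas N"
  have "smooth_fun M (U \<inter> F -` (V \<inter> V')) ((\<lambda>q. dir_deriv N q (Z q) d) \<circ> F)"
    using smooth_fun_pullback[OF assms(1) _ vector_fieldD[OF assms(3) d]] assms(2) N.chart_mopen[OF d] by blast
  then show "smooth_fun M (U \<inter> F -` V \<inter> F -` V') (\<lambda>p. dir_deriv N (F p) ((Z \<circ> F) p) d)"
    by (simp add: comp_def Int_assoc vimage_Int)
qed

lemma section_along_subset:
  assumes "section_along M N F U s" "V \<subseteq> U"
  shows "section_along M N F V s"
proof (rule section_alongI)
  fix V' d assume d: "(V', d) \<in> atlas N"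
  show "smooth_fun M (V \<inter> F -` V') (\<lambda>p. dir_deriv N (F p) (s p) d)"
    by (rule smooth_fun_subset[OF section_alongD[OF assms(1) d]]) (use assms(2) in blast)
qed

lemma section_along_add:
  assumes "mopen M U" "section_along M N F U s" "section_along M N F U t"
  shows "section_along M N F U (\<lambda>q. s q + t q)"
proof (rule section_alongI)
  fix V d assume d: "(V, d) \<in> atlas N"
  have o: "mopen M (U \<inter> F -` V)" using preimage_open[OF assms(1) N.chart_mopen[OF d]] .
  show "smooth_fun M (U \<inter> F -` V) (\<lambda>p. dir_deriv N (F p) (s p + t p) d)"
    by (rule M.smooth_fun_cong[OF o M.smooth_fun_add[OF o section_alongD[OF assms(2) d] section_alongD[OF assms(3) d]]])
      (simp add: linear_add[OF N.dir_deriv_chart_linear[OF d]])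
qed

lemma section_along_scaleR:
  assumes "mopen M U" "smooth_fun M U f" "section_along M N F U s"
  shows "section_along M N F U (\<lambda>q. f q *\<^sub>R s q)"
proof (rule section_alongI)
  fix V d assume d: "(V, d) \<in> atlas N"
  have o: "mopen M (U \<inter> F -` V)" using preimage_open[OF assms(1) N.chart_mopen[OF d]] .
  have f: "smooth_fun M (U \<inter> F -` V) f" by (rule smooth_fun_subset[OF assms(2)]) blast
  show "smooth_fun M (U \<inter> F -` V) (\<lambda>p. dir_deriv N (F p) (f p *\<^sub>R s p) d)"
    by (rule M.smooth_fun_cong[OF o M.smooth_fun_scaleR[OF o f section_alongD[OF assms(3) d]]])
      (simp add: linear_scale[OF N.dir_deriv_chart_linear[OF d]])
qed

lemma section_along_zero: "mopen M U \<Longrightarrow> section_along M N F U (\<lambda>q. 0)"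
proof (rule section_alongI)
  fix V d assume U: "mopen M U" and d: "(V, d) \<in> atlas N"
  have o: "mopen M (U \<inter> F -` V)" using preimage_open[OF U N.chart_mopen[OF d]] .
  show "smooth_fun M (U \<inter> F -` V) (\<lambda>p. dir_deriv N (F p) 0 d)"
    by (rule M.smooth_fun_cong[OF o M.smooth_fun_const[of _ 0]])
      (simp add: linear_0[OF N.dir_deriv_chart_linear[OF d]])
qed

lemma section_along_sum:
  assumes "mopen M U" "\<And>i. i \<in> I \<Longrightarrow> section_along M N F U (s i)"
  shows "section_along M N F U (\<lambda>q. \<Sum>i\<in>I. s i q)"
  using assms(2)
  by (induction I rule: infinite_finite_induct)
    (auto intro: section_along_add[OF assms(1)] section_along_zero[OF assms(1)])

text \<open>The pulled back coordinate fields form a local frame of the pullback bundle, and the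
  coefficients are the coordinates of \<open>s q\<close> in the chart \<open>d\<close>.\<close>

lemma section_expansion:
  assumes "(V, d) \<in> atlas N" "F q \<in> V" and B: "\<And>x::'f. (\<Sum>b\<in>B. (x \<bullet> b) *\<^sub>R b) = x"
  shows "s q = (\<Sum>b\<in>B. (dir_deriv N (F q) (s q) d \<bullet> b) *\<^sub>R (coord_field N V d b \<circ> F) q)"
proof -
  have "s q = coord_field N V d (\<Sum>b\<in>B. (dir_deriv N (F q) (s q) d \<bullet> b) *\<^sub>R b) (F q)"
    using N.coord_field_dir_deriv[OF assms(1,2)] by (simp add: B)
  also have "\<dots> = (\<Sum>b\<in>B. (dir_deriv N (F q) (s q) d \<bullet> b) *\<^sub>R (coord_field N V d b \<circ> F) q)"
    by (simp add: linear_sum[OF N.linear_coord_field[OF assms(1,2)]] linear_scale[OF N.linear_coord_field[OF assms(1,2)]])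
  finally show ?thesis .
qed

end

section \<open>The pullback of the Levi-Civita connection\<close>

locale pullback_levi_civita = smooth_map_between M N F
  for M :: "('a, 'e::real_inner) manifold" and N :: "('b, 'f::real_inner) manifold" and F +
  fixes h :: "'b \<Rightarrow> 'f \<Rightarrow> 'f \<Rightarrow> real"
    and DN :: "'b \<Rightarrow> 'f \<Rightarrow> ('b \<Rightarrow> 'f) \<Rightarrow> 'f" and DF :: "'a \<Rightarrow> 'e \<Rightarrow> ('a \<Rightarrow> 'f) \<Rightarrow> 'f"
  assumes riemannian_N: "riemannian_manifold N h"
    and levi_civita_N: "levi_civita N h DN"
    and pullback_connection: "pullback_connection M N F DN DF"
begin

lemma connection_N: "is_connection N (vector_field N) DN"
  using levi_civita_N by (simp add: levi_civita_def)

lemma connection_F: "is_connection M (section_along M N F) DF"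
  using pullback_connection by (simp add: pullback_connection_def)

lemma pullback_of_field:
  "mopen N W \<Longrightarrow> vector_field N W Z \<Longrightarrow> p \<in> points M \<Longrightarrow> F p \<in> W \<Longrightarrow>
    DF p u (Z \<circ> F) = DN (F p) (differential M N F p u) Z"
  using pullback_connection unfolding pullback_connection_def by blast

text \<open>The Leibniz rule is applied to the expansion of \<open>s\<close> in pulled back
  coordinate fields, on which \<open>DF\<close> is prescribed. The inner product with
  \<open>b\<close> reads off coordinates in the model space and is unrelated to the metric
  \<open>h\<close>.\<close>

lemma pullback_coord_expansion:
  assumes U: "mopen M U" and s: "section_along M N F U s" and p: "p \<in> U"
    and d: "(V, d) \<in> atlas N" "F p \<in> V"
    and fin: "finite B" and B: "\<And>x::'f. (\<Sum>b\<in>B. (x \<bullet> b) *\<^sub>R b) = x"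
  shows "DF p u s = (\<Sum>b\<in>B. dir_deriv M p u (\<lambda>q. dir_deriv N (F q) (s q) d \<bullet> b) *\<^sub>R coord_field N V d b (F p)
    + (dir_deriv N (F p) (s p) d \<bullet> b) *\<^sub>R DF p u (coord_field N V d b \<circ> F))"
proof -
  let ?U = "U \<inter> F -` V" and ?Z = "\<lambda>b. coord_field N V d b \<circ> F"
    and ?f = "\<lambda>b q. dir_deriv N (F q) (s q) d \<bullet> b"
  have U': "mopen M ?U" "p \<in> ?U" using preimage_open[OF U N.chart_mopen[OF d(1)]] p d by auto
  have f: "smooth_fun M ?U (?f b)" for b
    by (rule M.smooth_fun_bounded_linear[OF U'(1) bounded_linear_inner_left section_alongD[OF s d(1)]])
  have Z: "section_along M N F ?U (?Z b)" for b
    by (rule section_along_pullback[OF U N.chart_mopen[OF d(1)] N.vector_field_coord_field[OF d(1)]])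
  have s': "section_along M N F ?U s" by (rule section_along_subset[OF s]) blast
  have fZ: "section_along M N F ?U (\<lambda>q. ?f b q *\<^sub>R ?Z b q)" for b
    by (rule section_along_scaleR[OF U'(1) f Z])
  have "DF p u s = DF p u (\<lambda>q. \<Sum>b\<in>B. ?f b q *\<^sub>R ?Z b q)"
    by (rule connection_cong[OF connection_F U'(1) s' section_along_sum[OF U'(1) fZ] _ U'(2)])
      (use section_expansion[OF d(1) _ B] in blast)
  also have "\<dots> = (\<Sum>b\<in>B. DF p u (\<lambda>q. ?f b q *\<^sub>R ?Z b q))"
    by (rule connection_sum[OF connection_F U' section_along_zero[OF U'(1)] section_along_sum[OF U'(1) fZ] fin])
  finally show ?thesis
    unfolding connection_leibniz[OF connection_F U'(1) Z f U'(2)] by simp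
qed

text \<open>With constant coefficients the Leibniz rule loses its derivative term. So
  \<open>DN y w (coord_field N V d v)\<close> plays the role of the Christoffel symbol.\<close>

lemma christoffel_linear:
  assumes d: "(V, d) \<in> atlas N" "y \<in> V" and fin: "finite B" and B: "\<And>x::'f. (\<Sum>b\<in>B. (x \<bullet> b) *\<^sub>R b) = x"
  shows "DN y w (coord_field N V d v) = (\<Sum>b\<in>B. (v \<bullet> b) *\<^sub>R DN y w (coord_field N V d b))"
proof -
  note V = N.chart_mopen[OF d(1)]
  note Z = N.vector_field_coord_field[OF d(1)]
  have cZ: "vector_field N V (\<lambda>q. (v \<bullet> b) *\<^sub>R coord_field N V d b q)" for b
    by (rule N.vector_field_scaleR[OF V N.smooth_fun_const Z])
  have "coord_field N V d v q = (\<Sum>b\<in>B. (v \<bullet> b) *\<^sub>R coord_field N V d b q)" if "q \<in> V" for q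
  proof -
    have "coord_field N V d v q = coord_field N V d (\<Sum>b\<in>B. (v \<bullet> b) *\<^sub>R b) q" by (simp only: B)
    then show ?thesis
      by (simp only: linear_sum[OF N.linear_coord_field[OF d(1) that]] linear_scale[OF N.linear_coord_field[OF d(1) that]])
  qed
  then have "DN y w (coord_field N V d v) = DN y w (\<lambda>q. \<Sum>b\<in>B. (v \<bullet> b) *\<^sub>R coord_field N V d b q)"
    by (rule connection_cong[OF connection_N V Z N.vector_field_sum[OF V cZ] _ d(2)])
  also have "\<dots> = (\<Sum>b\<in>B. DN y w (\<lambda>q. (v \<bullet> b) *\<^sub>R coord_field N V d b q))"
    by (rule connection_sum[OF connection_N V d(2) N.vector_field_zero[OF V] N.vector_field_sum[OF V cZ] fin])
  finally show ?thesis
    by (simp add: connection_leibniz[OF connection_N V Z N.smooth_fun_const d(2)])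
qed

text \<open>Coordinate fields commute and the connection is torsion free. In the chart chosen at
  \<open>y\<close> the two fields take the values \<open>v\<close> and \<open>w\<close>
  there.\<close>

lemma christoffel_symmetric:
  assumes "y \<in> points N" "chart_at N y = (V, d)"
  shows "DN y w (coord_field N V d v) = DN y v (coord_field N V d w)"
proof -
  have d: "(V, d) \<in> atlas N" "y \<in> V" using N.chart_at_domain[OF assms(1)] assms(2) by auto
  have "DN y (coord_field N V d w y) (coord_field N V d v) - DN y (coord_field N V d v y) (coord_field N V d w) =
     lie_bracket N (coord_field N V d w) (coord_field N V d v) y"
    by (rule levi_civita_torsion_free[OF levi_civita_N N.chart_mopen[OF d(1)]
          N.vector_field_coord_field[OF d(1)] N.vector_field_coord_field[OF d(1)] d(2)])
  then show ?thesis
    by (simp add: N.coord_field_at[OF assms] N.lie_bracket_coord_field_at[OF assms])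
qed

text \<open>The classical coordinate formula: the derivative of the components of \<open>s\<close>,
  plus the Christoffel term in \<open>F\<^sub>* u\<close> and \<open>s p\<close>. The chart is the
  one chosen at \<open>F p\<close>, so components at \<open>p\<close> are themselves tangent
  vectors.\<close>

lemma pullback_formula:
  assumes U: "mopen M U" and s: "section_along M N F U s" and p: "p \<in> U"
    and d: "chart_at N (F p) = (V, d)"
  shows "DF p u s = dir_deriv M p u (\<lambda>q. dir_deriv N (F q) (s q) d)
    + DN (F p) (differential M N F p u) (coord_field N V d (s p))"
proof -
  obtain B :: "'f set" where B: "finite B" "\<And>x. (\<Sum>b\<in>B. (x \<bullet> b) *\<^sub>R b) = x"
    by (rule fin_dim_orthonormal_basis[OF N.fin_dim]) (rule that)
  have pM: "p \<in> points M" using U p openin_subset by blast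
  note pN = map_points[OF pM]
  have d': "(V, d) \<in> atlas N" "F p \<in> V" using N.chart_at_domain[OF pN] d by auto
  have U': "mopen M (U \<inter> F -` V)" "p \<in> U \<inter> F -` V" using preimage_open[OF U N.chart_mopen[OF d'(1)]] p d' by auto
  have sp: "dir_deriv N (F p) (s p) d = s p" using N.dir_deriv_chart_at[OF pN, of "s p"] d by simp
  have "dir_deriv M p u (\<lambda>q. dir_deriv N (F q) (s q) d \<bullet> b) = dir_deriv M p u (\<lambda>q. dir_deriv N (F q) (s q) d) \<bullet> b" for b
    by (rule M.dir_deriv_bounded_linear[OF bounded_linear_inner_left section_alongD[OF s d'(1)] U'])
  moreover have "DF p u (coord_field N V d b \<circ> F) = DN (F p) (differential M N F p u) (coord_field N V d b)" for b
    by (rule pullback_of_field[OF N.chart_mopen[OF d'(1)] N.vector_field_coord_field[OF d'(1)] pM d'(2)])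
  ultimately show ?thesis
    unfolding pullback_coord_expansion[OF U s p d' B] christoffel_linear[OF d' B, of _ "s p"]
    by (simp add: sum.distrib sp N.coord_field_at[OF pN d] B(2))
qed

text \<open>The Christoffel terms of the coordinate formula cancel by symmetry. The component terms
  are iterated derivatives of \<open>d \<circ> F\<close>, whose difference is the derivative along
  the bracket.\<close>

lemma pullback_torsion_free:
  assumes U: "mopen M U" and X: "vector_field M U X" and Y: "vector_field M U Y" and p: "p \<in> U"
  shows "DF p (X p) (\<lambda>q. differential M N F q (Y q)) - DF p (Y p) (\<lambda>q. differential M N F q (X q))
    = differential M N F p (lie_bracket M X Y p)"
proof -
  have pM: "p \<in> points M" using U p openin_subset by blast
  obtain V d where d: "chart_at N (F p) = (V, d)" "(V, d) \<in> atlas N" "F p \<in> V"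
    using N.chart_at map_points[OF pM] by blast
  have U': "mopen M (U \<inter> F -` V)" "p \<in> U \<inter> F -` V" using preimage_open[OF U N.chart_mopen[OF d(2)]] p d by auto
  have eq: "dir_deriv M p u (\<lambda>q. dir_deriv N (F q) (differential M N F q (Z q)) d)
     = dir_deriv M p u (\<lambda>q. dir_deriv M q (Z q) (d \<circ> F))" for u Z
    by (rule M.dir_deriv_cong[OF U']) (use dir_deriv_chart_comp[OF d(2)] openin_subset[OF U] in auto)
  have X': "vector_field M (U \<inter> F -` V) X" and Y': "vector_field M (U \<inter> F -` V) Y"
    using vector_field_subset X Y by blast+
  have "dir_deriv M p (lie_bracket M X Y p) (d \<circ> F) =
    dir_deriv M p (X p) (\<lambda>q. dir_deriv M q (Y q) (d \<circ> F)) - dir_deriv M p (Y p) (\<lambda>q. dir_deriv M q (X q) (d \<circ> F))"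
    by (rule M.dir_deriv_lie_bracket[OF U'(1) X' Y' smooth_fun_chart_comp[OF d(2) U] U'(2)])
  then show ?thesis
    unfolding pullback_formula[OF U section_along_differential[OF U X] p d(1)]
      pullback_formula[OF U section_along_differential[OF U Y] p d(1)] eq
    using christoffel_symmetric[OF map_points[OF pM] d(1), of "differential M N F p (X p)" "differential M N F p (Y p)"]
    by (simp add: differential_def d(1))
qed

lemma bilinear_h: "q \<in> points N \<Longrightarrow> bilinear (h q)"
  using riemannian_N by (rule riemannian_manifold.metric_bilinear)

lemma h_linear:
  assumes "q \<in> points N"
  shows "linear (h q x)" "linear (\<lambda>x. h q x y)"
  using bilinear_h[OF assms] by (auto simp: bilinear_def)

text \<open>Prepares the product rule, which asks for smooth factors. Smoothness of \<open>h\<close>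
  is given for fields on \<open>N\<close>, so \<open>s\<close> is expanded in pulled back coordinate
  fields, whose inner products are smooth functions composed with \<open>F\<close>.\<close>

lemma smooth_metric_sections_coord:
  assumes U: "mopen M U" and s: "section_along M N F U s" and d: "(V, d) \<in> atlas N"
  shows "smooth_fun M (U \<inter> F -` V) (\<lambda>q. h (F q) (s q) (coord_field N V d b (F q)))"
proof -
  obtain B :: "'f set" where B: "finite B" "\<And>x. (\<Sum>b\<in>B. (x \<bullet> b) *\<^sub>R b) = x"
    by (rule fin_dim_orthonormal_basis[OF N.fin_dim]) (rule that)
  have U': "mopen M (U \<inter> F -` V)" using preimage_open[OF U N.chart_mopen[OF d]] .
  let ?Z = "\<lambda>a. coord_field N V d a"
  have "smooth_fun M (U \<inter> F -` V) ((\<lambda>y. h y (?Z a y) (?Z b y)) \<circ> F)" for a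
    by (intro smooth_fun_pullback[OF U N.chart_mopen[OF d]] riemannian_manifold.metric_smooth[OF riemannian_N]
        N.chart_mopen[OF d] N.vector_field_coord_field[OF d])
  then have "smooth_fun M (U \<inter> F -` V)
    (\<lambda>q. \<Sum>a\<in>B. (dir_deriv N (F q) (s q) d \<bullet> a) *\<^sub>R ((\<lambda>y. h y (?Z a y) (?Z b y)) \<circ> F) q)"
    by (intro M.smooth_fun_sum[OF U'] M.smooth_fun_scaleR[OF U']
        M.smooth_fun_bounded_linear[OF U' bounded_linear_inner_left section_alongD[OF s d]])
  then show ?thesis
  proof (rule M.smooth_fun_cong[OF U'])
    fix q assume q: "q \<in> U \<inter> F -` V"
    then have qN: "F q \<in> points N" using N.chart_subset[OF d] by blast
    have "h (F q) (s q) (?Z b (F q)) =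
      h (F q) (\<Sum>a\<in>B. (dir_deriv N (F q) (s q) d \<bullet> a) *\<^sub>R (?Z a \<circ> F) q) (?Z b (F q))"
      using section_expansion[OF d _ B(2), of q s] q by simp
    then show "(\<Sum>a\<in>B. (dir_deriv N (F q) (s q) d \<bullet> a) *\<^sub>R ((\<lambda>y. h y (?Z a y) (?Z b y)) \<circ> F) q)
      = h (F q) (s q) (?Z b (F q))"
      by (simp add: linear_sum[OF h_linear(2)[OF qN]] linear_scale[OF h_linear(2)[OF qN]])
  qed
qed

text \<open>The defect of metric compatibility is linear over functions in the second section, so it
  suffices to test it on coordinate fields.\<close>

lemma pullback_metric_from_coord:
  assumes U: "mopen M U" and s: "section_along M N F U s" and t: "section_along M N F U t" and p: "p \<in> U"
    and d: "(V, d) \<in> atlas N" "F p \<in> V"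
    and coord: "\<And>b. dir_deriv M p u (\<lambda>q. h (F q) (s q) (coord_field N V d b (F q)))
      = h (F p) (DF p u s) (coord_field N V d b (F p)) + h (F p) (s p) (DF p u (coord_field N V d b \<circ> F))"
  shows "dir_deriv M p u (\<lambda>q. h (F q) (s q) (t q)) = h (F p) (DF p u s) (t p) + h (F p) (s p) (DF p u t)"
proof -
  obtain B :: "'f set" where B: "finite B" "\<And>x. (\<Sum>b\<in>B. (x \<bullet> b) *\<^sub>R b) = x"
    by (rule fin_dim_orthonormal_basis[OF N.fin_dim]) (rule that)
  let ?U = "U \<inter> F -` V"
  have U': "mopen M ?U" "p \<in> ?U" using preimage_open[OF U N.chart_mopen[OF d(1)]] p d by auto
  have pN: "F p \<in> points N" using d N.chart_subset by blast
  let ?Z = "\<lambda>b. coord_field N V d b" and ?f = "\<lambda>b q. dir_deriv N (F q) (t q) d \<bullet> b"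
  have f: "smooth_fun M ?U (?f b)" for b
    by (rule M.smooth_fun_bounded_linear[OF U'(1) bounded_linear_inner_left section_alongD[OF t d(1)]])
  note hZ = smooth_metric_sections_coord[OF U s d(1)]
  have exp: "h (F q) x (t q) = (\<Sum>b\<in>B. ?f b q *\<^sub>R h (F q) x (?Z b (F q)))" if "q \<in> ?U" for q x
  proof -
    have qN: "F q \<in> points N" using that N.chart_subset[OF d(1)] by blast
    have "h (F q) x (t q) = h (F q) x (\<Sum>b\<in>B. ?f b q *\<^sub>R (?Z b \<circ> F) q)"
      using section_expansion[OF d(1) _ B(2), of q t] that by simp
    then show ?thesis by (simp add: linear_sum[OF h_linear(1)[OF qN]] linear_scale[OF h_linear(1)[OF qN]])
  qed
  have "dir_deriv M p u (\<lambda>q. h (F q) (s q) (t q)) = dir_deriv M p u (\<lambda>q. \<Sum>b\<in>B. ?f b q *\<^sub>R h (F q) (s q) (?Z b (F q)))"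
    by (rule M.dir_deriv_cong[OF U' exp])
  also have "\<dots> = (\<Sum>b\<in>B. dir_deriv M p u (\<lambda>q. ?f b q *\<^sub>R h (F q) (s q) (?Z b (F q))))"
    by (rule M.dir_deriv_sum[OF M.smooth_fun_scaleR[OF U'(1) f hZ] U'])
  also have "\<dots> = (\<Sum>b\<in>B. ?f b p *\<^sub>R h (F p) (DF p u s) (?Z b (F p)))
     + (\<Sum>b\<in>B. dir_deriv M p u (?f b) *\<^sub>R h (F p) (s p) (?Z b (F p)) + ?f b p *\<^sub>R h (F p) (s p) (DF p u (?Z b \<circ> F)))"
    by (simp only: M.dir_deriv_scaleR[OF f hZ U'] coord sum.distrib[symmetric] scaleR_add_right ac_simps)
  also have "(\<Sum>b\<in>B. ?f b p *\<^sub>R h (F p) (DF p u s) (?Z b (F p))) = h (F p) (DF p u s) (t p)"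
    using exp[OF U'(2)] by simp
  also have "(\<Sum>b\<in>B. dir_deriv M p u (?f b) *\<^sub>R h (F p) (s p) (?Z b (F p)) + ?f b p *\<^sub>R h (F p) (s p) (DF p u (?Z b \<circ> F)))
    = h (F p) (s p) (DF p u t)"
    unfolding pullback_coord_expansion[OF U t p d B]
    by (simp add: linear_sum[OF h_linear(1)[OF pN]] linear_add[OF h_linear(1)[OF pN]] linear_scale[OF h_linear(1)[OF pN]])
  finally show ?thesis .
qed

text \<open>The reduction to coordinate fields acts on the second section. It is used with a pulled
  back coordinate field in the first slot and, after the slots are exchanged by symmetry of
  \<open>h\<close>, once more for arbitrary sections. For two coordinate fields the claim is the
  metric compatibility of \<open>DN\<close>.\<close>

lemma pullback_metric:
  assumes U: "mopen M U" and s: "section_along M N F U s" and t: "section_along M N F U t" and p: "p \<in> U"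
  shows "dir_deriv M p u (\<lambda>q. h (F q) (s q) (t q)) = h (F p) (DF p u s) (t p) + h (F p) (s p) (DF p u t)"
proof -
  have pM: "p \<in> points M" using U p openin_subset by blast
  note pN = map_points[OF pM]
  obtain V d where d: "(V, d) \<in> atlas N" "F p \<in> V" using N.chart_at[OF pN] by blast
  let ?U = "U \<inter> F -` V"
  have U': "mopen M ?U" "p \<in> ?U" using preimage_open[OF U N.chart_mopen[OF d(1)]] p d by auto
  have sub: "F q \<in> points N" if "q \<in> ?U" for q using that N.chart_subset[OF d(1)] by blast
  note V = N.chart_mopen[OF d(1)] and Z = N.vector_field_coord_field[OF d(1)]
  let ?Z = "\<lambda>b. coord_field N V d b \<circ> F"
  have secZ: "section_along M N F ?U (?Z b)" for b by (rule section_along_pullback[OF U V Z])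
  have sec: "section_along M N F ?U r" if "section_along M N F U r" for r
    by (rule section_along_subset[OF that]) blast
  have base: "dir_deriv M p u (\<lambda>q. h (F q) (?Z a q) (coord_field N V d b (F q)))
    = h (F p) (DF p u (?Z a)) (coord_field N V d b (F p)) + h (F p) (?Z a p) (DF p u (?Z b))" for a b
  proof -
    have "dir_deriv M p u ((\<lambda>y. h y (coord_field N V d a y) (coord_field N V d b y)) \<circ> F)
      = dir_deriv N (F p) (differential M N F p u) (\<lambda>y. h y (coord_field N V d a y) (coord_field N V d b y))"
      by (intro dir_deriv_pullback[OF pM d(2) V] riemannian_manifold.metric_smooth[OF riemannian_N] V Z)
    also have "\<dots> = h (F p) (DN (F p) (differential M N F p u) (coord_field N V d a)) (coord_field N V d b (F p))
      + h (F p) (coord_field N V d a (F p)) (DN (F p) (differential M N F p u) (coord_field N V d b))"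
      by (rule levi_civita_metric[OF levi_civita_N V Z Z d(2)])
    finally show ?thesis
      unfolding pullback_of_field[OF V Z pM d(2)] by (simp add: comp_def)
  qed
  have one: "dir_deriv M p u (\<lambda>q. h (F q) (?Z a q) (r q)) = h (F p) (DF p u (?Z a)) (r p) + h (F p) (?Z a p) (DF p u r)"
    if "section_along M N F U r" for a r
    by (rule pullback_metric_from_coord[OF U'(1) secZ sec[OF that] U'(2) d base])
  have "dir_deriv M p u (\<lambda>q. h (F q) (s q) (coord_field N V d b (F q)))
      = h (F p) (DF p u s) (coord_field N V d b (F p)) + h (F p) (s p) (DF p u (?Z b))" for b
  proof -
    have "dir_deriv M p u (\<lambda>q. h (F q) (s q) (coord_field N V d b (F q))) = dir_deriv M p u (\<lambda>q. h (F q) (?Z b q) (s q))"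
      by (rule M.dir_deriv_cong[OF U']) (use riemannian_manifold.metric_sym[OF riemannian_N] sub in auto)
    then show ?thesis
      using one[OF s, of b] riemannian_manifold.metric_sym[OF riemannian_N pN] by (simp add: add.commute)
  qed
  then show ?thesis by (rule pullback_metric_from_coord[OF U s t p d])
qed

end

section \<open>Orthonormal frames and cutoff fields\<close>

lemma fin_dim_euclidean: "fin_dim TYPE('a::euclidean_space)"
  unfolding fin_dim_def using finite_Basis span_Basis by blast

lemma orthonormal_family_expand:
  fixes G :: "'e::real_vector \<Rightarrow> 'e \<Rightarrow> real" and E :: "nat \<Rightarrow> 'e"
  assumes G: "bilinear G" and on: "\<And>i j. i < r \<Longrightarrow> j < r \<Longrightarrow> G (E i) (E j) = (if i = j then 1 else 0)"
    and x: "x \<in> span (E ` {..<r})"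
  shows "x = (\<Sum>i<r. G x (E i) *\<^sub>R E i)"
proof -
  have lin: "linear (\<lambda>y. G y z)" for z using G by (simp add: bilinear_def)
  have "linear (\<lambda>x. (\<Sum>i<r. G x (E i) *\<^sub>R E i) - x)"
    by (intro linear_compose_sub linear_compose_sum ballI linear_ident linear_compose[OF lin, unfolded comp_def]
        linearI) (auto simp: scaleR_left_distrib)
  moreover have "(\<Sum>i<r. G y (E i) *\<^sub>R E i) - y = 0" if "y \<in> E ` {..<r}" for y
  proof -
    from that obtain j where j: "j < r" "y = E j" by auto
    have "(\<Sum>i<r. G y (E i) *\<^sub>R E i) = (\<Sum>i<r. if i = j then E j else 0)"
      using j by (intro sum.cong) (auto simp: on)
    then show ?thesis using j by simp
  qed
  ultimately have "(\<Sum>i<r. G x (E i) *\<^sub>R E i) - x = 0" by (rule linear_eq_0_on_span[OF _ _ x])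
  then show ?thesis by simp
qed

lemma orthonormal_family_independent:
  fixes G :: "'e::real_vector \<Rightarrow> 'e \<Rightarrow> real" and E :: "nat \<Rightarrow> 'e"
  assumes G: "bilinear G" and on: "\<And>i j. i < r \<Longrightarrow> j < r \<Longrightarrow> G (E i) (E j) = (if i = j then 1 else 0)"
    and i: "i < r"
  shows "E i \<notin> span (E ` {..<i})"
proof
  assume E: "E i \<in> span (E ` {..<i})"
  have "linear (\<lambda>y. G y (E i))" using G by (simp add: bilinear_def)
  moreover have "G y (E i) = 0" if "y \<in> E ` {..<i}" for y using that i by (auto simp: on)
  ultimately have "G (E i) (E i) = 0" by (rule linear_eq_0_on_span[OF _ _ E])
  then show False using on[OF i i] by simp
qed

text \<open>Independence is phrased along the sequence, each vector outside the span of its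
  predecessors; this is the form that Gram-Schmidt consumes.\<close>

lemma independent_sequence:
  fixes x :: "nat \<Rightarrow> 'e::real_vector"
  assumes "\<And>i. i < r \<Longrightarrow> x i \<notin> span (x ` {..<i})"
  shows "independent (x ` {..<r})" "card (x ` {..<r}) = r"
proof -
  have "independent (x ` {..<r}) \<and> card (x ` {..<r}) = r"
    using assms
  proof (induction r)
    case 0
    then show ?case by (simp add: independent_empty)
  next
    case (Suc r)
    have IH: "independent (x ` {..<r})" "card (x ` {..<r}) = r"
      using Suc.IH[OF Suc.prems[OF less_SucI]] by blast+
    have "x r \<notin> span (x ` {..<r})" by (rule Suc.prems) simp
    moreover from this have "x r \<notin> x ` {..<r}" using span_base[of "x r" "x ` {..<r}"] by argo
    ultimately show ?case using IH unfolding lessThan_Suc image_insert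
      by (simp add: independent_insert)
  qed
  then show "independent (x ` {..<r})" "card (x ` {..<r}) = r" by auto
qed

lemma sequence_le_DIM:
  fixes x :: "nat \<Rightarrow> 'e::euclidean_space"
  assumes "\<And>i. i < r \<Longrightarrow> x i \<notin> span (x ` {..<i})"
  shows "r \<le> DIM('e)"
proof -
  have "independent (x ` {..<r})" "card (x ` {..<r}) = r"
    by (rule independent_sequence[OF assms], assumption)+
  then show ?thesis using independent_bound[of "x ` {..<r}"] by simp
qed

lemma extend_independent_sequence:
  fixes x :: "nat \<Rightarrow> 'e::euclidean_space"
  assumes x: "\<And>i. i < n \<Longrightarrow> x i \<notin> span (x ` {..<i})"
  obtains y where "\<And>i. i < n \<Longrightarrow> y i = x i" "\<And>i. i < DIM('e) \<Longrightarrow> y i \<notin> span (y ` {..<i})"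
proof -
  \<comment> \<open>Induction on the length of the checked prefix: below \<open>n\<close> the given
    vectors are kept, from \<open>n\<close> on a vector outside a span of dimension less than
    \<open>DIM('e)\<close> is chosen.\<close>
  have "\<exists>y. (\<forall>i<n. y i = x i) \<and> (\<forall>i<r. y i \<notin> span (y ` {..<i}))" if "r \<le> DIM('e)" for r
    using that
  proof (induction r)
    case 0
    then show ?case by auto
  next
    case (Suc r)
    then obtain y where y: "\<forall>i<n. y i = x i" "\<forall>i<r. y i \<notin> span (y ` {..<i})" by auto
    show ?case
    proof (cases "r < n")
      case True
      have "y ` {..<r} = x ` {..<r}" using y(1) True by (intro image_cong) auto
      then have "y r \<notin> span (y ` {..<r})" using x[OF True] y(1) True by simp
      then show ?thesis using y by (intro exI[of _ y]) (auto simp: less_Suc_eq)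
    next
      case False
      have "dim (y ` {..<r}) \<le> card (y ` {..<r})" by (rule dim_le_card') simp
      also have "\<dots> \<le> r" using card_image_le[of "{..<r}" y] by simp
      also have "\<dots> < DIM('e)" using Suc.prems by simp
      finally have "span (y ` {..<r}) \<noteq> UNIV" using dim_eq_full by (metis less_irrefl)
      then obtain z where z: "z \<notin> span (y ` {..<r})" by auto
      define y' where "y' = y(r := z)"
      have y'_r: "y' r = z" and y'_i: "i \<noteq> r \<Longrightarrow> y' i = y i" for i by (auto simp: y'_def)
      have "y' ` {..<i} = y ` {..<i}" if "i \<le> r" for i
        using that y'_i by (intro image_cong) auto
      then show ?thesis
        using y z False y'_r y'_i by (intro exI[of _ y']) (auto simp: less_Suc_eq)
    qed
  qed
  then show ?thesis using that by blast
qed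

lemma span_orthonormal_full:
  fixes G :: "'e::euclidean_space \<Rightarrow> 'e \<Rightarrow> real"
  assumes "bilinear G" "\<And>i j. i < DIM('e) \<Longrightarrow> j < DIM('e) \<Longrightarrow> G (E i) (E j) = (if i = j then 1 else 0)"
  shows "span (E ` {..<DIM('e)}) = UNIV"
  using independent_sequence[of "DIM('e)" E, OF orthonormal_family_independent[OF assms]]
    card_ge_dim_independent[of "E ` {..<DIM('e)}" UNIV] by auto

text \<open>The change of basis is orthogonal: expanding \<open>A j\<close> in the
  \<open>E i\<close> shows that the sum over \<open>i\<close> of
  \<open>G (E i) (A j) * G (E i) (A k)\<close> is \<open>G (A j) (A k)\<close>, which is 1 or
  0.\<close>

lemma trace_orthonormal_independent:
  fixes G :: "'e::real_vector \<Rightarrow> 'e \<Rightarrow> real" and B :: "'e \<Rightarrow> 'e \<Rightarrow> 'f::real_vector"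
    and E A :: "nat \<Rightarrow> 'e"
  assumes G: "bilinear G" "\<And>u v. G u v = G v u"
    and E: "\<And>i j. i < r \<Longrightarrow> j < r \<Longrightarrow> G (E i) (E j) = (if i = j then 1 else 0)"
    and A: "\<And>i j. i < s \<Longrightarrow> j < s \<Longrightarrow> G (A i) (A j) = (if i = j then 1 else 0)"
    and sp: "span (E ` {..<r}) = span (A ` {..<s})" and B: "bilinear B"
  shows "(\<Sum>i<r. B (E i) (E i)) = (\<Sum>j<s. B (A j) (A j))"
proof -
  have linG: "linear (\<lambda>x. G x z)" "linear (G z)" and linB: "linear (\<lambda>x. B x y)" "linear (B y)" for z y
    using G(1) B by (auto simp: bilinear_def)
  have "B (E i) (E i) = (\<Sum>j<s. \<Sum>k<s. (G (E i) (A j) * G (E i) (A k)) *\<^sub>R B (A j) (A k))" if "i < r" for i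
  proof -
    have e: "E i = (\<Sum>j<s. G (E i) (A j) *\<^sub>R A j)"
      by (rule orthonormal_family_expand[OF G(1) A]) (use that sp in \<open>auto intro: span_base\<close>)
    have "B (E i) (E i) = B (\<Sum>j<s. G (E i) (A j) *\<^sub>R A j) (\<Sum>k<s. G (E i) (A k) *\<^sub>R A k)"
      using e by metis
    then show ?thesis
      by (simp add: linear_sum[OF linB(1)] linear_sum[OF linB(2)] linear_scale[OF linB(1)] linear_scale[OF linB(2)]
          scaleR_sum_right, subst sum.swap, simp add: mult.commute)
  qed
  then have "(\<Sum>i<r. B (E i) (E i)) = (\<Sum>i<r. \<Sum>j<s. \<Sum>k<s. (G (E i) (A j) * G (E i) (A k)) *\<^sub>R B (A j) (A k))"
    by (intro sum.cong) auto
  also have "\<dots> = (\<Sum>j<s. \<Sum>k<s. (\<Sum>i<r. G (E i) (A j) * G (E i) (A k)) *\<^sub>R B (A j) (A k))"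
    unfolding scaleR_sum_left by (subst sum.swap) (intro sum.cong refl sum.swap)
  also have "\<dots> = (\<Sum>j<s. \<Sum>k<s. (if j = k then B (A j) (A k) else 0))"
  proof (intro sum.cong refl)
    fix j k assume jk: "j \<in> {..<s}" "k \<in> {..<s}"
    have a: "A j = (\<Sum>i<r. G (A j) (E i) *\<^sub>R E i)"
      by (rule orthonormal_family_expand[OF G(1) E]) (use jk sp in \<open>auto intro: span_base\<close>)
    have "G (A j) (A k) = G (\<Sum>i<r. G (A j) (E i) *\<^sub>R E i) (A k)" using a by metis
    also have "\<dots> = (\<Sum>i<r. G (E i) (A j) * G (E i) (A k))"
      by (simp add: linear_sum[OF linG(1)] linear_scale[OF linG(1)] G(2)[of "A j"])
    finally show "(\<Sum>i<r. G (E i) (A j) * G (E i) (A k)) *\<^sub>R B (A j) (A k) = (if j = k then B (A j) (A k) else 0)"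
      using A jk by auto
  qed
  also have "\<dots> = (\<Sum>j<s. B (A j) (A j))" by (intro sum.cong refl) simp
  finally show ?thesis .
qed

section \<open>Gram-Schmidt for vector fields\<close>

context riemannian_manifold
begin

lemma metric_linear:
  assumes "q \<in> points M"
  shows "linear (g q x)" "linear (\<lambda>x. g q x y)"
  using metric_bilinear[OF assms] by (auto simp: bilinear_def)

text \<open>Independence is assumed at \<open>p\<close> only. There each residual \<open>Y\<close>
  has positive squared length \<open>n\<close>, and the neighbourhood shrinks to the open set where
  \<open>n > 0\<close>. Keeping the spans of all initial segments allows frames adapted to a
  subbundle.\<close>

lemma gram_schmidt_fields:
  fixes X :: "nat \<Rightarrow> 'a \<Rightarrow> 'e"
  assumes "mopen M U" "p \<in> U" "\<And>i. i < r \<Longrightarrow> vector_field M U (X i)"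
    and "\<And>i. i < r \<Longrightarrow> X i p \<notin> span ((\<lambda>j. X j p) ` {..<i})"
  shows "\<exists>V E. mopen M V \<and> p \<in> V \<and> V \<subseteq> U \<and> (\<forall>i<r. vector_field M V (E i)) \<and>
    (\<forall>q\<in>V. (\<forall>i<r. \<forall>j<r. g q (E i q) (E j q) = (if i = j then 1 else 0)) \<and>
      (\<forall>s\<le>r. span ((\<lambda>i. E i q) ` {..<s}) = span ((\<lambda>i. X i q) ` {..<s})))"
  using assms
proof (induction r)
  case 0
  then show ?case by (intro exI[of _ U]) auto
next
  case (Suc r)
  have "\<exists>V E. mopen M V \<and> p \<in> V \<and> V \<subseteq> U \<and> (\<forall>i<r. vector_field M V (E i)) \<and>
    (\<forall>q\<in>V. (\<forall>i<r. \<forall>j<r. g q (E i q) (E j q) = (if i = j then 1 else 0)) \<and>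
      (\<forall>s\<le>r. span ((\<lambda>i. E i q) ` {..<s}) = span ((\<lambda>i. X i q) ` {..<s})))"
    by (rule Suc.IH) (use Suc.prems in auto)
  then obtain V E where V: "mopen M V" "p \<in> V" "V \<subseteq> U" and E': "\<forall>i<r. vector_field M V (E i)"
    and VE: "\<forall>q\<in>V. (\<forall>i<r. \<forall>j<r. g q (E i q) (E j q) = (if i = j then 1 else 0)) \<and>
      (\<forall>s\<le>r. span ((\<lambda>i. E i q) ` {..<s}) = span ((\<lambda>i. X i q) ` {..<s}))"
    by (elim exE conjE)
  have E: "vector_field M V (E i)" if "i < r" for i using E' that by simp
  have on: "g q (E i q) (E j q) = (if i = j then 1 else 0)" if "q \<in> V" "i < r" "j < r" for q i j
    using VE that by simp
  have sp: "span ((\<lambda>i. E i q) ` {..<s}) = span ((\<lambda>i. X i q) ` {..<s})" if "q \<in> V" "s \<le> r" for q s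
    using VE that by simp
  have Vp: "V \<subseteq> points M" using V(1) openin_subset by blast
  have Xr: "vector_field M V (X r)" using Suc.prems(3) vector_field_subset V(3) by blast
  define P where "P q = (\<Sum>i<r. g q (X r q) (E i q) *\<^sub>R E i q)" for q
  define Y where "Y q = X r q + (- 1) *\<^sub>R P q" for q
  define n where "n q = g q (Y q) (Y q)" for q
  have PV: "vector_field M V P" unfolding P_def
    by (intro vector_field_sum vector_field_scaleR metric_smooth V(1) E Xr) auto
  have YV: "vector_field M V Y" unfolding Y_def
    by (intro vector_field_add vector_field_scaleR smooth_fun_const V(1) Xr PV)
  have nV: "smooth_fun M V n" unfolding n_def by (intro metric_smooth V(1) YV)
  have P_span: "P q \<in> span ((\<lambda>i. X i q) ` {..<r})" if "q \<in> V" for q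
    unfolding P_def sp[OF that order.refl, symmetric] by (intro span_sum span_scale span_base) auto
  define V' where "V' = {q \<in> V. n q > 0}"
  have V': "mopen M V'" "V' \<subseteq> V" unfolding V'_def using open_superlevel[OF V(1) nV] by auto
  have "Y p \<noteq> 0"
  proof
    assume "Y p = 0"
    then have "X r p = P p" by (simp add: Y_def)
    then show False using P_span[OF V(2)] Suc.prems(4)[of r] by simp
  qed
  then have pV': "p \<in> V'" using V(2) Vp metric_pos by (auto simp: V'_def n_def)
  \<comment> \<open>Division by the length is the power -1/2 of the positive smooth function
    \<open>n\<close>, so the normalized field stays smooth.\<close>
  define E' where "E' = E(r := \<lambda>q. (n q powr (- 1 / 2)) *\<^sub>R Y q)"
  have E'_r: "E' r q = (n q powr (- 1 / 2)) *\<^sub>R Y q" and E'_i: "i < r \<Longrightarrow> E' i = E i" for q i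
    by (auto simp: E'_def)
  have fd: "fin_dim TYPE(real)" by (rule fin_dim_euclidean)
  have "smooth_fun M V' (\<lambda>q. n q powr (- 1 / 2))"
    by (rule smooth_fun_compose[OF fd V'(1) smooth_fun_subset[OF nV V'(2)] Ck_on_powr]) (auto simp: V'_def)
  then have "vector_field M V' (E' r)" unfolding E'_r[abs_def]
    by (intro vector_field_scaleR V'(1) vector_field_subset[OF YV V'(2)])
  then have vf: "vector_field M V' (E' i)" if "i < Suc r" for i
    using that E'_i vector_field_subset[OF E V'(2)] by (auto simp: less_Suc_eq)
  have YE: "g q (Y q) (E i q) = 0" if "q \<in> V" "i < r" for q i
  proof -
    have q: "q \<in> points M" using that Vp by blast
    have "g q (P q) (E i q) = (\<Sum>j<r. g q (X r q) (E j q) * (if j = i then 1 else 0))"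
      unfolding P_def using that
      by (simp add: linear_sum[OF metric_linear(2)[OF q]] linear_scale[OF metric_linear(2)[OF q]] on)
    also have "\<dots> = g q (X r q) (E i q)" using that by (simp add: if_distrib cong: if_cong)
    finally show ?thesis unfolding Y_def
      by (simp only: linear_add[OF metric_linear(2)[OF q]] linear_scale[OF metric_linear(2)[OF q]]) simp
  qed
  have on': "g q (E' i q) (E' j q) = (if i = j then 1 else 0)" if q: "q \<in> V'" and ij: "i < Suc r" "j < Suc r" for q i j
  proof -
    have qV: "q \<in> V" and qM: "q \<in> points M" and n: "n q > 0" using q Vp by (auto simp: V'_def)
    have "n q powr (- 1 / 2) * (n q powr (- 1 / 2) * n q) = 1"
      using n by (simp add: mult.assoc[symmetric] powr_add[symmetric] powr_minus_divide)
    then have "g q (E' r q) (E' r q) = 1"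
      by (simp add: E'_r linear_scale[OF metric_linear(1)[OF qM]] linear_scale[OF metric_linear(2)[OF qM]] n_def[symmetric])
    moreover have "g q (E' r q) (E' i q) = 0" if "i < r" for i
      using YE[OF qV that] that by (simp add: E'_r E'_i linear_scale[OF metric_linear(2)[OF qM]])
    moreover from this have "g q (E' i q) (E' r q) = 0" if "i < r" for i
      using metric_sym[OF qM] that by simp
    ultimately show ?thesis using ij on[OF qV] E'_i by (auto simp: less_Suc_eq)
  qed
  have im: "(\<lambda>i. E' i q) ` {..<s} = (\<lambda>i. E i q) ` {..<s}" if "s \<le> r" for s q
    using that E'_i by (intro image_cong) auto
  have sp': "span ((\<lambda>i. E' i q) ` {..<s}) = span ((\<lambda>i. X i q) ` {..<s})" if q: "q \<in> V'" and s: "s \<le> Suc r" for q s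
  proof (cases "s = Suc r")
    case False
    then show ?thesis using s im[of s q] sp[of q s] q V'(2) by auto
  next
    case True
    have qV: "q \<in> V" and n: "n q > 0" using q by (auto simp: V'_def)
    let ?S = "(\<lambda>i. X i q) ` {..<r}" and ?T = "(\<lambda>i. E i q) ` {..<r}"
    have ST: "span ?T = span ?S" using sp[OF qV] by simp
    have "span (insert (E' r q) ?T) = span (insert (X r q) ?S)"
    proof (rule span_eq[THEN iffD2], intro conjI)
      have "Y q \<in> span (insert (X r q) ?S)" unfolding Y_def
        by (intro span_add span_scale) (use P_span[OF qV] span_mono[of ?S "insert (X r q) ?S"] in \<open>auto intro: span_base\<close>)
      then have "E' r q \<in> span (insert (X r q) ?S)" by (simp add: E'_r span_scale)
      moreover have "?T \<subseteq> span (insert (X r q) ?S)"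
        using ST span_superset[of ?T] span_mono[of ?S "insert (X r q) ?S"] by blast
      ultimately show "insert (E' r q) ?T \<subseteq> span (insert (X r q) ?S)" by blast
      have "(1 / n q powr (- 1 / 2)) *\<^sub>R E' r q \<in> span (insert (E' r q) ?T)" by (intro span_scale span_base) simp
      then have "Y q \<in> span (insert (E' r q) ?T)" using n by (simp add: E'_r)
      moreover have "P q \<in> span (insert (E' r q) ?T)"
        using P_span[OF qV] ST span_mono[of ?T "insert (E' r q) ?T"] by blast
      ultimately have "Y q + P q \<in> span (insert (E' r q) ?T)" by (rule span_add)
      then have "X r q \<in> span (insert (E' r q) ?T)" by (simp add: Y_def)
      moreover have "?S \<subseteq> span (insert (E' r q) ?T)"
        using ST span_superset[of ?S] span_mono[of ?T "insert (E' r q) ?T"] by blast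
      ultimately show "insert (X r q) ?S \<subseteq> span (insert (E' r q) ?T)" by blast
    qed
    then show ?thesis using True im[of r q] by (simp add: lessThan_Suc)
  qed
  show ?case using V' V(3) pV' vf on' sp' by (intro exI[of _ V'] exI[of _ E']) auto
qed

end

locale euclidean_riemannian_manifold = riemannian_manifold M g
  for M :: "('a, 'e::euclidean_space) manifold" and g
begin

text \<open>Coordinate fields complete the given fields to a basis at \<open>p\<close>, and
  Gram-Schmidt does the rest. For \<open>n = 0\<close> this is the mere existence of frames.\<close>

lemma local_orthonormal_frame:
  assumes U: "mopen M U" "p \<in> U" and X: "\<And>i. i < n \<Longrightarrow> vector_field M U (X i)"
    and ind: "\<And>i. i < n \<Longrightarrow> X i p \<notin> span ((\<lambda>j. X j p) ` {..<i})"
  shows "\<exists>V E. p \<in> V \<and> V \<subseteq> U \<and> orthonormal_frame M g (\<lambda>q. UNIV) V DIM('e) E \<and>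
    (\<forall>q\<in>V. \<forall>s\<le>n. span ((\<lambda>i. E i q) ` {..<s}) = span ((\<lambda>i. X i q) ` {..<s}))"
proof -
  obtain W c where c: "chart_at M p = (W, c)" "(W, c) \<in> atlas M" "p \<in> W"
    using chart_at U openin_subset by blast
  have pM: "p \<in> points M" using U openin_subset by blast
  have n: "n \<le> DIM('e)" by (rule sequence_le_DIM[OF ind])
  obtain y where y: "\<And>i. i < n \<Longrightarrow> y i = X i p" "\<And>i. i < DIM('e) \<Longrightarrow> y i \<notin> span (y ` {..<i})"
    using extend_independent_sequence[of n "\<lambda>i. X i p", OF ind] by blast
  define X' where "X' i = (if i < n then X i else coord_field M W c (y i))" for i
  have UW: "mopen M (U \<inter> W)" "p \<in> U \<inter> W" using U chart_mopen[OF c(2)] c by auto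
  have X'p: "X' i p = y i" for i using y(1) coord_field_at[OF pM c(1)] by (simp add: X'_def)
  have X'vf: "vector_field M (U \<inter> W) (X' i)" for i
    using vector_field_subset[OF X[of i], of "U \<inter> W"] vector_field_subset[OF vector_field_coord_field[OF c(2)], of "U \<inter> W"]
    by (auto simp: X'_def)
  have X'ind: "X' i p \<notin> span ((\<lambda>j. X' j p) ` {..<i})" if "i < DIM('e)" for i
    using y(2)[OF that] by (simp add: X'p)
  have "\<exists>V E. mopen M V \<and> p \<in> V \<and> V \<subseteq> U \<inter> W \<and> (\<forall>i<DIM('e). vector_field M V (E i)) \<and>
    (\<forall>q\<in>V. (\<forall>i<DIM('e). \<forall>j<DIM('e). g q (E i q) (E j q) = (if i = j then 1 else 0)) \<and>
      (\<forall>s\<le>DIM('e). span ((\<lambda>i. E i q) ` {..<s}) = span ((\<lambda>i. X' i q) ` {..<s})))"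
    by (rule gram_schmidt_fields[OF UW]) (rule X'vf, rule X'ind, assumption)
  then obtain V E where V: "mopen M V" "p \<in> V" "V \<subseteq> U \<inter> W" "\<forall>i<DIM('e). vector_field M V (E i)"
    and VE: "\<forall>q\<in>V. (\<forall>i<DIM('e). \<forall>j<DIM('e). g q (E i q) (E j q) = (if i = j then 1 else 0)) \<and>
      (\<forall>s\<le>DIM('e). span ((\<lambda>i. E i q) ` {..<s}) = span ((\<lambda>i. X' i q) ` {..<s}))"
    by (elim exE conjE)
  have on: "g q (E i q) (E j q) = (if i = j then 1 else 0)" if "q \<in> V" "i < DIM('e)" "j < DIM('e)" for q i j
    using VE that by simp
  have sp: "span ((\<lambda>i. E i q) ` {..<s}) = span ((\<lambda>i. X' i q) ` {..<s})" if "q \<in> V" "s \<le> DIM('e)" for q s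
    using VE that by simp
  have "span ((\<lambda>i. E i q) ` {..<DIM('e)}) = UNIV" if "q \<in> V" for q
    using openin_subset[OF V(1)] that on[OF that]
    by (intro span_orthonormal_full[of "g q"] metric_bilinear) auto
  then have "orthonormal_frame M g (\<lambda>q. UNIV) V DIM('e) E"
    using V on by (auto simp: orthonormal_frame_def)
  moreover have "span ((\<lambda>i. E i q) ` {..<s}) = span ((\<lambda>i. X i q) ` {..<s})" if "q \<in> V" "s \<le> n" for q s
  proof -
    have "(\<lambda>i. X' i q) ` {..<s} = (\<lambda>i. X i q) ` {..<s}"
      using that by (intro image_cong) (auto simp: X'_def)
    then show ?thesis using sp[of q s] that n by simp
  qed
  ultimately show ?thesis using V(2,3) by (intro exI[of _ V] exI[of _ E]) simp
qed

section \<open>Cutting off vector fields\<close>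

text \<open>A set closed in the chart domain may fail to be closed in \<open>M\<close>. The ball is
  compact, and compact sets are closed because \<open>M\<close> is Hausdorff; this is what makes
  extension by zero smooth.\<close>

lemma chart_ball_closedin:
  assumes c: "(W, c) \<in> atlas M" and K: "cball x r \<subseteq> c ` W"
  shows "closedin (mtop M) {q \<in> W. c q \<in> cball x r}"
proof -
  let ?K = "{q \<in> W. c q \<in> cball x r}"
  have img: "c ` ?K = cball x r" using K by auto
  have "compactin (top_of_set (c ` W)) (c ` ?K)"
    unfolding img using K by (simp add: compactin_subtopology)
  then have "compactin (subtopology (mtop M) W) ?K"
    using homeomorphic_map_compactness[of "subtopology (mtop M) W" "top_of_set (c ` W)" c ?K] chart[OF c] chart_subset[OF c]
    by auto
  then have "compactin (mtop M) ?K" by (simp add: compactin_subtopology)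
  then show ?thesis using compactin_imp_closedin[OF Hausdorff] by blast
qed

text \<open>\<open>Y\<close> is multiplied by the bump function exp(-1/f) with f = r^2 - |c - c p|^2
  and extended by zero. As a pointwise multiple of \<open>Y\<close> the result stays in any
  subbundle containing \<open>Y\<close>; the positive factor at \<open>p\<close> is harmless for
  homogeneous conclusions.\<close>

lemma cutoff_vector_field:
  assumes U: "mopen M U" "p \<in> U" and Y: "vector_field M U Y"
  shows "\<exists>V. vector_field M (points M) V \<and> (\<exists>a>0. V p = a *\<^sub>R Y p) \<and>
    (\<forall>q\<in>points M. V q = 0 \<or> q \<in> U \<and> (\<exists>a. V q = a *\<^sub>R Y q))"
proof -
  obtain W c where c: "chart_at M p = (W, c)" "(W, c) \<in> atlas M" "p \<in> W"
    using chart_at U openin_subset by blast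
  have UW: "mopen M (U \<inter> W)" "p \<in> U \<inter> W" using U chart_mopen[OF c(2)] c by auto
  have "open (c ` (U \<inter> W))" "c p \<in> c ` (U \<inter> W)" using chart_image_open[OF c(2) U(1)] UW by auto
  then obtain r where r: "r > 0" "cball (c p) r \<subseteq> c ` (U \<inter> W)" using open_contains_cball by blast
  define K where "K = {q \<in> W. c q \<in> cball (c p) r}"
  have K: "closedin (mtop M) K" unfolding K_def using r(2) by (intro chart_ball_closedin[OF c(2)]) auto
  have KU: "K \<subseteq> U"
  proof
    fix q assume q: "q \<in> K"
    then have "c q \<in> c ` (U \<inter> W)" "q \<in> W" using r(2) by (auto simp: K_def)
    then show "q \<in> U" using inj_on_image_mem_iff[OF chart_inj[OF c(2)], of q "U \<inter> W"] by blast
  qed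
  \<comment> \<open>Written with sums and products of coordinates so that smoothness follows from
    closure rules; \<open>f_eq\<close> gives the geometric form.\<close>
  define f where "f q = r\<^sup>2 + (\<Sum>b\<in>Basis. (- ((c q - c p) \<bullet> b)) *\<^sub>R ((c q - c p) \<bullet> b))" for q
  have f_eq: "f q = r\<^sup>2 - (dist (c p) (c q))\<^sup>2" for q
  proof -
    have "(dist (c p) (c q))\<^sup>2 = (c q - c p) \<bullet> (c q - c p)"
      by (metis dist_commute dist_norm dot_square_norm)
    also have "\<dots> = (\<Sum>b\<in>Basis. ((c q - c p) \<bullet> b) * ((c q - c p) \<bullet> b))" by (rule euclidean_inner)
    finally show ?thesis by (simp add: f_def sum_negf)
  qed
  have cp: "smooth_fun M (U \<inter> W) (\<lambda>q. (c q - c p) \<bullet> b)" for b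
  proof -
    have "smooth_fun M (U \<inter> W) (\<lambda>q. c q \<bullet> b + (- (c p \<bullet> b)))"
      by (intro smooth_fun_add smooth_fun_const UW(1) smooth_fun_bounded_linear[OF _ bounded_linear_inner_left]
          smooth_fun_subset[OF smooth_fun_chart[OF c(2)]]) auto
    then show ?thesis by (simp add: inner_diff_left)
  qed
  have "smooth_fun M (U \<inter> W) f" unfolding f_def
    by (intro smooth_fun_add smooth_fun_const smooth_fun_sum smooth_fun_scaleR UW(1) cp
        smooth_fun_bounded_linear[OF UW(1) bounded_linear_minus[OF bounded_linear_ident] cp])
  moreover have fd: "fin_dim TYPE(real)" by (rule fin_dim_euclidean)
  ultimately have rho: "smooth_fun M (U \<inter> W) (\<lambda>q. flat 1 (f q))"
    by (intro smooth_fun_compose[OF fd UW(1) _ Ck_on_flat]) auto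
  define V where "V q = (if q \<in> U \<inter> W then flat 1 (f q) *\<^sub>R Y q else 0)" for q
  have V0: "V q = 0" if "q \<notin> K" for q
  proof (cases "q \<in> U \<inter> W")
    case True
    then have "dist (c p) (c q) > r" using that by (auto simp: K_def)
    then have "f q \<le> 0" using r(1) power_strict_mono[of r "dist (c p) (c q)" 2] by (simp add: f_eq)
    then show ?thesis by (simp add: V_def flat_def)
  next
    case False
    then show ?thesis unfolding V_def by (rule if_not_P)
  qed
  have in1: "vector_field M (U \<inter> W) V"
    by (rule vector_field_cong[OF UW(1) vector_field_scaleR[OF UW(1) rho vector_field_subset[OF Y]]]) (auto simp: V_def)
  have o2: "mopen M (points M - K)" using K by blast
  have in2: "vector_field M (points M - K) V"
    by (rule vector_field_cong[OF o2 vector_field_zero[OF o2]]) (use V0 in auto)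
  \<comment> \<open>\<open>U \<inter> W\<close> and the complement of the closed set
    \<open>K\<close> are open and cover \<open>M\<close>, and \<open>V\<close> is smooth on
    both.\<close>
  have "vector_field M (points M) V"
  proof (rule vector_field_local)
    fix q assume "q \<in> points M"
    then consider "q \<in> U \<inter> W" | "q \<in> points M - K" using KU by (auto simp: K_def)
    then show "\<exists>T. mopen M T \<and> q \<in> T \<and> vector_field M T V"
      using in1 in2 UW(1) o2 by cases blast+
  qed
  moreover have "\<exists>a>0. V p = a *\<^sub>R Y p"
    using UW(2) r(1) by (intro exI[of _ "flat 1 (f p)"]) (auto simp: V_def f_eq flat_def)
  ultimately show ?thesis by (intro exI[of _ V]) (auto simp: V_def)
qed

end

section \<open>Riemannian submersions\<close>

locale submersion = pullback_levi_civita M N F h DN DF + RM: euclidean_riemannian_manifold M g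
  for M :: "('a, 'e::euclidean_space) manifold" and N :: "('b, 'f::real_inner) manifold" and F h DN DF g +
  fixes D :: "'a \<Rightarrow> 'e \<Rightarrow> ('a \<Rightarrow> 'e) \<Rightarrow> 'e"
  assumes levi_civita_M: "levi_civita M g D"
    and submersion: "riemannian_submersion M g N h F"
begin

abbreviation dF where "dF \<equiv> differential M N F"
abbreviation vert where "vert \<equiv> vertical M N F"
abbreviation horiz where "horiz \<equiv> horizontal M g N F"
abbreviation sff where "sff \<equiv> second_fundamental_form M D N F DF"

lemma connection_M: "is_connection M (vector_field M) D"
  using levi_civita_M by (simp add: levi_civita_def)

lemma dF_surj: "p \<in> points M \<Longrightarrow> surj (dF p)"
  using submersion unfolding riemannian_submersion_def by simp

lemma dF_isometry: "p \<in> points M \<Longrightarrow> u \<in> horiz p \<Longrightarrow> h (F p) (dF p u) (dF p u) = g p u u"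
  using submersion unfolding riemannian_submersion_def by simp

lemma vert_iff: "v \<in> vert p \<longleftrightarrow> dF p v = 0"
  by (simp add: vertical_def)

lemma horizD: "u \<in> horiz p \<Longrightarrow> v \<in> vert p \<Longrightarrow> g p u v = 0"
  by (simp add: horizontal_def)

lemma subspace_vert: "p \<in> points M \<Longrightarrow> subspace (vert p)"
  unfolding vertical_def by (rule linear_subspace_kernel[OF differential_linear])

lemma subspace_horiz: "p \<in> points M \<Longrightarrow> subspace (horiz p)"
  unfolding subspace_def horizontal_def
  by (simp add: linear_0[OF RM.metric_linear(2)] linear_add[OF RM.metric_linear(2)] linear_scale[OF RM.metric_linear(2)])

lemma horiz_vert_trivial:
  assumes "p \<in> points M" "u \<in> horiz p" "u \<in> vert p"
  shows "u = 0"
  using horizD[OF assms(2,3)] RM.metric_pos[OF assms(1), of u] by (cases "u = 0") auto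

section \<open>Adapted frames and the orthogonal splitting\<close>

text \<open>The inequality of dimensions is included so that \<open>DIM('e) - dim UNIV\<close> is
  the true number of vertical vectors and not a truncated difference.\<close>

definition adapted_frame :: "'a set \<Rightarrow> (nat \<Rightarrow> 'a \<Rightarrow> 'e) \<Rightarrow> bool" where
  "adapted_frame U A \<longleftrightarrow> orthonormal_frame M g (\<lambda>q. UNIV) U DIM('e) A \<and> dim (UNIV :: 'f set) \<le> DIM('e) \<and>
    (\<forall>q\<in>U. (\<forall>i<dim (UNIV :: 'f set). A i q \<in> horiz q) \<and>
      (\<forall>i. dim (UNIV :: 'f set) \<le> i \<and> i < DIM('e) \<longrightarrow> A i q \<in> vert q))"

text \<open>The gradients of the components of \<open>F\<close> in a chart of \<open>N\<close> span the horizontal spaces, so that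
  orthonormalizing them together with complementary fields yields an adapted frame.\<close>

lemma ex_adapted_frame:
  assumes p: "p \<in> points M"
  shows "\<exists>U A. p \<in> U \<and> adapted_frame U A"
proof -
  let ?n = "dim (UNIV :: 'f set)"
  obtain V d where d: "(V, d) \<in> atlas N" "F p \<in> V" using N.chart_at[OF map_points[OF p]] by blast
  obtain B :: "'f set" where B: "finite B" "pairwise orthogonal B" "\<And>b. b \<in> B \<Longrightarrow> norm b = 1"
    "\<And>x. (\<Sum>b\<in>B. (x \<bullet> b) *\<^sub>R b) = x" "span B = UNIV"
    by (rule fin_dim_orthonormal_basis[OF N.fin_dim]) (rule that)
  have "0 \<notin> B" using B(3) by force
  then have "independent B" using pairwise_orthogonal_independent B(2) by blast
  then have "card B = ?n" using dim_eq_card[where B = B and V = UNIV] B(5) by simp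
  then obtain b where b: "bij_betw b {..<?n} B" using ex_bij_betw_nat_finite[OF B(1)] by (auto simp: atLeast0LessThan)
  have bb: "b i \<bullet> b j = (if i = j then 1 else 0)" if "i < ?n" "j < ?n" for i j
  proof -
    have "b i \<in> B" "b j \<in> B" using b that by (auto simp: bij_betw_def)
    moreover have "b i = b j \<longleftrightarrow> i = j" using b that by (auto simp: bij_betw_def dest: inj_onD)
    ultimately show ?thesis using B(2) B(3)[of "b i"] by (auto simp: pairwise_def orthogonal_def dot_square_norm)
  qed
  have zero_iff: "x = 0" if "\<And>i. i < ?n \<Longrightarrow> x \<bullet> b i = 0" for x :: 'f
  proof -
    have "x \<bullet> c = 0" if "c \<in> B" for c
      using b that \<open>\<And>i. i < ?n \<Longrightarrow> x \<bullet> b i = 0\<close> by (auto simp: bij_betw_def)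
    then have "(\<Sum>c\<in>B. (x \<bullet> c) *\<^sub>R c) = 0" by simp
    then show ?thesis by (simp only: B(4))
  qed
  \<comment> \<open>An auxiliary frame, obtained with no prescribed fields, in which the gradients
    are written down.\<close>
  obtain U0 E where U0: "p \<in> U0" and E: "orthonormal_frame M g (\<lambda>q. UNIV) U0 DIM('e) E"
    using RM.local_orthonormal_frame[of "points M" p 0 "\<lambda>_ _. 0"] p by auto
  have Eo: "mopen M U0" and Ev: "\<And>i. i < DIM('e) \<Longrightarrow> vector_field M U0 (E i)"
    using E by (auto simp: orthonormal_frame_def)
  let ?U = "U0 \<inter> F -` V"
  have U: "mopen M ?U" "p \<in> ?U" using preimage_open[OF Eo N.chart_mopen[OF d(1)]] U0 d by auto
  have UM: "q \<in> points M" if "q \<in> ?U" for q using that openin_subset[OF Eo] by blast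
  \<comment> \<open>\<open>H a\<close> is the gradient of the component
    \<open>(d \<circ> F) \<bullet> b a\<close>; its defining property is \<open>gH\<close>.\<close>
  define H where "H a q = (\<Sum>i<DIM('e). (dir_deriv M q (E i q) (d \<circ> F) \<bullet> b a) *\<^sub>R E i q)" for a q
  have Hv: "vector_field M ?U (H a)" for a
  proof -
    have Ev': "vector_field M ?U (E i)" if "i < DIM('e)" for i
      by (rule vector_field_subset[OF Ev[OF that]]) blast
    show ?thesis unfolding H_def
      by (intro M.vector_field_sum[OF U(1)] M.vector_field_scaleR[OF U(1)]
          M.smooth_fun_bounded_linear[OF U(1) bounded_linear_inner_left]
          M.dir_deriv_along_field_smooth[OF U(1) smooth_fun_chart_comp[OF d(1) Eo]] Ev') auto
  qed
  have gH: "g q (H a q) u = dir_deriv M q u (d \<circ> F) \<bullet> b a" if q: "q \<in> ?U" for a q u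
  proof -
    note lg = RM.metric_linear(2)[OF UM[OF q]]
    have lin: "linear (\<lambda>u. dir_deriv M q u (d \<circ> F))"
      by (rule M.dir_deriv_linear[OF smooth_fun_chart_comp[OF d(1) Eo] U(1) q])
    have on: "\<And>i j. i < DIM('e) \<Longrightarrow> j < DIM('e) \<Longrightarrow> g q (E i q) (E j q) = (if i = j then 1 else 0)"
      and sp: "span ((\<lambda>i. E i q) ` {..<DIM('e)}) = UNIV"
      using E q by (auto simp: orthonormal_frame_def)
    have u: "u = (\<Sum>i<DIM('e). g q u (E i q) *\<^sub>R E i q)"
      by (rule orthonormal_family_expand[where E = "\<lambda>i. E i q", OF RM.metric_bilinear[OF UM[OF q]] on]) (simp_all add: sp)
    have "g q (H a q) u = (\<Sum>i<DIM('e). g q u (E i q) * (dir_deriv M q (E i q) (d \<circ> F) \<bullet> b a))"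
      unfolding H_def by (simp add: linear_sum[OF lg] linear_scale[OF lg] RM.metric_sym[OF UM[OF q], of u] mult.commute)
    also have "\<dots> = dir_deriv M q (\<Sum>i<DIM('e). g q u (E i q) *\<^sub>R E i q) (d \<circ> F) \<bullet> b a"
      by (simp add: linear_sum[OF lin] linear_scale[OF lin] inner_sum_left)
    finally show ?thesis using u by simp
  qed
  have vert_eq: "u \<in> vert q \<longleftrightarrow> (\<forall>a<?n. g q (H a q) u = 0)" if q: "q \<in> ?U" for q u
  proof -
    have Fq: "F q \<in> V" using q by blast
    have "dF q u = 0 \<longleftrightarrow> dir_deriv N (F q) (dF q u) d = 0"
      using linear_0[OF N.dir_deriv_chart_linear[OF d(1) Fq]] linear_0[OF N.linear_coord_field[OF d(1) Fq]]
        N.coord_field_dir_deriv[OF d(1) Fq, of "dF q u"] by auto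
    also have "\<dots> \<longleftrightarrow> dir_deriv M q u (d \<circ> F) = 0" using dir_deriv_chart_comp[OF d(1) UM[OF q] Fq] by simp
    also have "\<dots> \<longleftrightarrow> (\<forall>a<?n. g q (H a q) u = 0)" unfolding gH[OF q] using zero_iff by auto
    finally show ?thesis by (simp add: vert_iff)
  qed
  have ind: "H a p \<notin> span ((\<lambda>j. H j p) ` {..<a})" if a: "a < ?n" for a
  proof
    assume Ha: "H a p \<in> span ((\<lambda>j. H j p) ` {..<a})"
    \<comment> \<open>By surjectivity some \<open>u\<close> maps to the vector with coordinates
      \<open>b a\<close>. It is orthogonal to the earlier gradients but not to
      \<open>H a p\<close>.\<close>
    obtain u where "dF p u = coord_field N V d (b a) (F p)" using surjD[OF dF_surj[OF p]] by metis
    then have "dir_deriv M p u (d \<circ> F) = b a"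
      using dir_deriv_chart_comp[OF d(1) p d(2)] N.dir_deriv_coord_field_self[OF d] by simp
    then have gu: "g p (H j p) u = b a \<bullet> b j" for j by (simp add: gH[OF U(2)])
    have "g p (H a p) u = 0"
      by (rule linear_eq_0_on_span[OF RM.metric_linear(2)[OF p] _ Ha]) (use gu bb a in auto)
    then show False using gu bb[OF a a] by simp
  qed
  have "\<exists>V E. p \<in> V \<and> V \<subseteq> ?U \<and> orthonormal_frame M g (\<lambda>q. UNIV) V DIM('e) E \<and>
    (\<forall>q\<in>V. \<forall>s\<le>?n. span ((\<lambda>i. E i q) ` {..<s}) = span ((\<lambda>i. H i q) ` {..<s}))"
    by (rule RM.local_orthonormal_frame[OF U Hv]) (rule ind)
  then obtain U1 A where U1: "p \<in> U1" "U1 \<subseteq> ?U" and A: "orthonormal_frame M g (\<lambda>q. UNIV) U1 DIM('e) A"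
    and sp: "\<forall>q\<in>U1. \<forall>s\<le>?n. span ((\<lambda>i. A i q) ` {..<s}) = span ((\<lambda>i. H i q) ` {..<s})"
    by (elim exE conjE)
  have n: "?n \<le> DIM('e)" by (rule sequence_le_DIM[OF ind])
  have "A i q \<in> horiz q" if q: "q \<in> U1" and i: "i < ?n" for i q
    unfolding horizontal_def
  proof (intro CollectI ballI)
    fix v assume v: "v \<in> vert q"
    have qU: "q \<in> ?U" using q U1(2) by blast
    have "A i q \<in> span ((\<lambda>i. A i q) ` {..<?n})" using i by (intro span_base) auto
    then have Ai: "A i q \<in> span ((\<lambda>i. H i q) ` {..<?n})" using sp q by simp
    show "g q (A i q) v = 0"
      by (rule linear_eq_0_on_span[OF RM.metric_linear(2)[OF UM[OF qU]] _ Ai])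
        (use v vert_eq[OF qU] in auto)
  qed
  \<comment> \<open>The later vectors of the frame are orthogonal to the first ones, hence to all
    gradients, and so they lie in the kernel of \<open>dF\<close>.\<close>
  moreover have "A i q \<in> vert q" if q: "q \<in> U1" and i: "?n \<le> i" "i < DIM('e)" for i q
  proof -
    have qU: "q \<in> ?U" using q U1(2) by blast
    have "g q (H a q) (A i q) = 0" if a: "a < ?n" for a
    proof -
      have "H a q \<in> span ((\<lambda>i. H i q) ` {..<?n})" using a by (intro span_base) auto
      then have Ha: "H a q \<in> span ((\<lambda>i. A i q) ` {..<?n})" using sp q by simp
      show ?thesis
        by (rule linear_eq_0_on_span[OF RM.metric_linear(2)[OF UM[OF qU]] _ Ha])
          (use A q i in \<open>auto simp: orthonormal_frame_def\<close>)
    qed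
    then show ?thesis using vert_eq[OF qU] by blast
  qed
  ultimately have "adapted_frame U1 A" using A n by (simp add: adapted_frame_def)
  then show ?thesis using U1(1) by blast
qed

lemma adapted_frame_props:
  assumes "adapted_frame U A" "q \<in> U"
  shows "mopen M U" "q \<in> points M" "\<And>i. i < DIM('e) \<Longrightarrow> vector_field M U (A i)"
    "\<And>i j. i < DIM('e) \<Longrightarrow> j < DIM('e) \<Longrightarrow> g q (A i q) (A j q) = (if i = j then 1 else 0)"
    "span ((\<lambda>i. A i q) ` {..<DIM('e)}) = UNIV" "dim (UNIV :: 'f set) \<le> DIM('e)"
    "\<And>i. i < dim (UNIV :: 'f set) \<Longrightarrow> A i q \<in> horiz q"
    "\<And>i. dim (UNIV :: 'f set) \<le> i \<Longrightarrow> i < DIM('e) \<Longrightarrow> A i q \<in> vert q"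
    "\<And>u. u = (\<Sum>i<DIM('e). g q u (A i q) *\<^sub>R A i q)"
proof -
  have o: "orthonormal_frame M g (\<lambda>q. UNIV) U DIM('e) A" using assms(1) by (simp add: adapted_frame_def)
  then show U: "mopen M U" and "\<And>i. i < DIM('e) \<Longrightarrow> vector_field M U (A i)"
    by (simp_all add: orthonormal_frame_def)
  show q: "q \<in> points M" using openin_subset[OF U] assms(2) by blast
  show on: "\<And>i j. i < DIM('e) \<Longrightarrow> j < DIM('e) \<Longrightarrow> g q (A i q) (A j q) = (if i = j then 1 else 0)"
    and sp: "span ((\<lambda>i. A i q) ` {..<DIM('e)}) = UNIV"
    using o assms(2) by (simp_all add: orthonormal_frame_def)
  show "\<And>i. i < dim (UNIV :: 'f set) \<Longrightarrow> A i q \<in> horiz q" "dim (UNIV :: 'f set) \<le> DIM('e)"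
    "\<And>i. dim (UNIV :: 'f set) \<le> i \<Longrightarrow> i < DIM('e) \<Longrightarrow> A i q \<in> vert q"
    using assms by (simp_all add: adapted_frame_def)
  show "u = (\<Sum>i<DIM('e). g q u (A i q) *\<^sub>R A i q)" for u
    by (rule orthonormal_family_expand[where E = "\<lambda>i. A i q", OF RM.metric_bilinear[OF q] on]) (simp_all add: sp)
qed

lemma split_sum_DIM:
  fixes f :: "nat \<Rightarrow> 'c::comm_monoid_add"
  assumes "n \<le> DIM('e)"
  shows "(\<Sum>i<DIM('e). f i) = (\<Sum>i<n. f i) + (\<Sum>i<DIM('e) - n. f (n + i))"
proof -
  have "{..<DIM('e)} = {..<n} \<union> {n..<DIM('e)}" using assms by auto
  then have "(\<Sum>i<DIM('e). f i) = (\<Sum>i<n. f i) + (\<Sum>i\<in>{n..<DIM('e)}. f i)"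
    by (simp add: sum.union_disjoint ivl_disj_int)
  also have "(\<Sum>i\<in>{n..<DIM('e)}. f i) = (\<Sum>i<DIM('e) - n. f (n + i))"
    using sum.shift_bounds_nat_ivl[of f 0 n "DIM('e) - n"] assms by (simp add: atLeast0LessThan add.commute)
  finally show ?thesis .
qed

lemma adapted_frame_vertical_span:
  assumes A: "adapted_frame U A" and q: "q \<in> U"
  defines "n \<equiv> dim (UNIV :: 'f set)"
  shows "span ((\<lambda>i. A (n + i) q) ` {..<DIM('e) - n}) = vert q"
proof
  note a = adapted_frame_props[OF A q, folded n_def]
  show "span ((\<lambda>i. A (n + i) q) ` {..<DIM('e) - n}) \<subseteq> vert q"
    by (rule span_minimal[OF _ subspace_vert[OF a(2)]]) (use a(8) in auto)
  show "vert q \<subseteq> span ((\<lambda>i. A (n + i) q) ` {..<DIM('e) - n})"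
  proof
    fix v assume v: "v \<in> vert q"
    have "g q v (A i q) = 0" if "i < n" for i
      using horizD[OF a(7)[OF that] v] RM.metric_sym[OF a(2)] by simp
    then have "v = (\<Sum>i<DIM('e) - n. g q v (A (n + i) q) *\<^sub>R A (n + i) q)"
      using a(9)[of v] split_sum_DIM[OF a(6), of "\<lambda>i. g q v (A i q) *\<^sub>R A i q"] by simp
    also have "\<dots> \<in> span ((\<lambda>i. A (n + i) q) ` {..<DIM('e) - n})"
      by (intro span_sum span_scale span_base) auto
    finally show "v \<in> span ((\<lambda>i. A (n + i) q) ` {..<DIM('e) - n})" .
  qed
qed

lemma horiz_vert_decomposition:
  assumes p: "p \<in> points M"
  obtains x y where "x \<in> horiz p" "y \<in> vert p" "u = x + y"
proof -
  let ?n = "dim (UNIV :: 'f set)"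
  obtain U A where A: "p \<in> U" "adapted_frame U A" using ex_adapted_frame[OF p] by blast
  note a = adapted_frame_props[OF A(2,1)]
  have "u = (\<Sum>i<?n. g p u (A i p) *\<^sub>R A i p) + (\<Sum>i<DIM('e) - ?n. g p u (A (?n + i) p) *\<^sub>R A (?n + i) p)"
    using a(9)[of u] split_sum_DIM[OF a(6), of "\<lambda>i. g p u (A i p) *\<^sub>R A i p"] by simp
  moreover have "(\<Sum>i<?n. g p u (A i p) *\<^sub>R A i p) \<in> horiz p"
    by (intro subspace_sum subspace_horiz p subspace_scale a(7)) auto
  moreover have "(\<Sum>i<DIM('e) - ?n. g p u (A (?n + i) p) *\<^sub>R A (?n + i) p) \<in> vert p"
    by (intro subspace_sum subspace_vert p subspace_scale a(8)) auto
  ultimately show ?thesis using that by blast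
qed

lemma decomposition_unique:
  assumes p: "p \<in> points M" and "x \<in> horiz p" "y \<in> vert p" "x' \<in> horiz p" "y' \<in> vert p" "x + y = x' + y'"
  shows "x = x'" "y = y'"
proof -
  have "x - x' \<in> horiz p" using subspace_diff[OF subspace_horiz[OF p]] assms by blast
  moreover have "x - x' = y' - y" using assms(6) by (simp add: algebra_simps)
  moreover have "y' - y \<in> vert p" using subspace_diff[OF subspace_vert[OF p]] assms by blast
  ultimately have "x - x' = 0" by (intro horiz_vert_trivial[OF p]) simp_all
  then show "x = x'" "y = y'" using assms(6) by auto
qed

text \<open>Uniqueness of the splitting gives the definite descriptions in \<open>ver\<close> and
  \<open>hor\<close> their value.\<close>

lemma ver_hor:
  assumes p: "p \<in> points M" and x: "x \<in> horiz p" and y: "y \<in> vert p"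
  shows "ver M g N F p (x + y) = y" "hor M g N F p (x + y) = x"
proof -
  show "ver M g N F p (x + y) = y" unfolding ver_def
  proof (rule the_equality)
    fix v assume v: "v \<in> vert p \<and> x + y - v \<in> horiz p"
    have "x + y = (x + y - v) + v" by simp
    from decomposition_unique(2)[OF p x y _ _ this] v show "v = y" by simp
  qed (use x y in simp)
  show "hor M g N F p (x + y) = x" unfolding hor_def
  proof (rule the_equality)
    fix v assume v: "v \<in> horiz p \<and> x + y - v \<in> vert p"
    have "x + y = v + (x + y - v)" by simp
    from decomposition_unique(1)[OF p x y _ _ this] v show "v = x" by simp
  qed (use x y in simp)
qed

text \<open>If \<open>v\<close> is orthogonal to all horizontal vectors, its horizontal part
  \<open>x\<close> satisfies \<open>g p x x = 0\<close>.\<close>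

lemma vert_iff_orthogonal:
  assumes p: "p \<in> points M"
  shows "v \<in> vert p \<longleftrightarrow> (\<forall>u\<in>horiz p. g p u v = 0)"
proof
  assume v: "\<forall>u\<in>horiz p. g p u v = 0"
  obtain x y where xy: "x \<in> horiz p" "y \<in> vert p" "v = x + y" using horiz_vert_decomposition[OF p] by blast
  have "g p x v = 0" using v xy(1) by blast
  then have "g p x x = 0" using xy(3) horizD[OF xy(1,2)] by (simp add: linear_add[OF RM.metric_linear(1)[OF p]])
  then have "x = 0" using RM.metric_pos[OF p, of x] by (cases "x = 0") auto
  then show "v \<in> vert p" using xy by simp
qed (use horizD in blast)

text \<open>Preservation of lengths is polarized on horizontal vectors; the vertical part of
  \<open>u\<close> contributes zero on both sides.\<close>

lemma dF_inner:
  assumes p: "p \<in> points M" and v: "v \<in> horiz p"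
  shows "h (F p) (dF p u) (dF p v) = g p u v"
proof -
  note lh = h_linear[OF map_points[OF p]] and lg = RM.metric_linear[OF p] and ld = differential_linear[OF p]
  have hor: "h (F p) (dF p x) (dF p v) = g p x v" if x: "x \<in> horiz p" for x
  proof -
    have "x + v \<in> horiz p" using subspace_add[OF subspace_horiz[OF p] x v] .
    from dF_isometry[OF p this] dF_isometry[OF p x] dF_isometry[OF p v]
    have "h (F p) (dF p x) (dF p v) + h (F p) (dF p v) (dF p x) = g p x v + g p v x"
      by (simp add: linear_add[OF ld] linear_add[OF lh(1)] linear_add[OF lh(2)] linear_add[OF lg(1)] linear_add[OF lg(2)])
    then show ?thesis
      using riemannian_manifold.metric_sym[OF riemannian_N map_points[OF p], of "dF p v" "dF p x"] RM.metric_sym[OF p, of v x]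
      by simp
  qed
  obtain x y where xy: "x \<in> horiz p" "y \<in> vert p" "u = x + y" using horiz_vert_decomposition[OF p] by blast
  have "g p y v = 0" using horizD[OF v xy(2)] RM.metric_sym[OF p] by simp
  then show ?thesis
    using hor[OF xy(1)] xy by (simp add: linear_add[OF ld] vert_iff linear_add[OF lg(2)])
qed

section \<open>The second fundamental form of the submersion\<close>

lemma sff_linear:
  assumes U: "mopen M U" and Y: "vector_field M U Y" and p: "p \<in> U"
  shows "linear (\<lambda>u. DF p u (\<lambda>q. dF q (Y q)) - dF p (D p u Y))"
proof -
  have "p \<in> points M" using openin_subset[OF U] p by blast
  then show ?thesis
    by (intro linear_compose_sub connection_linear[OF connection_F U section_along_differential[OF U Y] p]
        linear_compose[OF connection_linear[OF connection_M U Y p] differential_linear, unfolded comp_def])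
qed

lemma sff_symmetric:
  assumes U: "mopen M U" and X: "vector_field M U X" and Y: "vector_field M U Y" and p: "p \<in> U"
  shows "sff X Y p = sff Y X p"
proof -
  have "p \<in> points M" using openin_subset[OF U] p by blast
  then have "dF p (D p (X p) Y) - dF p (D p (Y p) X) = dF p (lie_bracket M X Y p)"
    using levi_civita_torsion_free[OF levi_civita_M U X Y p] linear_diff[OF differential_linear, of p] by metis
  then show ?thesis using pullback_torsion_free[OF U X Y p]
    unfolding second_fundamental_form_def by (simp add: algebra_simps)
qed

text \<open>The first field enters linearly and only through its value at \<open>p\<close>. Symmetry
  passes this on to the second field, so no coefficient functions have to be differentiated.\<close>

lemma sff_expand:
  fixes A :: "nat \<Rightarrow> 'a \<Rightarrow> 'e"
  assumes U: "mopen M U" and X: "vector_field M U X" and p: "p \<in> U"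
    and A: "\<And>i. i < r \<Longrightarrow> vector_field M U (A i)" and x: "X p = (\<Sum>i<r. c i *\<^sub>R A i p)"
  shows "sff X X p = (\<Sum>j<r. \<Sum>k<r. (c j * c k) *\<^sub>R sff (A k) (A j) p)"
proof -
  have step: "sff X Y p = (\<Sum>i<r. c i *\<^sub>R sff (A i) Y p)" if Y: "vector_field M U Y" for Y
    using linear_sum[OF sff_linear[OF U Y p], of "\<lambda>i. c i *\<^sub>R A i p" "{..<r}"] linear_scale[OF sff_linear[OF U Y p]]
    unfolding second_fundamental_form_def x by simp
  have "sff X X p = (\<Sum>j<r. c j *\<^sub>R sff (A j) X p)" by (rule step[OF X])
  also have "\<dots> = (\<Sum>j<r. c j *\<^sub>R sff X (A j) p)"
    using sff_symmetric[OF U X A p] by (intro sum.cong) auto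
  also have "\<dots> = (\<Sum>j<r. c j *\<^sub>R (\<Sum>k<r. c k *\<^sub>R sff (A k) (A j) p))"
    using step A by (intro sum.cong) auto
  finally show ?thesis by (simp add: scaleR_sum_right)
qed

text \<open>The values on the \<open>A i\<close> define a bilinear map on vectors that reproduces
  \<open>sff X X p\<close> whenever \<open>X p\<close> lies in the common span, which leaves a
  question of linear algebra. The span may be a proper subspace, so vertical frames can be compared
  too.\<close>

lemma trace_sff_independent:
  fixes E A :: "nat \<Rightarrow> 'a \<Rightarrow> 'e"
  assumes U: "mopen M U" and p: "p \<in> U"
    and E: "\<And>i. i < r \<Longrightarrow> vector_field M U (E i)"
    and onE: "\<And>i j. i < r \<Longrightarrow> j < r \<Longrightarrow> g p (E i p) (E j p) = (if i = j then 1 else 0)"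
    and A: "\<And>i. i < s \<Longrightarrow> vector_field M U (A i)"
    and onA: "\<And>i j. i < s \<Longrightarrow> j < s \<Longrightarrow> g p (A i p) (A j p) = (if i = j then 1 else 0)"
    and sp: "span ((\<lambda>i. E i p) ` {..<r}) = span ((\<lambda>i. A i p) ` {..<s})"
  shows "(\<Sum>i<r. sff (E i) (E i) p) = (\<Sum>i<s. sff (A i) (A i) p)"
proof -
  have pM: "p \<in> points M" using openin_subset[OF U] p by blast
  note G = RM.metric_bilinear[OF pM]
  define B where "B u v = (\<Sum>j<s. \<Sum>k<s. (g p u (A j p) * g p v (A k p)) *\<^sub>R sff (A k) (A j) p)" for u v
  have lin: "linear (\<lambda>u. g p u z)" for z using RM.metric_linear(2)[OF pM] .
  have "bilinear B" unfolding bilinear_def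
    by (auto intro!: linearI simp: B_def linear_add[OF lin] linear_scale[OF lin] algebra_simps sum.distrib scaleR_sum_right)
  moreover have "sff X X p = B (X p) (X p)"
    if X: "vector_field M U X" and sX: "X p \<in> span ((\<lambda>i. A i p) ` {..<s})" for X
    unfolding B_def by (rule sff_expand[OF U X p A orthonormal_family_expand[where E = "\<lambda>i. A i p", OF G onA sX]])
  moreover have "E i p \<in> span ((\<lambda>i. A i p) ` {..<s})" if "i < r" for i
    unfolding sp[symmetric] using that by (intro span_base) auto
  moreover have "A i p \<in> span ((\<lambda>i. A i p) ` {..<s})" if "i < s" for i
    using that by (intro span_base) auto
  ultimately show ?thesis
    using trace_orthonormal_independent[of "g p" r "\<lambda>i. E i p" s "\<lambda>i. A i p" B, OF G RM.metric_sym[OF pM] onE onA sp] E A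
    by simp
qed

text \<open>The cubic form \<open>h (sff (A i) (A j)) (F\<^sub>* (A k))\<close> on horizontal fields is symmetric in \<open>i, j\<close> and
  skew in \<open>j, k\<close>, hence vanishes.\<close>

lemma sff_horizontal:
  assumes A: "adapted_frame U A" and p: "p \<in> U" and ij: "i < dim (UNIV :: 'f set)" "j < dim (UNIV :: 'f set)"
  shows "sff (A i) (A j) p = 0"
proof -
  let ?n = "dim (UNIV :: 'f set)"
  note a = adapted_frame_props[OF A p]
  have a4: "g q (A i q) (A j q) = (if i = j then 1 else 0)" if "q \<in> U" "i < ?n" "j < ?n" for q i j
    using adapted_frame_props(4)[OF A that(1), of i j] a(6) that by simp
  have Av: "vector_field M U (A i)" if "i < ?n" for i using a(3,6) that by simp
  have sec: "section_along M N F U (\<lambda>q. dF q (A i q))" if "i < ?n" for i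
    by (rule section_along_differential[OF a(1) Av[OF that]])
  note hN = h_linear[OF map_points[OF a(2)]]
  define T where "T i j k = h (F p) (sff (A i) (A j) p) (dF p (A k p))" for i j k
  have sym: "T i j k = T j i k" if "i < ?n" "j < ?n" for i j k
    using sff_symmetric[OF a(1) Av Av p] that by (simp add: T_def)
  have skew: "T i j k = - T i k j" if ijk: "i < ?n" "j < ?n" "k < ?n" for i j k
  proof -
    let ?u = "A i p"
    \<comment> \<open>The isometry makes the inner products of the frame vectors in \<open>M\<close>
      and of their images in \<open>N\<close> the same constants. Skewness results from
      differentiating both and subtracting.\<close>
    have "dir_deriv M p ?u (\<lambda>q. h (F q) (dF q (A j q)) (dF q (A k q))) = dir_deriv M p ?u (\<lambda>q. if j = k then 1 else 0)"
    proof (rule M.dir_deriv_cong[OF a(1) p])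
      fix q assume q: "q \<in> U"
      show "h (F q) (dF q (A j q)) (dF q (A k q)) = (if j = k then 1 else 0)"
        using dF_inner[OF adapted_frame_props(2)[OF A q] adapted_frame_props(7)[OF A q ijk(3)]] a4[OF q ijk(2,3)] by simp
    qed
    then have N0: "h (F p) (DF p ?u (\<lambda>q. dF q (A j q))) (dF p (A k p))
        + h (F p) (dF p (A j p)) (DF p ?u (\<lambda>q. dF q (A k q))) = 0"
      using pullback_metric[OF a(1) sec[OF ijk(2)] sec[OF ijk(3)] p, of ?u] M.dir_deriv_const by simp
    have "dir_deriv M p ?u (\<lambda>q. g q (A j q) (A k q)) = dir_deriv M p ?u (\<lambda>q. if j = k then 1 else 0)"
      using a4 ijk by (intro M.dir_deriv_cong[OF a(1) p]) auto
    then have M0: "g p (D p ?u (A j)) (A k p) + g p (A j p) (D p ?u (A k)) = 0"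
      using levi_civita_metric[OF levi_civita_M a(1) Av[OF ijk(2)] Av[OF ijk(3)] p, of ?u] M.dir_deriv_const by simp
    have "T i j k + T i k j = h (F p) (DF p ?u (\<lambda>q. dF q (A j q))) (dF p (A k p)) - g p (D p ?u (A j)) (A k p)
      + (h (F p) (DF p ?u (\<lambda>q. dF q (A k q))) (dF p (A j p)) - g p (D p ?u (A k)) (A j p))"
      unfolding T_def second_fundamental_form_def
      by (simp add: linear_diff[OF hN(2)] dF_inner[OF a(2) a(7)] ijk)
    then show ?thesis
      using N0 M0 riemannian_manifold.metric_sym[OF riemannian_N map_points[OF a(2)], of "dF p (A j p)"]
        RM.metric_sym[OF a(2), of "A j p"] by simp
  qed
  \<comment> \<open>Six alternating applications return to the same indices with three sign changes,
    so \<open>T i j k = - T i j k\<close>.\<close>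
  have T0: "T i j k = 0" if "i < ?n" "j < ?n" "k < ?n" for i j k
    using sym[of i j k] skew[of j i k] sym[of j k i] skew[of k j i] sym[of k i j] skew[of i k j] that by simp
  \<comment> \<open>By surjectivity the value of \<open>sff\<close> is some \<open>dF p u\<close>;
    expanding \<open>u\<close> in the adapted frame shows that it is orthogonal to itself.\<close>
  obtain u where u: "sff (A i) (A j) p = dF p u" using surjD[OF dF_surj[OF a(2)]] by metis
  have "h (F p) (dF p u) (dF p u) = h (F p) (dF p u) (dF p (\<Sum>k<DIM('e). g p u (A k p) *\<^sub>R A k p))"
    using a(9)[of u] by simp
  also have "\<dots> = (\<Sum>k<DIM('e). g p u (A k p) *\<^sub>R h (F p) (dF p u) (dF p (A k p)))"
    by (simp add: linear_sum[OF hN(1)] linear_scale[OF hN(1)] linear_sum[OF differential_linear[OF a(2)]]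
        linear_scale[OF differential_linear[OF a(2)]])
  also have "\<dots> = 0"
  proof (intro sum.neutral ballI)
    fix k assume k: "k \<in> {..<DIM('e)}"
    show "g p u (A k p) *\<^sub>R h (F p) (dF p u) (dF p (A k p)) = 0"
    proof (cases "k < ?n")
      case True
      then show ?thesis using T0[OF ij True] by (simp add: T_def u)
    next
      case False
      then have "dF p (A k p) = 0" using a(8)[of k] k by (simp add: vert_iff)
      then show ?thesis using linear_0[OF hN(1)] by simp
    qed
  qed
  finally have "dF p u = 0"
    using riemannian_manifold.metric_pos[OF riemannian_N map_points[OF a(2)], of "dF p u"] by (cases "dF p u = 0") auto
  then show ?thesis by (simp add: u)
qed

text \<open>\<open>F\<^sub>* Y\<close> vanishes identically on \<open>U\<close>, so the term with
  the pullback connection is zero.\<close>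

lemma sff_vertical:
  assumes U: "mopen M U" and Y: "vector_field M U Y" and v: "\<And>q. q \<in> U \<Longrightarrow> Y q \<in> vert q" and p: "p \<in> U"
  shows "sff X Y p = - dF p (D p (X p) Y)"
proof -
  have "DF p (X p) (\<lambda>q. dF q (Y q)) = DF p (X p) (\<lambda>q. 0)"
    by (rule connection_cong[OF connection_F U section_along_differential[OF U Y] section_along_zero[OF U] _ p])
      (use v in \<open>simp add: vert_iff\<close>)
  then show ?thesis
    using connection_zero[OF connection_F U section_along_zero[OF U] p]
    by (simp add: second_fundamental_form_def)
qed

section \<open>Traces over vertical frames and harmonicity\<close>

text \<open>For a vertical orthonormal frame the horizontal part does not depend on the frame: it is
  \<open>k\<close> times the mean curvature vector of the fibre.\<close>

definition trace_nabla :: "nat \<Rightarrow> (nat \<Rightarrow> 'a \<Rightarrow> 'e) \<Rightarrow> 'a \<Rightarrow> 'e" where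
  "trace_nabla k e p = (\<Sum>i<k. D p (e i p) (e i))"

text \<open>\<open>E\<close> and \<open>e\<close> are unrelated, so an adapted frame mediates: it
  has the same full trace as \<open>E\<close>, and its vertical vectors have the same trace as
  \<open>e\<close>.\<close>

lemma trace_sff_vertical_frame:
  assumes E: "orthonormal_frame M g (\<lambda>q. UNIV) U DIM('e) E" and p: "p \<in> U"
    and e: "orthonormal_frame M g vert U' k e" and p': "p \<in> U'"
  shows "(\<Sum>i<DIM('e). sff (E i) (E i) p) = - dF p (trace_nabla k e p)"
proof -
  let ?n = "dim (UNIV :: 'f set)"
  have o: "mopen M U" "mopen M U'" using E e by (auto simp: orthonormal_frame_def)
  have pM: "p \<in> points M" using openin_subset[OF o(1)] p by blast
  obtain U2 A where A: "p \<in> U2" "adapted_frame U2 A" using ex_adapted_frame[OF pM] by blast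
  note a = adapted_frame_props[OF A(2,1)]
  let ?V = "U \<inter> U' \<inter> U2"
  have V: "mopen M ?V" "p \<in> ?V" using o a(1) p p' A(1) by auto
  have E': "vector_field M ?V (E i)" "g p (E i p) (E j p) = (if i = j then 1 else 0)" if "i < DIM('e)" "j < DIM('e)" for i j
    using E p that vector_field_subset[of M U "E i" ?V] by (auto simp: orthonormal_frame_def)
  have spE: "span ((\<lambda>i. E i p) ` {..<DIM('e)}) = UNIV" using E p by (auto simp: orthonormal_frame_def)
  have e': "vector_field M ?V (e i)" "g p (e i p) (e j p) = (if i = j then 1 else 0)" if "i < k" "j < k" for i j
    using e p' that vector_field_subset[of M U' "e i" ?V] by (auto simp: orthonormal_frame_def)
  have spe: "span ((\<lambda>i. e i q) ` {..<k}) = vert q" if "q \<in> U'" for q using e that by (auto simp: orthonormal_frame_def)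
  have A': "vector_field M ?V (A i)" if "i < DIM('e)" for i
    by (rule vector_field_subset[OF a(3)[OF that]]) blast
  let ?A = "\<lambda>i. A (?n + i)" and ?k = "DIM('e) - ?n"
  note spA = adapted_frame_vertical_span[OF A(2,1)]
  have "(\<Sum>i<DIM('e). sff (E i) (E i) p) = (\<Sum>i<DIM('e). sff (A i) (A i) p)"
    by (rule trace_sff_independent[OF V E'(1) E'(2) A' a(4)]) (simp_all add: spE a(5))
  also have "\<dots> = (\<Sum>i<?n. sff (A i) (A i) p) + (\<Sum>i<?k. sff (?A i) (?A i) p)"
    by (rule split_sum_DIM[OF a(6)])
  also have "(\<Sum>i<?n. sff (A i) (A i) p) = 0"
    using sff_horizontal[OF A(2,1)] by simp
  also have "(\<Sum>i<?k. sff (?A i) (?A i) p) = (\<Sum>i<k. sff (e i) (e i) p)"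
    by (rule trace_sff_independent[OF V]) (use A' a(4) e' in \<open>auto simp: spA spe[OF p']\<close>)
  also have "\<dots> = (\<Sum>i<k. - dF p (D p (e i p) (e i)))"
  proof (intro sum.cong refl)
    fix i assume i: "i \<in> {..<k}"
    have "e i q \<in> vert q" if "q \<in> ?V" for q
      using spe[of q] that i by (metis IntD1 IntD2 image_eqI span_base)
    then show "sff (e i) (e i) p = - dF p (D p (e i p) (e i))"
      using i by (intro sff_vertical[OF V(1) e'(1) _ V(2)]) auto
  qed
  also have "\<dots> = - dF p (trace_nabla k e p)"
    by (simp add: trace_nabla_def linear_sum[OF differential_linear[OF pM]] sum_negf)
  finally show ?thesis by simp
qed

lemma ex_vertical_frame:
  assumes "p \<in> points M"
  shows "\<exists>U e. p \<in> U \<and> orthonormal_frame M g vert U (DIM('e) - dim (UNIV :: 'f set)) e"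
proof -
  let ?n = "dim (UNIV :: 'f set)"
  obtain U A where A: "p \<in> U" "adapted_frame U A" using ex_adapted_frame[OF assms] by blast
  let ?A = "\<lambda>i. A (?n + i)" and ?k = "DIM('e) - ?n"
  have "orthonormal_frame M g vert U ?k ?A"
    using adapted_frame_props[OF A(2)] adapted_frame_vertical_span[OF A(2)] A(1)
    by (auto simp: orthonormal_frame_def)
  then show ?thesis using A(1) by blast
qed

text \<open>A vertical frame extends \<open>v\<close> with constant coefficients near
  \<open>p\<close>, and the cutoff makes the extension global. Pointwise multiples of vertical
  vectors stay vertical.\<close>

lemma ex_vertical_field:
  assumes p: "p \<in> points M" and v: "v \<in> vert p"
  shows "\<exists>V a. vector_field M (points M) V \<and> (\<forall>q\<in>points M. V q \<in> vert q) \<and> a > 0 \<and> V p = a *\<^sub>R v"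
proof -
  let ?k = "DIM('e) - dim (UNIV :: 'f set)"
  obtain U e where e: "p \<in> U" "orthonormal_frame M g vert U ?k e" using ex_vertical_frame[OF p] by blast
  have ev: "vector_field M U (e i)" if "i < ?k" for i
    using e(2) that by (auto simp: orthonormal_frame_def)
  have U: "mopen M U" using e(2) by (auto simp: orthonormal_frame_def)
  have on: "g p (e i p) (e j p) = (if i = j then 1 else 0)" if "i < ?k" "j < ?k" for i j
    using e that by (auto simp: orthonormal_frame_def)
  have sp: "span ((\<lambda>i. e i q) ` {..<?k}) = vert q" if "q \<in> U" for q
    using e(2) that by (auto simp: orthonormal_frame_def)
  define Y where "Y q = (\<Sum>i<?k. g p v (e i p) *\<^sub>R e i q)" for q
  have "vector_field M U Y" unfolding Y_def
    by (intro M.vector_field_sum[OF U] M.vector_field_scaleR[OF U] M.smooth_fun_const ev) auto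
  moreover have Yp: "Y p = v" unfolding Y_def
    by (rule orthonormal_family_expand[where E = "\<lambda>i. e i p", OF RM.metric_bilinear[OF p] on, symmetric]) (use v sp[OF e(1)] in auto)
  ultimately obtain V where V: "vector_field M (points M) V" "\<exists>a>0. V p = a *\<^sub>R v"
    "\<forall>q\<in>points M. V q = 0 \<or> q \<in> U \<and> (\<exists>a. V q = a *\<^sub>R Y q)"
    using RM.cutoff_vector_field[OF U e(1), of Y] by auto
  have "V q \<in> vert q" if q: "q \<in> points M" for q
  proof (cases "V q = 0")
    case True
    then show ?thesis using subspace_0[OF subspace_vert[OF q]] by simp
  next
    case False
    then obtain a where a: "q \<in> U" "V q = a *\<^sub>R Y q" using V(3) q by blast
    have "Y q \<in> vert q" unfolding Y_def sp[OF a(1), symmetric] by (intro span_sum span_scale span_base) auto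
    then show ?thesis using subspace_scale[OF subspace_vert[OF q]] a by simp
  qed
  then show ?thesis using V by blast
qed

text \<open>The trace does not depend on the frames, and frames of both kinds exist near each point,
  so a condition on all frames of one kind carries over to the other.\<close>

lemma harmonic_iff_trace_nabla_vertical:
  "harmonic M g D N F DF \<longleftrightarrow>
    (\<forall>U e. orthonormal_frame M g vert U (DIM('e) - dim (UNIV :: 'f set)) e \<longrightarrow>
      (\<forall>p\<in>U. trace_nabla (DIM('e) - dim (UNIV :: 'f set)) e p \<in> vert p))" (is "_ \<longleftrightarrow> ?R")
proof
  assume H: "harmonic M g D N F DF"
  show ?R
  proof (intro allI impI ballI)
    fix U e p assume e: "orthonormal_frame M g vert U (DIM('e) - dim (UNIV :: 'f set)) e" and p: "p \<in> U"
    have "p \<in> points M" using e p openin_subset unfolding orthonormal_frame_def by blast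
    then obtain U' A where A: "p \<in> U'" "adapted_frame U' A" using ex_adapted_frame by blast
    have A': "orthonormal_frame M g (\<lambda>q. UNIV) U' DIM('e) A" using A(2) by (simp add: adapted_frame_def)
    have "(\<Sum>i<DIM('e). sff (A i) (A i) p) = 0" using H A' A(1) unfolding harmonic_def by simp
    then show "trace_nabla (DIM('e) - dim (UNIV :: 'f set)) e p \<in> vert p"
      using trace_sff_vertical_frame[OF A' A(1) e p] by (simp add: vert_iff)
  qed
next
  assume R: ?R
  show "harmonic M g D N F DF" unfolding harmonic_def
  proof (intro allI impI ballI)
    fix U E p assume E: "orthonormal_frame M g (\<lambda>p. UNIV) U (dim (UNIV :: 'e set)) E" and p: "p \<in> U"
    have "p \<in> points M" using E p openin_subset unfolding orthonormal_frame_def by blast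
    then obtain U' e where e: "p \<in> U'" "orthonormal_frame M g vert U' (DIM('e) - dim (UNIV :: 'f set)) e"
      using ex_vertical_frame by blast
    have "dF p (trace_nabla (DIM('e) - dim (UNIV :: 'f set)) e p) = 0" using R e by (simp add: vert_iff)
    then show "(\<Sum>i<dim (UNIV :: 'e set). sff (E i) (E i) p) = 0"
      using trace_sff_vertical_frame[OF _ p e(2,1), of E] E by simp
  qed
qed

end

section \<open>Submersions from Sasakian manifolds\<close>

locale sasakian_submersion = submersion M N F h DN DF g D + S: sasakian_manifold M g D \<phi> \<xi> \<eta>
  for M :: "('a, 'e::euclidean_space) manifold" and N :: "('b, 'f::real_inner) manifold"
    and F h DN DF g D \<phi> \<xi> \<eta> +
  assumes phi_vert: "p \<in> points M \<Longrightarrow> \<phi> p ` vertical M N F p = horizontal M g N F p"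
begin

text \<open>\<open>metric_phi\<close> is used with \<open>\<phi> p v\<close> in the second slot and
  \<open>\<phi>\<^sup>2\<close> is expanded; the \<open>\<eta>\<close> terms vanish by
  \<open>\<eta> \<circ> \<phi> = 0\<close>.\<close>

lemma phi_skew:
  assumes p: "p \<in> points M"
  shows "g p (\<phi> p u) v = - g p u (\<phi> p v)"
proof -
  note l = RM.metric_linear[OF p]
  have "g p (\<phi> p u) (\<phi> p (\<phi> p v)) = g p u (\<phi> p v)"
    using S.metric_phi[OF p, of u "\<phi> p v"] S.eta_phi[OF p] by simp
  moreover have "g p (\<phi> p u) (\<phi> p (\<phi> p v)) = - g p (\<phi> p u) v"
    using S.eta_metric[OF p, of "\<phi> p u"] S.eta_phi[OF p]
    by (simp add: S.phi_phi[OF p] linear_diff[OF l(1)] linear_scale[OF l(1)])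
  ultimately show ?thesis by simp
qed

lemma trace_phi_T_eq:
  assumes V: "vector_field M (points M) V" "\<And>q. q \<in> points M \<Longrightarrow> V q \<in> vert q"
    and e: "orthonormal_frame M g vert U k e" and p: "p \<in> U"
  shows "trace_phi_T M g D \<phi> N F k e V p = (real k - 1) * \<eta> p (V p) - g p (\<phi> p (V p)) (trace_nabla k e p)"
proof -
  have U: "mopen M U" and ev: "\<And>i. i < k \<Longrightarrow> vector_field M U (e i)"
    and on: "\<And>i j. i < k \<Longrightarrow> j < k \<Longrightarrow> g p (e i p) (e j p) = (if i = j then 1 else 0)"
    and sp: "\<And>q. q \<in> U \<Longrightarrow> span ((\<lambda>i. e i q) ` {..<k}) = vert q"
    using e p by (auto simp: orthonormal_frame_def)
  have UM: "q \<in> points M" if "q \<in> U" for q using openin_subset[OF U] that by blast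
  note pM = UM[OF p]
  note l = RM.metric_linear[OF pM]
  have evert: "e i q \<in> vert q" if "i < k" "q \<in> U" for i q
    unfolding sp[OF that(2), symmetric] using that by (intro span_base) auto
  have VU: "vector_field M U V" by (rule vector_field_subset[OF V(1) openin_subset[OF U]])
  have phie: "vector_field M U (\<lambda>q. \<phi> q (e i q))" if "i < k" for i by (rule S.phi_smooth[OF U ev[OF that]])
  have phih: "\<phi> q v \<in> horiz q" if "q \<in> points M" "v \<in> vert q" for q v
    using phi_vert[OF that(1)] that(2) by blast
  \<comment> \<open>On all of \<open>U\<close> the field \<open>e i\<close> has no horizontal part,
    so the second term of the tensor is the derivative of zero. Vanishing at \<open>p\<close> alone
    would not suffice.\<close>
  have T: "oneill_T M g D N F V (e i) p = hor M g N F p (D p (V p) (e i))" if i: "i < k" for i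
  proof -
    have vV: "ver M g N F p (V p) = V p" using ver_hor(1)[OF pM subspace_0[OF subspace_horiz[OF pM]] V(2)[OF pM]] by simp
    have ve: "ver M g N F q (e i q) = e i q" if "q \<in> U" for q
      using ver_hor(1)[OF UM[OF that] subspace_0[OF subspace_horiz[OF UM[OF that]]] evert[OF i that]] by simp
    have he: "hor M g N F q (e i q) = 0" if "q \<in> U" for q
      using ver_hor(2)[OF UM[OF that] subspace_0[OF subspace_horiz[OF UM[OF that]]] evert[OF i that]] by simp
    have "D p (V p) (\<lambda>q. ver M g N F q (e i q)) = D p (V p) (e i)"
      by (rule connection_cong[OF connection_M U M.vector_field_cong[OF U ev[OF i]] ev[OF i] ve p]) (simp_all add: ve)
    moreover have "D p (V p) (\<lambda>q. hor M g N F q (e i q)) = D p (V p) (\<lambda>q. 0)"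
      by (rule connection_cong[OF connection_M U M.vector_field_cong[OF U M.vector_field_zero[OF U]]
            M.vector_field_zero[OF U] he p]) (simp_all add: he)
    moreover have "D p (V p) (\<lambda>q. 0) = 0" by (rule connection_zero[OF connection_M U M.vector_field_zero[OF U] p])
    moreover have "ver M g N F p 0 = 0"
      using ver_hor(1)[OF pM subspace_0[OF subspace_horiz[OF pM]] subspace_0[OF subspace_vert[OF pM]]] by simp
    ultimately show ?thesis by (simp add: oneill_T_def vV)
  qed
  have summand: "g p (\<phi> p (oneill_T M g D N F V (e i) p)) (e i p)
     = \<eta> p (V p) - \<eta> p (e i p) * g p (e i p) (V p) - g p (\<phi> p (V p)) (D p (e i p) (e i))" if i: "i < k" for i
  proof -
    let ?h = "\<phi> p (e i p)"
    have hh: "?h \<in> horiz p" by (rule phih[OF pM evert[OF i p]])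
    have "g p (\<phi> p (oneill_T M g D N F V (e i) p)) (e i p) = - g p (hor M g N F p (D p (V p) (e i))) ?h"
      unfolding T[OF i] by (rule phi_skew[OF pM])
    \<comment> \<open>\<open>?h\<close> is horizontal, so dropping the projection adds only a
      vertical part that is orthogonal to it.\<close>
    also have "g p (hor M g N F p (D p (V p) (e i))) ?h = g p (D p (V p) (e i)) ?h"
    proof -
      obtain x y where xy: "x \<in> horiz p" "y \<in> vert p" "D p (V p) (e i) = x + y"
        using horiz_vert_decomposition[OF pM] by blast
      then show ?thesis
        using horizD[OF hh xy(2)] RM.metric_sym[OF pM, of y ?h] by (simp add: ver_hor(2)[OF pM] linear_add[OF l(2)])
    qed
    \<comment> \<open>Symmetry of \<open>sff\<close> on two vertical fields makes the difference of
      the two derivatives vertical, hence orthogonal to \<open>?h\<close>.\<close>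
    also have "\<dots> = g p (D p (e i p) V) ?h"
    proof -
      have "sff V (e i) p = - dF p (D p (V p) (e i))"
        by (rule sff_vertical[OF U ev[OF i] evert[OF i] p])
      moreover have "sff (e i) V p = - dF p (D p (e i p) V)"
        by (rule sff_vertical[OF U VU V(2)[OF UM] p])
      ultimately have "dF p (D p (V p) (e i)) = dF p (D p (e i p) V)"
        using sff_symmetric[OF U VU ev[OF i] p] by simp
      then have "D p (V p) (e i) - D p (e i p) V \<in> vert p"
        by (simp add: vert_iff linear_diff[OF differential_linear[OF pM]])
      from horizD[OF hh this] show ?thesis
        using RM.metric_sym[OF pM, of ?h] by (simp add: linear_diff[OF l(1)])
    qed
    \<comment> \<open>\<open>V\<close> is vertical and \<open>\<phi> e_i\<close> horizontal, so
      their inner product is constantly zero; differentiating it shifts the derivative from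
      \<open>V\<close> to \<open>\<phi> e_i\<close>.\<close>
    also have "\<dots> = - g p (V p) (D p (e i p) (\<lambda>q. \<phi> q (e i q)))"
    proof -
      have "dir_deriv M p (e i p) (\<lambda>q. g q (V q) (\<phi> q (e i q))) = dir_deriv M p (e i p) (\<lambda>q. 0)"
      proof (rule M.dir_deriv_cong[OF U p])
        fix q assume q: "q \<in> U"
        show "g q (V q) (\<phi> q (e i q)) = 0"
          using horizD[OF phih[OF UM[OF q] evert[OF i q]] V(2)[OF UM[OF q]]] RM.metric_sym[OF UM[OF q]] by simp
      qed
      then show ?thesis
        using levi_civita_metric[OF levi_civita_M U VU phie[OF i] p, of "e i p"] by simp
    qed
    \<comment> \<open>The Sasakian identity for the field \<open>e i\<close> in its own direction;
      the coefficient of \<open>\<xi>\<close> is \<open>g p (e i p) (e i p) = 1\<close>.\<close>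
    also have "D p (e i p) (\<lambda>q. \<phi> q (e i q)) = \<phi> p (D p (e i p) (e i)) + \<xi> p - \<eta> p (e i p) *\<^sub>R e i p"
      using S.nabla_phi[OF U ev[OF i] p, of "e i p"] on[OF i i] by (simp add: algebra_simps)
    finally show ?thesis
      using phi_skew[OF pM, of "V p" "D p (e i p) (e i)"] S.eta_metric[OF pM, of "V p"] RM.metric_sym[OF pM, of "V p" "e i p"]
      by (simp add: linear_diff[OF l(1)] linear_add[OF l(1)] linear_scale[OF l(1)])
  qed
  \<comment> \<open>Expanding \<open>V\<close> in the frame evaluates the middle terms of all
    summands together to one \<open>\<eta>(V)\<close>, which turns the factor \<open>k\<close> into
    \<open>k - 1\<close>.\<close>
  have "V p = (\<Sum>i<k. g p (V p) (e i p) *\<^sub>R e i p)"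
    by (rule orthonormal_family_expand[where E = "\<lambda>i. e i p", OF RM.metric_bilinear[OF pM] on]) (use V(2)[OF pM] sp[OF p] in auto)
  then have "\<eta> p (V p) = \<eta> p (\<Sum>i<k. g p (V p) (e i p) *\<^sub>R e i p)" by simp
  also have "\<dots> = (\<Sum>i<k. \<eta> p (e i p) * g p (e i p) (V p))"
    by (simp add: linear_sum[OF S.eta_linear[OF pM]] linear_scale[OF S.eta_linear[OF pM]] RM.metric_sym[OF pM, of "V p"] mult.commute)
  finally have eta: "(\<Sum>i<k. \<eta> p (e i p) * g p (e i p) (V p)) = \<eta> p (V p)" by simp
  have "trace_phi_T M g D \<phi> N F k e V p =
    (\<Sum>i<k. \<eta> p (V p) - \<eta> p (e i p) * g p (e i p) (V p) - g p (\<phi> p (V p)) (D p (e i p) (e i)))"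
    unfolding trace_phi_T_def by (intro sum.cong refl summand) simp
  also have "\<dots> = (real k - 1) * \<eta> p (V p) - g p (\<phi> p (V p)) (trace_nabla k e p)"
    by (simp add: sum_subtractf eta trace_nabla_def linear_sum[OF l(1)] left_diff_distrib)
  finally show ?thesis .
qed

lemma harmonic_iff_trace:
  fixes m n :: nat
  assumes m: "DIM('e) = 2 * m + 1" and n: "dim (UNIV :: 'f set) = n"
  shows "harmonic M g D N F DF \<longleftrightarrow>
    (\<forall>V. vector_field M (points M) V \<and> (\<forall>p\<in>points M. V p \<in> vert p) \<longrightarrow>
      (\<forall>U e. orthonormal_frame M g vert U (2 * m + 1 - n) e \<longrightarrow>
        (\<forall>p\<in>U. trace_phi_T M g D \<phi> N F (2 * m + 1 - n) e V p = (2 * real m - real n) * \<eta> p (V p))))"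
    (is "_ \<longleftrightarrow> ?R")
proof -
  let ?k = "2 * m + 1 - n"
  \<comment> \<open>A point of \<open>M\<close> carries an adapted frame, which yields
    \<open>n \<le> 2 * m + 1\<close>; so the subtraction of natural numbers is not
    truncated.\<close>
  have k: "real ?k - 1 = 2 * real m - real n" if p: "p \<in> points M" for p
  proof -
    have "n \<le> DIM('e)" using ex_adapted_frame[OF p] n by (auto simp: adapted_frame_def)
    then show ?thesis using m by (simp add: of_nat_diff)
  qed
  have H: "harmonic M g D N F DF \<longleftrightarrow>
    (\<forall>U e. orthonormal_frame M g vert U ?k e \<longrightarrow> (\<forall>p\<in>U. trace_nabla ?k e p \<in> vert p))"
    using harmonic_iff_trace_nabla_vertical m n by simp
  have phih: "\<phi> p v \<in> horiz p" if "p \<in> points M" "v \<in> vert p" for p v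
    using phi_vert[OF that(1)] that(2) by blast
  have frame_point: "p \<in> points M" if "orthonormal_frame M g vert U ?k e" "p \<in> U" for U e p
    using that openin_subset unfolding orthonormal_frame_def by blast
  show ?thesis
  proof
    assume "harmonic M g D N F DF"
    then have trace_nabla: "trace_nabla ?k e p \<in> vert p" if "orthonormal_frame M g vert U ?k e" "p \<in> U" for U e p
      using H that by blast
    show ?R
    proof (intro allI impI ballI, elim conjE)
      fix V U e p assume V: "vector_field M (points M) V" "\<forall>p\<in>points M. V p \<in> vert p"
        and e: "orthonormal_frame M g vert U ?k e" and p: "p \<in> U"
      have pM: "p \<in> points M" by (rule frame_point[OF e p])
      have "trace_phi_T M g D \<phi> N F ?k e V p = (real ?k - 1) * \<eta> p (V p) - g p (\<phi> p (V p)) (trace_nabla ?k e p)"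
        by (rule trace_phi_T_eq[OF V(1) _ e p]) (use V(2) in blast)
      moreover have "g p (\<phi> p (V p)) (trace_nabla ?k e p) = 0"
        by (rule horizD[OF phih[OF pM] trace_nabla[OF e p]]) (use V(2) pM in blast)
      ultimately show "trace_phi_T M g D \<phi> N F ?k e V p = (2 * real m - real n) * \<eta> p (V p)"
        using k[OF pM] by simp
    qed
  next
    assume R: ?R
    show "harmonic M g D N F DF" unfolding H
    proof (intro allI impI ballI)
      fix U e p assume e: "orthonormal_frame M g vert U ?k e" and p: "p \<in> U"
      have pM: "p \<in> points M" by (rule frame_point[OF e p])
      have "g p w (trace_nabla ?k e p) = 0" if w: "w \<in> horiz p" for w
      proof -
        \<comment> \<open>The trace condition is tested on a global vertical field whose value at
          \<open>p\<close> is a positive multiple of the preimage \<open>v\<close> of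
          \<open>w\<close>; the factor \<open>a\<close> cancels at the end.\<close>
        obtain v where v: "v \<in> vert p" "w = \<phi> p v" using w phi_vert[OF pM] by blast
        obtain V a where V: "vector_field M (points M) V" "\<forall>q\<in>points M. V q \<in> vert q" "a > 0" "V p = a *\<^sub>R v"
          using ex_vertical_field[OF pM v(1)] by blast
        have "trace_phi_T M g D \<phi> N F ?k e V p = (real ?k - 1) * \<eta> p (V p) - g p (\<phi> p (V p)) (trace_nabla ?k e p)"
          by (rule trace_phi_T_eq[OF V(1) _ e p]) (use V(2) in blast)
        moreover have "trace_phi_T M g D \<phi> N F ?k e V p = (2 * real m - real n) * \<eta> p (V p)"
          using R V(1,2) e p by simp
        ultimately have "g p (\<phi> p (V p)) (trace_nabla ?k e p) = 0" using k[OF pM] by simp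
        then show ?thesis
          using V(3) by (simp add: V(4) v(2) linear_scale[OF S.phi_linear[OF pM]] linear_scale[OF RM.metric_linear(2)[OF pM]])
      qed
      then show "trace_nabla ?k e p \<in> vert p" using vert_iff_orthogonal[OF pM] by blast
    qed
  qed
qed

end

theorem theorem6:
  fixes M :: "('a, 'e::euclidean_space) manifold"
    and N :: "('b, 'f::real_inner) manifold"
    and gM :: "'a \<Rightarrow> 'e \<Rightarrow> 'e \<Rightarrow> real"
    and gN :: "'b \<Rightarrow> 'f \<Rightarrow> 'f \<Rightarrow> real"
    and \<phi> :: "'a \<Rightarrow> 'e \<Rightarrow> 'e"
    and \<xi> :: "'a \<Rightarrow> 'e"
    and \<eta> :: "'a \<Rightarrow> 'e \<Rightarrow> real"
    and F :: "'a \<Rightarrow> 'b"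
    and nablaM :: "'a \<Rightarrow> 'e \<Rightarrow> ('a \<Rightarrow> 'e) \<Rightarrow> 'e"
    and nablaN :: "'b \<Rightarrow> 'f \<Rightarrow> ('b \<Rightarrow> 'f) \<Rightarrow> 'f"
    and nablaF :: "'a \<Rightarrow> 'e \<Rightarrow> ('a \<Rightarrow> 'f) \<Rightarrow> 'f"
    and m n :: nat
  assumes "sasakian_manifold M gM nablaM \<phi> \<xi> \<eta>"
    and "DIM('e) = 2 * m + 1"
    and "riemannian_manifold N gN"
    and "dim (UNIV :: 'f set) = n"
    and "levi_civita N gN nablaN"
    and "pullback_connection M N F nablaN nablaF"
    and "riemannian_submersion M gM N gN F"
    and "anti_invariant M gM \<phi> N F"
    and "\<And>p. p \<in> points M \<Longrightarrow> \<phi> p ` vertical M N F p = horizontal M gM N F p"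
  shows "harmonic M gM nablaM N F nablaF \<longleftrightarrow>
    (\<forall>V. vector_field M (points M) V \<and> (\<forall>p\<in>points M. V p \<in> vertical M N F p) \<longrightarrow>
      (\<forall>U e. orthonormal_frame M gM (vertical M N F) U (2 * m + 1 - n) e \<longrightarrow>
        (\<forall>p\<in>U. trace_phi_T M gM nablaM \<phi> N F (2 * m + 1 - n) e V p =
                 (2 * real m - real n) * \<eta> p (V p))))"
proof -
  interpret S: sasakian_manifold M gM nablaM \<phi> \<xi> \<eta> by fact
  interpret N: riemannian_manifold N gN by fact
  interpret sasakian_submersion M N F gN nablaN nablaF gM nablaM \<phi> \<xi> \<eta>
  proof unfold_locales
    show "smooth_map M N F" using assms(7) by (simp add: riemannian_submersion_def)
  qed (use assms S.levi_civita in auto)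
  show ?thesis by (rule harmonic_iff_trace[OF assms(2,4)])
qed

end
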